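(* Let a connected Lie group $G$ act freely and properly on the left on a smooth manifold $Q$, and let $L\in C^\infty(T^1_kQ)$ be a regular Lagrangian that is invariant under the lifted $G$-action and $G$-regular. Then the mechanical $k$-connection of $L$ is a principal $k$-connection on the principal bundle $T^1_kQ\to(T^1_kQ)/G$.
   Context: Everything is smooth; repeated indices are summed. $T^1_kN=TN\oplus\cdots\oplus TN$ ($k$ copies) for a manifold $N$; $\tau^1_Q:T^1_kQ\to Q$; natural coordinates $(q^A,u^A_\alpha)$ on $T^1_kQ$, $\alpha=1,\dots,k$. $G$ acts on $T^1_kQ$ by $g\cdot(v_1,\dots,v_k)=(T\Phi_g v_1,\dots,T\Phi_g v_k)$. $L$ is regular if $\left(\frac{\partial^2L}{\partial u^A_\alpha\partial u^B_\beta}\right)$ is everywhere non-singular. For $\mathbf v\in T^1_kQ$ over $q\in Q$ define bilinear maps $g_{\mathbf v}^{\alpha,\beta}:T_qQ\times T_qQ\to\mathbb R$ by $$g_{\mathbf v}^{\alpha,\beta}(u,w)=\frac{\partial^2L}{\partial u^A_\alpha\partial u^B_\beta}(\mathbf v)\,u^Aw^B,$$ and the symmetric bilinear map $g_{\mathbf v}(\mathbf u,\mathbf w)=g^{\alpha,\beta}_{\mathbf v}(u_\alpha,w_\beta)$ for $\mathbf u=(u_\alpha),\mathbf w=(w_\beta)\in(T^1_kQ)_q$. Let $\{E_a\}$ be a basis of the Lie algebra $\mathfrak g$ and $\widetilde E_a$ the corresponding fundamental vector fields on $Q$. $L$ is $G$-regular if the matrix with entries $g^{\alpha\beta}_{ab}(\mathbf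 v)=g_{\mathbf v}^{\alpha,\beta}(\widetilde E_a(q),\widetilde E_b(q))$ (rows $(\alpha,a)$, columns $(\beta,b)$) is non-singular for every $\mathbf v$. For a principal bundle $\pi:M\to M/G$, a $k$-connection is a linear bundle map $\gamma^k:M\times_{M/G}T^1_k(M/G)\to T^1_kM$ over $M$ that is a right inverse of $T^1_kM\to M\times_{M/G}T^1_k(M/G)$, $(v_1,\dots,v_k)\mapsto(m,T\pi(v_1),\dots,T\pi(v_k))$; equivalently, a smooth subbundle of $T^1_kM$ (the horizontal elements) complementary to $(VM)^k$, $VM=\ker T\pi$. Let $\omega^k:T^1_kM\to(VM)^k$ be the corresponding vertical projection. The $k$-connection is principal if $\omega^k(g\mathbf w)=g\,\omega^k(\mathbf w)$ for all $g\in G$, $\mathbf w\in T^1_kM$ ($G$ acting componentwise by the tangent action). The mechanical $k$-connection of $L$ (with $M=T^1_kQ$) is defined by declaring $\mathbf W=(W_1,\dots,W_k)\in T^1_k(T^1_kQ)$ at $\mathbf v\in T^1_kQ$, with $q=\tau^1_Q(\mathbf v)$, to be horizontal if $$g_{\mathbf v}\big((T\tau^1_Q(W_1),\dots,T\tau^1_Q(W_k)),\,((\xi_1)_Q(q),\dots,(\xi_k)_Q(q))\big)=0\quad\text{for all }(\xi_1,\dots,\xi_k)\in\mathfrak g^k,$$ where $\xi_Q$ is the fundamental vector field of $\xi$ on $Q$. *)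

theory Defs
  imports "HOL-Analysis.Analysis" "HOL-Algebra.Group_Action"
begin

section \<open>Smooth maps between open subsets of Euclidean spaces\<close>

primrec Ck_on :: "nat \<Rightarrow> 'a::euclidean_space set \<Rightarrow> ('a \<Rightarrow> 'b::euclidean_space) \<Rightarrow> bool" where
  "Ck_on 0 S f \<longleftrightarrow> continuous_on S f"
| "Ck_on (Suc r) S f \<longleftrightarrow> (\<forall>x\<in>S. f differentiable (at x)) \<and>
     (\<forall>b. Ck_on r S (\<lambda>x. frechet_derivative f (at x) b))"

definition smooth_on :: "'a::euclidean_space set \<Rightarrow> ('a \<Rightarrow> 'b::euclidean_space) \<Rightarrow> bool" where
  "smooth_on S f \<longleftrightarrow> (\<forall>r. Ck_on r S f)"

section \<open>Manifolds\<close>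

text \<open>A manifold is given by an atlas: a set of charts (domain, coordinate map). Its underlying set
  is the union of the chart domains; the values of a coordinate map outside its domain are irrelevant.
  The atlas need not be maximal.\<close>

type_synonym ('a, 'e) chart = "'a set \<times> ('a \<Rightarrow> 'e)"
type_synonym ('a, 'e) atlas = "('a, 'e) chart set"

definition chart_inv :: "('a, 'e) chart \<Rightarrow> 'e \<Rightarrow> 'a" where
  "chart_inv c = inv_into (fst c) (snd c)"

definition mcarrier :: "('a, 'e) atlas \<Rightarrow> 'a set" where
  "mcarrier A = \<Union>(fst ` A)"

definition mtopology :: "('a, 'e::euclidean_space) atlas \<Rightarrow> 'a topology" where
  "mtopology A = topology (\<lambda>S. S \<subseteq> mcarrier A \<and> (\<forall>c\<in>A. open (snd c ` (S \<inter> fst c))))"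

definition smooth_manifold :: "('a, 'e::euclidean_space) atlas \<Rightarrow> bool" where
  "smooth_manifold A \<longleftrightarrow>
     (\<forall>c\<in>A. inj_on (snd c) (fst c)) \<and>
     (\<forall>c\<in>A. \<forall>d\<in>A. open (snd c ` (fst c \<inter> fst d)) \<and>
        smooth_on (snd c ` (fst c \<inter> fst d)) (snd d \<circ> chart_inv c)) \<and>
     Hausdorff_space (mtopology A) \<and> second_countable (mtopology A)"

text \<open>Openness of the set on which the local representative lives amounts to continuity of the map.\<close>

definition smooth_map ::
  "('a, 'e::euclidean_space) atlas \<Rightarrow> ('b, 'f::euclidean_space) atlas \<Rightarrow> ('a \<Rightarrow> 'b) \<Rightarrow> bool" where
  "smooth_map A B f \<longleftrightarrow> f \<in> mcarrier A \<rightarrow> mcarrier B \<and>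
     (\<forall>c\<in>A. \<forall>d\<in>B.
        open (snd c ` {p \<in> fst c. f p \<in> fst d}) \<and>
        smooth_on (snd c ` {p \<in> fst c. f p \<in> fst d}) (snd d \<circ> f \<circ> chart_inv c))"

definition euclidean_atlas :: "('e, 'e::euclidean_space) atlas" where
  "euclidean_atlas = {(UNIV, id)}"

definition prod_atlas ::
  "('a, 'e::euclidean_space) atlas \<Rightarrow> ('b, 'f::euclidean_space) atlas \<Rightarrow> ('a \<times> 'b, 'e \<times> 'f) atlas" where
  "prod_atlas A B = {(fst c \<times> fst d, map_prod (snd c) (snd d)) | c d. c \<in> A \<and> d \<in> B}"

definition sub_atlas :: "('a, 'e) atlas \<Rightarrow> 'a set \<Rightarrow> ('a, 'e) atlas" where
  "sub_atlas A U = (\<lambda>c. (fst c \<inter> U, snd c)) ` A"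

section \<open>Tangent vectors and the bundle \<open>T\<^sup>1\<^sub>k\<close>\<close>

text \<open>A tangent vector at \<open>p\<close> is the family of its coordinate representatives in all charts around \<open>p\<close>,
  related by the derivatives of the chart changes (and 0 at all other indices).\<close>

definition tangent_space ::
  "('a, 'e::euclidean_space) atlas \<Rightarrow> 'a \<Rightarrow> (('a, 'e) chart \<Rightarrow> 'e) set" where
  "tangent_space A p = {v.
     (\<forall>c\<in>A. \<forall>d\<in>A. p \<in> fst c \<inter> fst d \<longrightarrow>
        v d = frechet_derivative (snd d \<circ> chart_inv c) (at (snd c p)) (v c)) \<and>
     (\<forall>c. \<not> (c \<in> A \<and> p \<in> fst c) \<longrightarrow> v c = 0)}"

definition chart_at :: "('a, 'e) atlas \<Rightarrow> 'a \<Rightarrow> ('a, 'e) chart" where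
  "chart_at A p = (SOME c. c \<in> A \<and> p \<in> fst c)"

text \<open>For smooth \<open>f\<close> the tangent map does not depend on the chart chosen at \<open>p\<close>.\<close>

definition tangent_map ::
  "('a, 'e::euclidean_space) atlas \<Rightarrow> ('b, 'f::euclidean_space) atlas \<Rightarrow> ('a \<Rightarrow> 'b) \<Rightarrow> 'a \<Rightarrow>
   (('a, 'e) chart \<Rightarrow> 'e) \<Rightarrow> (('b, 'f) chart \<Rightarrow> 'f)" where
  "tangent_map A B f p v = (\<lambda>d. if d \<in> B \<and> f p \<in> fst d
     then frechet_derivative (snd d \<circ> f \<circ> chart_inv (chart_at A p))
            (at (snd (chart_at A p) p)) (v (chart_at A p))
     else 0)"

text \<open>Elements of \<open>T\<^sup>1\<^sub>kN\<close>: a base point together with \<open>k\<close> tangent vectors there;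
  the copies are indexed by a finite type \<open>'k\<close>.\<close>

type_synonym ('k, 'a, 'e) ktangent = "'a \<times> ('k \<Rightarrow> ('a, 'e) chart \<Rightarrow> 'e)"

definition Tk_set :: "('a, 'e::euclidean_space) atlas \<Rightarrow> ('k::finite, 'a, 'e) ktangent set" where
  "Tk_set A = {(p, v). p \<in> mcarrier A \<and> (\<forall>\<alpha>. v \<alpha> \<in> tangent_space A p)}"

text \<open>The natural chart \<open>(q\<^sup>A, u\<^sup>A\<^sub>\<alpha>)\<close> induced by a chart \<open>(q\<^sup>A)\<close>.\<close>

definition Tk_chart ::
  "('a, 'e::euclidean_space) atlas \<Rightarrow> ('a, 'e) chart \<Rightarrow>
   (('k::finite, 'a, 'e) ktangent, 'e \<times> ('e ^ 'k)) chart" where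
  "Tk_chart A c = ({w \<in> Tk_set A. fst w \<in> fst c}, \<lambda>w. (snd c (fst w), \<chi> \<alpha>. snd w \<alpha> c))"

definition Tk ::
  "('a, 'e::euclidean_space) atlas \<Rightarrow> (('k::finite, 'a, 'e) ktangent, 'e \<times> ('e ^ 'k)) atlas" where
  "Tk A = Tk_chart A ` A"

definition Tk_map ::
  "('a, 'e::euclidean_space) atlas \<Rightarrow> ('b, 'f::euclidean_space) atlas \<Rightarrow> ('a \<Rightarrow> 'b) \<Rightarrow>
   ('k, 'a, 'e) ktangent \<Rightarrow> ('k, 'b, 'f) ktangent" where
  "Tk_map A B f w = (f (fst w), \<lambda>\<alpha>. tangent_map A B f (fst w) (snd w \<alpha>))"

section \<open>Lie groups and their actions\<close>

definition lie_group ::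
  "('g, 'z) monoid_scheme \<Rightarrow> ('g, 'h::euclidean_space) atlas \<Rightarrow> bool" where
  "lie_group G AG \<longleftrightarrow> group G \<and> smooth_manifold AG \<and> mcarrier AG = carrier G \<and>
     smooth_map (prod_atlas AG AG) AG (\<lambda>(g, h). g \<otimes>\<^bsub>G\<^esub> h) \<and>
     smooth_map AG AG (\<lambda>g. inv\<^bsub>G\<^esub> g)"

definition smooth_action ::
  "('g, 'z) monoid_scheme \<Rightarrow> ('g, 'h::euclidean_space) atlas \<Rightarrow> ('a, 'e::euclidean_space) atlas \<Rightarrow>
   ('g \<Rightarrow> 'a \<Rightarrow> 'a) \<Rightarrow> bool" where
  "smooth_action G AG A \<Phi> \<longleftrightarrow> group_action G (mcarrier A) \<Phi> \<and>
     smooth_map (prod_atlas AG A) A (\<lambda>(g, p). \<Phi> g p)"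

definition free_action :: "('g, 'z) monoid_scheme \<Rightarrow> 'a set \<Rightarrow> ('g \<Rightarrow> 'a \<Rightarrow> 'a) \<Rightarrow> bool" where
  "free_action G M \<Phi> \<longleftrightarrow> (\<forall>p\<in>M. stabilizer G \<Phi> p = {\<one>\<^bsub>G\<^esub>})"

definition proper_action ::
  "('g, 'h::euclidean_space) atlas \<Rightarrow> ('a, 'e::euclidean_space) atlas \<Rightarrow> ('g \<Rightarrow> 'a \<Rightarrow> 'a) \<Rightarrow> bool" where
  "proper_action AG A \<Phi> \<longleftrightarrow>
     proper_map (prod_topology (mtopology AG) (mtopology A))
       (prod_topology (mtopology A) (mtopology A)) (\<lambda>(g, p). (\<Phi> g p, p))"

text \<open>The componentwise tangent action. The restriction to the underlying set is there because the
  library's actions take values in extensional bijections.\<close>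

definition lift_action ::
  "('a, 'e::euclidean_space) atlas \<Rightarrow> ('g \<Rightarrow> 'a \<Rightarrow> 'a) \<Rightarrow> 'g \<Rightarrow>
   ('k::finite, 'a, 'e) ktangent \<Rightarrow> ('k, 'a, 'e) ktangent" where
  "lift_action A \<Phi> g = restrict (Tk_map A A (\<Phi> g)) (Tk_set A)"

abbreviation lie_algebra ::
  "('g, 'z) monoid_scheme \<Rightarrow> ('g, 'h::euclidean_space) atlas \<Rightarrow> (('g, 'h) chart \<Rightarrow> 'h) set" where
  "lie_algebra G AG \<equiv> tangent_space AG \<one>\<^bsub>G\<^esub>"

definition lie_algebra_basis ::
  "('g, 'z) monoid_scheme \<Rightarrow> ('g, 'h::euclidean_space) atlas \<Rightarrow>
   ('i::finite \<Rightarrow> ('g, 'h) chart \<Rightarrow> 'h) \<Rightarrow> bool" where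
  "lie_algebra_basis G AG E \<longleftrightarrow> (\<forall>a. E a \<in> lie_algebra G AG) \<and>
     (\<forall>\<xi>\<in>lie_algebra G AG. \<exists>!x::real ^ 'i. \<xi> = (\<lambda>c. \<Sum>a\<in>UNIV. (x $ a) *\<^sub>R E a c))"

text \<open>The value at \<open>p\<close> of the fundamental vector field of \<open>\<xi>\<close>, i.e. of
  \<open>d/dt exp(t\<xi>)\<cdot>p\<close> at \<open>t = 0\<close>, as the derivative at the unit of the orbit map.\<close>

definition fundamental ::
  "('g, 'z) monoid_scheme \<Rightarrow> ('g, 'h::euclidean_space) atlas \<Rightarrow> ('a, 'e::euclidean_space) atlas \<Rightarrow>
   ('g \<Rightarrow> 'a \<Rightarrow> 'a) \<Rightarrow> (('g, 'h) chart \<Rightarrow> 'h) \<Rightarrow> 'a \<Rightarrow> (('a, 'e) chart \<Rightarrow> 'e)" where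
  "fundamental G AG A \<Phi> \<xi> p = tangent_map AG A (\<lambda>g. \<Phi> g p) \<one>\<^bsub>G\<^esub> \<xi>"

text \<open>\<open>P\<close> is the quotient manifold \<open>M/G\<close>: the orbit set with the (unique) smooth structure for which
  the projection to orbits is a submersion.\<close>

definition quotient_manifold ::
  "('g, 'z) monoid_scheme \<Rightarrow> ('a, 'e::euclidean_space) atlas \<Rightarrow> ('g \<Rightarrow> 'a \<Rightarrow> 'a) \<Rightarrow>
   ('a set, 'p::euclidean_space) atlas \<Rightarrow> bool" where
  "quotient_manifold G A \<Phi> P \<longleftrightarrow> smooth_manifold P \<and>
     mcarrier P = orbits G (mcarrier A) \<Phi> \<and>
     smooth_map A P (orbit G \<Phi>) \<and>
     (\<forall>m\<in>mcarrier A. tangent_map A P (orbit G \<Phi>) m ` tangent_space A m =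
        tangent_space P (orbit G \<Phi> m))"

section \<open>Principal \<open>k\<close>-connections\<close>

definition vertical_space ::
  "('a, 'e::euclidean_space) atlas \<Rightarrow> ('b, 'f::euclidean_space) atlas \<Rightarrow> ('a \<Rightarrow> 'b) \<Rightarrow> 'a \<Rightarrow>
   (('a, 'e) chart \<Rightarrow> 'e) set" where
  "vertical_space A P \<pi> m = {v \<in> tangent_space A m. tangent_map A P \<pi> m v = (\<lambda>_. 0)}"

text \<open>A smooth vector subbundle \<open>H\<close> of \<open>T\<^sup>1\<^sub>kM\<close>: near each point its fibres are spanned by a pointwise
  linearly independent finite family \<open>s 0, \<dots>, s (r - 1)\<close> of smooth local sections of \<open>T\<^sup>1\<^sub>kM\<close>.\<close>

definition smooth_subbundle ::
  "('a, 'e::euclidean_space) atlas \<Rightarrow> ('k::finite, 'a, 'e) ktangent set \<Rightarrow> bool" where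
  "smooth_subbundle A H \<longleftrightarrow> H \<subseteq> Tk_set A \<and>
     (\<forall>m\<in>mcarrier A. \<exists>U (r::nat) (s :: nat \<Rightarrow> 'a \<Rightarrow> 'k \<Rightarrow> ('a, 'e) chart \<Rightarrow> 'e).
        openin (mtopology A) U \<and> m \<in> U \<and>
        (\<forall>i<r. smooth_map (sub_atlas A U) (Tk A) (\<lambda>p. (p, s i p))) \<and>
        (\<forall>p\<in>U.
           {w. (p, w) \<in> H} = range (\<lambda>x. \<lambda>\<alpha> c. \<Sum>i<r. (x i :: real) *\<^sub>R s i p \<alpha> c) \<and>
           (\<forall>x. (\<lambda>\<alpha> c. \<Sum>i<r. (x i :: real) *\<^sub>R s i p \<alpha> c) = (\<lambda>\<alpha> c. 0) \<longrightarrow> (\<forall>i<r. x i = 0))))"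

text \<open>A \<open>k\<close>-connection, given by its horizontal elements: a smooth subbundle of \<open>T\<^sup>1\<^sub>kM\<close>
  complementary to \<open>(VM)\<^sup>k\<close>.\<close>

definition k_connection ::
  "('a, 'e::euclidean_space) atlas \<Rightarrow> ('b, 'f::euclidean_space) atlas \<Rightarrow> ('a \<Rightarrow> 'b) \<Rightarrow>
   ('k::finite, 'a, 'e) ktangent set \<Rightarrow> bool" where
  "k_connection A P \<pi> H \<longleftrightarrow> smooth_subbundle A H \<and>
     (\<forall>(m, w)\<in>Tk_set A. \<exists>!u. (\<forall>\<alpha>. u \<alpha> \<in> vertical_space A P \<pi> m) \<and>
        (m, \<lambda>\<alpha> c. w \<alpha> c - u \<alpha> c) \<in> H)"

definition vertical_projection ::
  "('a, 'e::euclidean_space) atlas \<Rightarrow> ('b, 'f::euclidean_space) atlas \<Rightarrow> ('a \<Rightarrow> 'b) \<Rightarrow>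
   ('k::finite, 'a, 'e) ktangent set \<Rightarrow> ('k, 'a, 'e) ktangent \<Rightarrow> ('k, 'a, 'e) ktangent" where
  "vertical_projection A P \<pi> H w = (fst w, THE u. (\<forall>\<alpha>. u \<alpha> \<in> vertical_space A P \<pi> (fst w)) \<and>
        (fst w, \<lambda>\<alpha> c. snd w \<alpha> c - u \<alpha> c) \<in> H)"

definition principal_k_connection ::
  "('g, 'z) monoid_scheme \<Rightarrow> ('a, 'e::euclidean_space) atlas \<Rightarrow> ('g \<Rightarrow> 'a \<Rightarrow> 'a) \<Rightarrow>
   ('a set, 'p::euclidean_space) atlas \<Rightarrow> ('k::finite, 'a, 'e) ktangent set \<Rightarrow> bool" where
  "principal_k_connection G A \<Phi> P H \<longleftrightarrow> k_connection A P (orbit G \<Phi>) H \<and>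
     (\<forall>g\<in>carrier G. \<forall>w\<in>Tk_set A.
        vertical_projection A P (orbit G \<Phi>) H (lift_action A \<Phi> g w) =
        lift_action A \<Phi> g (vertical_projection A P (orbit G \<Phi>) H w))"

section \<open>Lagrangians\<close>

type_synonym ('k, 'q, 'n) lagrangian = "('k, 'q, real ^ 'n) ktangent \<Rightarrow> real"

definition partial :: "('e::euclidean_space \<Rightarrow> real) \<Rightarrow> 'e \<Rightarrow> 'e \<Rightarrow> real" where
  "partial f b x = frechet_derivative f (at x) b"

text \<open>\<open>\<partial>\<^sup>2L / \<partial>u\<^sup>A\<^sub>\<alpha> \<partial>u\<^sup>B\<^sub>\<beta>\<close> at \<open>v\<close>, in the natural coordinates induced by the chart \<open>c\<close>; the
  coordinate direction of \<open>u\<^sup>A\<^sub>\<alpha>\<close> is \<open>(0, axis \<alpha> (axis A 1))\<close>.\<close>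

definition fibre_hessian ::
  "('q, real ^ 'n) atlas \<Rightarrow> ('k::finite, 'q, 'n::finite) lagrangian \<Rightarrow> ('q, real ^ 'n) chart \<Rightarrow>
   ('k, 'q, real ^ 'n) ktangent \<Rightarrow> 'k \<Rightarrow> 'n \<Rightarrow> 'k \<Rightarrow> 'n \<Rightarrow> real" where
  "fibre_hessian Q L c v \<alpha> A \<beta> B =
     partial (partial (L \<circ> chart_inv (Tk_chart Q c)) (0, axis \<beta> (axis B 1)))
       (0, axis \<alpha> (axis A 1)) (snd (Tk_chart Q c) v)"

definition regular_lagrangian ::
  "('q, real ^ 'n) atlas \<Rightarrow> ('k::finite, 'q, 'n::finite) lagrangian \<Rightarrow> bool" where
  "regular_lagrangian Q L \<longleftrightarrow> (\<forall>c\<in>Q. \<forall>v\<in>Tk_set Q. fst v \<in> fst c \<longrightarrow>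
     invertible ((\<chi> i j. fibre_hessian Q L c v (fst i) (snd i) (fst j) (snd j))
       :: real ^ ('k \<times> 'n) ^ ('k \<times> 'n)))"

definition invariant_lagrangian ::
  "('g, 'z) monoid_scheme \<Rightarrow> ('q, real ^ 'n) atlas \<Rightarrow> ('g \<Rightarrow> 'q \<Rightarrow> 'q) \<Rightarrow>
   ('k::finite, 'q, 'n::finite) lagrangian \<Rightarrow> bool" where
  "invariant_lagrangian G Q \<Phi> L \<longleftrightarrow>
     (\<forall>g\<in>carrier G. \<forall>v\<in>Tk_set Q. L (lift_action Q \<Phi> g v) = L v)"

text \<open>The bilinear maps \<open>g\<^sub>v\<^bsup>\<alpha>,\<beta>\<^esup>\<close>; the value does not depend on the chart chosen at the base point.\<close>

definition g_comp ::
  "('q, real ^ 'n) atlas \<Rightarrow> ('k::finite, 'q, 'n::finite) lagrangian \<Rightarrow> ('k, 'q, real ^ 'n) ktangent \<Rightarrow>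
   'k \<Rightarrow> 'k \<Rightarrow> (('q, real ^ 'n) chart \<Rightarrow> real ^ 'n) \<Rightarrow> (('q, real ^ 'n) chart \<Rightarrow> real ^ 'n) \<Rightarrow> real" where
  "g_comp Q L v \<alpha> \<beta> u w = (let c = chart_at Q (fst v) in
     \<Sum>A\<in>UNIV. \<Sum>B\<in>UNIV. fibre_hessian Q L c v \<alpha> A \<beta> B * u c $ A * w c $ B)"

definition g_total ::
  "('q, real ^ 'n) atlas \<Rightarrow> ('k::finite, 'q, 'n::finite) lagrangian \<Rightarrow> ('k, 'q, real ^ 'n) ktangent \<Rightarrow>
   ('k \<Rightarrow> ('q, real ^ 'n) chart \<Rightarrow> real ^ 'n) \<Rightarrow> ('k \<Rightarrow> ('q, real ^ 'n) chart \<Rightarrow> real ^ 'n) \<Rightarrow> real" where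
  "g_total Q L v u w = (\<Sum>\<alpha>\<in>UNIV. \<Sum>\<beta>\<in>UNIV. g_comp Q L v \<alpha> \<beta> (u \<alpha>) (w \<beta>))"

definition G_regular ::
  "('g, 'z) monoid_scheme \<Rightarrow> ('g, 'h::euclidean_space) atlas \<Rightarrow> ('q, real ^ 'n) atlas \<Rightarrow>
   ('g \<Rightarrow> 'q \<Rightarrow> 'q) \<Rightarrow> ('i::finite \<Rightarrow> ('g, 'h) chart \<Rightarrow> 'h) \<Rightarrow>
   ('k::finite, 'q, 'n::finite) lagrangian \<Rightarrow> bool" where
  "G_regular G AG Q \<Phi> E L \<longleftrightarrow> (\<forall>v\<in>Tk_set Q.
     invertible ((\<chi> i j. g_comp Q L v (fst i) (fst j)
         (fundamental G AG Q \<Phi> (E (snd i)) (fst v)) (fundamental G AG Q \<Phi> (E (snd j)) (fst v)))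
       :: real ^ ('k \<times> 'i) ^ ('k \<times> 'i)))"

text \<open>Horizontal elements of the mechanical \<open>k\<close>-connection, as elements of \<open>T\<^sup>1\<^sub>k(T\<^sup>1\<^sub>kQ)\<close>.
  On \<open>T\<^sup>1\<^sub>kQ\<close> the projection to \<open>Q\<close> is \<open>fst\<close>.\<close>

definition mechanical_k_connection ::
  "('g, 'z) monoid_scheme \<Rightarrow> ('g, 'h::euclidean_space) atlas \<Rightarrow> ('q, real ^ 'n) atlas \<Rightarrow>
   ('g \<Rightarrow> 'q \<Rightarrow> 'q) \<Rightarrow> ('k::finite, 'q, 'n::finite) lagrangian \<Rightarrow>
   ('k, ('k, 'q, real ^ 'n) ktangent, (real ^ 'n) \<times> ((real ^ 'n) ^ 'k)) ktangent set" where
  "mechanical_k_connection G AG Q \<Phi> L = {(v, W) \<in> Tk_set (Tk Q).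
     \<forall>\<xi>. (\<forall>\<beta>. \<xi> \<beta> \<in> lie_algebra G AG) \<longrightarrow>
       g_total Q L v (\<lambda>\<alpha>. tangent_map (Tk Q) Q fst v (W \<alpha>))
         (\<lambda>\<beta>. fundamental G AG Q \<Phi> (\<xi> \<beta>) (fst v)) = 0}"

end

theory Submission
  imports Defs
begin

text \<open>At \<open>\<^bold>v\<close> over \<open>q\<close>, the projection to \<open>T\<^sub>qQ\<close> maps the vertical space of \<open>T\<^sup>1\<^sub>kQ\<close> isomorphically onto the
  span of the fundamental vectors at \<open>q\<close>: the fundamental vectors of the lifted action are vertical and
  project to those of \<open>Q\<close>, which are independent because \<open>L\<close> is \<open>G\<close>-regular, and the vertical space has
  dimension at most \<open>dim G\<close>, since otherwise a neighbourhood would be a countable union of smooth images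
  of lower-dimensional sets. Removing a vertical part then amounts to solving a linear system whose
  matrix is the Gram matrix of \<open>G\<close>-regularity, which gives complementarity; solving it smoothly in \<open>\<^bold>v\<close>
  gives local frames of the horizontal elements. Equivariance follows from uniqueness of the
  decomposition, since invariance of \<open>L\<close> makes its fibre Hessian invariant and the action permutes
  fundamental vector fields through the adjoint representation.\<close>

section \<open>Calculus of smooth maps\<close>

text \<open>The vertical space is only given as the kernel of the derivative of the orbit map, and
  \<open>quotient_manifold\<close> fixes no relation between \<open>DIM('p)\<close> and the group.
  As the orbit map is a submersion, this kernel has dimension \<open>DIM('e) - DIM('p)\<close>, so
  bounding it by dim G means proving \<open>DIM('e) \<le> DIM('h) + DIM('p)\<close>. Lebesgue
  measure decides this; the countability of the covering comes from second countability of the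
  group. Horizontality at a point is, in a natural chart, the vanishing of one linear functional for
  each pair \<open>(\<beta>, b)\<close>, and these functionals see only the base components of the
  tangent vectors. Fundamental vectors put into single slots are dual to them through the Gram
  matrix. The same matrix therefore fixes the codimension of the horizontal spaces, and Cramer's
  rule makes the projection onto them smooth in the base point. Tangent vectors are families of
  coordinates over all charts, so a pointwise identity between them is settled by its value in one
  chart.\<close>

lemma Ck_on_mono: "Ck_on r S f \<Longrightarrow> T \<subseteq> S \<Longrightarrow> Ck_on r T f"
  by (induction r arbitrary: f) (auto intro: continuous_on_subset)

text \<open>Openness of \<open>S\<close> is essential: \<open>Ck_on\<close> uses derivatives over
  full neighbourhoods, so agreement must extend around each point before the two derivatives can be
  compared.\<close>

lemma Ck_on_cong_imp:
  assumes "open S" "Ck_on r S f" "\<And>x. x \<in> S \<Longrightarrow> f x = g x"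
  shows "Ck_on r S g"
  using assms(2,3)
proof (induction r arbitrary: f g)
  case 0
  then show ?case by (simp cong: continuous_on_cong)
next
  case (Suc r)
  have d: "f differentiable (at x)" if "x \<in> S" for x using Suc.prems(1) that by simp
  have "g differentiable (at x)" if "x \<in> S" for x
  proof -
    have "(f has_derivative frechet_derivative f (at x)) (at x)"
      using d[OF that] frechet_derivative_works by blast
    then have "(g has_derivative frechet_derivative f (at x)) (at x)"
      by (rule has_derivative_transform_within_open[OF _ assms(1) that]) (rule Suc.prems(2))
    then show ?thesis by (rule differentiableI)
  qed
  moreover have "Ck_on r S (\<lambda>x. frechet_derivative g (at x) b)" for b
  proof (rule Suc.IH)
    show "Ck_on r S (\<lambda>x. frechet_derivative f (at x) b)" using Suc.prems(1) by simp
    show "frechet_derivative f (at x) b = frechet_derivative g (at x) b" if "x \<in> S" for x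
      using frechet_derivative_transform_within_open[OF d[OF that] assms(1) that Suc.prems(2)] by simp
  qed
  ultimately show ?case by simp
qed

lemma Ck_on_SucD: "Ck_on (Suc r) S f \<Longrightarrow> Ck_on r S f"
proof (induction r arbitrary: f)
  case 0
  then show ?case
    by (auto simp: continuous_at_imp_continuous_on differentiable_imp_continuous_within)
next
  case (Suc r)
  then show ?case by (metis Ck_on.simps(2))
qed

text \<open>By uniqueness of derivatives, any explicit formula \<open>f'\<close> may stand for
  \<open>frechet_derivative\<close>; the inductive closure proofs below supply such
  formulas.\<close>

lemma Ck_on_SucI:
  assumes "open S" "\<And>x. x \<in> S \<Longrightarrow> (f has_derivative f' x) (at x)"
    and "\<And>b. Ck_on r S (\<lambda>x. f' x b)"
  shows "Ck_on (Suc r) S f"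
proof -
  have "frechet_derivative f (at x) = f' x" if "x \<in> S" for x
    using assms(2)[OF that] by (metis frechet_derivative_at)
  then have "Ck_on r S (\<lambda>x. frechet_derivative f (at x) b)" for b
    by (intro Ck_on_cong_imp[OF assms(1) assms(3)[of b]]) simp
  then show ?thesis using assms(2) by (auto simp: differentiable_def)
qed

lemma Ck_on_SucD_deriv:
  assumes "Ck_on (Suc r) S f" "x \<in> S"
  shows "(f has_derivative frechet_derivative f (at x)) (at x)"
  using assms by (auto simp: frechet_derivative_works)

lemma Ck_on_const: "open S \<Longrightarrow> Ck_on r S (\<lambda>x. c)"
proof (induction r arbitrary: c)
  case (Suc r)
  then show ?case by (intro Ck_on_SucI[where f'="\<lambda>_ _. 0"]) auto
qed auto

lemma Ck_on_bounded_linear: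
  assumes "bounded_linear h" "open S"
  shows "Ck_on r S f \<Longrightarrow> Ck_on r S (\<lambda>x. h (f x))"
proof (induction r arbitrary: f)
  case 0
  then show ?case using assms by (auto intro: bounded_linear.continuous_on)
next
  case (Suc r)
  show ?case
    by (rule Ck_on_SucI[OF assms(2) bounded_linear.has_derivative[OF assms(1)
          Ck_on_SucD_deriv[OF Suc.prems(1)]]]) (use Suc in auto)
qed

lemma Ck_on_ident: "open S \<Longrightarrow> Ck_on r S (\<lambda>x. x)"
  by (cases r) (auto intro!: Ck_on_SucI[where f'="\<lambda>_ b. b"] Ck_on_const)

lemma Ck_on_add:
  assumes "open S"
  shows "Ck_on r S f \<Longrightarrow> Ck_on r S g \<Longrightarrow> Ck_on r S (\<lambda>x. f x + g x)"
proof (induction r arbitrary: f g)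
  case 0
  then show ?case by (auto intro: continuous_on_add)
next
  case (Suc r)
  show ?case
    by (rule Ck_on_SucI[OF assms has_derivative_add[OF Ck_on_SucD_deriv[OF Suc.prems(1)]
          Ck_on_SucD_deriv[OF Suc.prems(2)]]]) (use Suc in auto)
qed

lemma Ck_on_bounded_bilinear:
  assumes "bounded_bilinear h" "open S"
  shows "Ck_on r S f \<Longrightarrow> Ck_on r S g \<Longrightarrow> Ck_on r S (\<lambda>x. h (f x) (g x))"
proof (induction r arbitrary: f g)
  case 0
  then show ?case using assms by (auto intro: bounded_bilinear.continuous_on)
next
  case (Suc r)
  note D = Ck_on_SucD_deriv[OF Suc.prems(1)] Ck_on_SucD_deriv[OF Suc.prems(2)]
  show ?case
  proof (rule Ck_on_SucI[OF assms(2) bounded_bilinear.FDERIV[OF assms(1) D]])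
    show "Ck_on r S (\<lambda>x. h (f x) (frechet_derivative g (at x) b) + h (frechet_derivative f (at x) b) (g x))" for b
      using Suc.prems by (intro Ck_on_add[OF assms(2)] Suc.IH Ck_on_SucD[OF Suc.prems(1)]
        Ck_on_SucD[OF Suc.prems(2)]) simp_all
  qed
qed

lemma Ck_on_sum:
  assumes "open S" "\<And>i. i \<in> I \<Longrightarrow> Ck_on r S (f i)"
  shows "Ck_on r S (\<lambda>x. \<Sum>i\<in>I. f i x)"
  using assms(2)
  by (induction I rule: infinite_finite_induct) (auto intro: Ck_on_const Ck_on_add assms(1))

lemma linear_expand_Basis:
  fixes f :: "'a::euclidean_space \<Rightarrow> 'b::real_vector"
  assumes "linear f"
  shows "f v = (\<Sum>e\<in>Basis. (v \<bullet> e) *\<^sub>R f e)"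
proof -
  have "f v = f (\<Sum>e\<in>Basis. (v \<bullet> e) *\<^sub>R e)" by (simp add: euclidean_representation)
  then show ?thesis using assms by (simp add: linear_sum linear_scale)
qed

text \<open>The chain rule applies the derivative of \<open>g\<close> to a moving vector, whereas
  \<open>Ck_on\<close> controls only derivatives in fixed directions. Expanding the moving vector
  over \<open>Basis\<close> leaves fixed directions with varying coefficients.\<close>

lemma Ck_on_compose:
  assumes "open S" "open T" "f ` S \<subseteq> T"
  shows "Ck_on r T g \<Longrightarrow> Ck_on r S f \<Longrightarrow> Ck_on r S (\<lambda>x. g (f x))"
  using assms(3)
proof (induction r arbitrary: g f)
  case 0
  then show ?case by (auto intro: continuous_on_compose2)
next
  case (Suc r)
  have gd: "(g has_derivative frechet_derivative g (at (f x))) (at (f x))" if "x \<in> S" for x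
    using Ck_on_SucD_deriv[OF Suc.prems(1)] that Suc.prems(3) by blast
  have "Ck_on r S (\<lambda>x. frechet_derivative g (at (f x)) e)" for e
    using Suc Ck_on_SucD[OF Suc.prems(2)]
    by (intro Suc.IH[of "\<lambda>y. frechet_derivative g (at y) e"]) auto
  then have "Ck_on r S (\<lambda>x. \<Sum>e\<in>Basis. (frechet_derivative f (at x) b \<bullet> e) *\<^sub>R
      frechet_derivative g (at (f x)) e)" for b
    using Suc.prems(2) assms(1)
    by (intro Ck_on_sum Ck_on_bounded_bilinear[OF bounded_bilinear_scaleR]
        Ck_on_bounded_linear[OF bounded_linear_inner_left]) auto
  then have "Ck_on r S (\<lambda>x. frechet_derivative g (at (f x)) (frechet_derivative f (at x) b))" for b
    by (rule Ck_on_cong_imp[OF assms(1)])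
      (simp add: linear_expand_Basis[OF has_derivative_linear[OF gd], symmetric])
  then show ?case
    by (intro Ck_on_SucI[OF assms(1) has_derivative_compose[OF Ck_on_SucD_deriv[OF Suc.prems(2)] gd]])
qed

lemma Ck_on_inverse:
  fixes f :: "'a::euclidean_space \<Rightarrow> real"
  assumes "open S"
  shows "Ck_on r S f \<Longrightarrow> (\<And>x. x \<in> S \<Longrightarrow> f x \<noteq> 0) \<Longrightarrow> Ck_on r S (\<lambda>x. inverse (f x))"
proof (induction r)
  case 0
  then show ?case by (auto intro: continuous_on_inverse)
next
  case (Suc r)
  have i: "Ck_on r S (\<lambda>x. inverse (f x))"
    using Suc Ck_on_SucD by blast
  show ?case
  proof (rule Ck_on_SucI[OF assms Deriv.has_derivative_inverse[OF Suc.prems(2) Ck_on_SucD_deriv[OF Suc.prems(1)]]])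
    show "Ck_on r S (\<lambda>x. - (inverse (f x) * frechet_derivative f (at x) b * inverse (f x)))" for b
      using Suc.prems(1) by (intro
       Ck_on_bounded_linear[OF bounded_linear_minus[OF bounded_linear_ident]]
       Ck_on_bounded_bilinear[OF bounded_bilinear_mult] i assms) simp
  qed
qed

lemma Ck_on_local:
  assumes "\<And>x. x \<in> S \<Longrightarrow> \<exists>U. open U \<and> x \<in> U \<and> Ck_on r U f"
  shows "Ck_on r S f"
  using assms
proof (induction r arbitrary: f)
  case 0
  have "isCont f x" if "x \<in> S" for x
    using 0[OF that] continuous_on_eq_continuous_at by auto
  then show ?case by (simp add: continuous_at_imp_continuous_on)
next
  case (Suc r)
  have "f differentiable (at x)" if "x \<in> S" for x
    using Suc.prems[OF that] by auto
  moreover have "Ck_on r S (\<lambda>x. frechet_derivative f (at x) b)" for b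
  proof (rule Suc.IH)
    fix x assume "x \<in> S"
    from Suc.prems[OF this] show "\<exists>U. open U \<and> x \<in> U \<and> Ck_on r U (\<lambda>x. frechet_derivative f (at x) b)"
      by auto
  qed
  ultimately show ?case by simp
qed

section \<open>Closure properties of smooth maps on open sets\<close>

lemma smooth_on_mono: "smooth_on S f \<Longrightarrow> T \<subseteq> S \<Longrightarrow> smooth_on T f"
  by (auto simp: smooth_on_def intro: Ck_on_mono)

lemma smooth_on_cong:
  assumes "smooth_on S f" "open S" "\<And>x. x \<in> S \<Longrightarrow> f x = g x"
  shows "smooth_on S g"
  using assms(1) Ck_on_cong_imp[OF assms(2) _ assms(3)] unfolding smooth_on_def by simp

lemma smooth_on_const: "open S \<Longrightarrow> smooth_on S (\<lambda>x. c)"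
  by (simp add: smooth_on_def Ck_on_const)

lemma smooth_on_ident: "open S \<Longrightarrow> smooth_on S (\<lambda>x. x)"
  by (simp add: smooth_on_def Ck_on_ident)

lemma smooth_on_bounded_linear:
  "bounded_linear h \<Longrightarrow> open S \<Longrightarrow> smooth_on S f \<Longrightarrow> smooth_on S (\<lambda>x. h (f x))"
  by (simp add: smooth_on_def Ck_on_bounded_linear)

lemma smooth_on_bounded_bilinear:
  "bounded_bilinear h \<Longrightarrow> open S \<Longrightarrow> smooth_on S f \<Longrightarrow> smooth_on S g \<Longrightarrow>
    smooth_on S (\<lambda>x. h (f x) (g x))"
  by (simp add: smooth_on_def Ck_on_bounded_bilinear)

lemmas smooth_on_mult = smooth_on_bounded_bilinear[OF bounded_bilinear_mult]
lemmas smooth_on_scaleR = smooth_on_bounded_bilinear[OF bounded_bilinear_scaleR]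

lemma smooth_on_add:
  "open S \<Longrightarrow> smooth_on S f \<Longrightarrow> smooth_on S g \<Longrightarrow> smooth_on S (\<lambda>x. f x + g x)"
  by (simp add: smooth_on_def Ck_on_add)

lemma smooth_on_diff:
  assumes "open S" "smooth_on S f" "smooth_on S g"
  shows "smooth_on S (\<lambda>x. f x - g x)"
  using smooth_on_add[OF assms(1,2) smooth_on_bounded_linear[OF bounded_linear_minus[OF bounded_linear_ident] assms(1,3)]]
  by simp

lemma smooth_on_sum:
  "open S \<Longrightarrow> (\<And>i. i \<in> I \<Longrightarrow> smooth_on S (f i)) \<Longrightarrow> smooth_on S (\<lambda>x. \<Sum>i\<in>I. f i x)"
  by (simp add: smooth_on_def Ck_on_sum)

lemma smooth_on_prod:
  fixes f :: "'i \<Rightarrow> 'a::euclidean_space \<Rightarrow> real"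
  assumes "open S" "\<And>i. i \<in> I \<Longrightarrow> smooth_on S (f i)"
  shows "smooth_on S (\<lambda>x. \<Prod>i\<in>I. f i x)"
  using assms(2) by (induction I rule: infinite_finite_induct)
    (auto intro: smooth_on_const smooth_on_mult assms(1))

lemma smooth_on_inverse:
  fixes f :: "'a::euclidean_space \<Rightarrow> real"
  assumes "open S" "smooth_on S f" "\<And>x. x \<in> S \<Longrightarrow> f x \<noteq> 0"
  shows "smooth_on S (\<lambda>x. inverse (f x))"
  using assms(2) Ck_on_inverse[OF assms(1) _ assms(3)] unfolding smooth_on_def by simp

lemma smooth_on_compose:
  assumes "smooth_on T g" "smooth_on S f" "open S" "open T" "f ` S \<subseteq> T"
  shows "smooth_on S (\<lambda>x. g (f x))"
  unfolding smooth_on_def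
proof
  fix r
  have "Ck_on r T g" "Ck_on r S f" using assms(1,2) by (simp_all add: smooth_on_def)
  then show "Ck_on r S (\<lambda>x. g (f x))" by (rule Ck_on_compose[OF assms(3-5)])
qed

lemma smooth_on_Pair:
  fixes f :: "'a::euclidean_space \<Rightarrow> 'b::euclidean_space" and g :: "'a \<Rightarrow> 'c::euclidean_space"
  assumes "open S" "smooth_on S f" "smooth_on S g"
  shows "smooth_on S (\<lambda>x. (f x, g x))"
proof -
  have f: "smooth_on S (\<lambda>x. (f x, 0::'c))"
    by (rule smooth_on_bounded_linear[OF _ assms(1,2)])
      (intro bounded_linear_Pair bounded_linear_zero bounded_linear_ident)
  have g: "smooth_on S (\<lambda>x. (0::'b, g x))"
    by (rule smooth_on_bounded_linear[OF _ assms(1,3)])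
      (intro bounded_linear_Pair bounded_linear_zero bounded_linear_ident)
  from smooth_on_add[OF assms(1) f g] show ?thesis by simp
qed

lemma linear_axis: "linear (axis i :: 'b::real_vector \<Rightarrow> 'b ^ 'k)"
  by (rule linearI) (auto simp: axis_def vec_eq_iff)

lemma sum_axis: "(\<Sum>i\<in>UNIV. axis i (f i)) = (\<chi> i. f i)"
  by (auto simp: vec_eq_iff axis_def if_distrib[of "\<lambda>v. v $ _"] sum.delta cong: if_cong)

lemma smooth_on_vec:
  fixes f :: "'k::finite \<Rightarrow> 'a::euclidean_space \<Rightarrow> 'b::euclidean_space"
  assumes "open S" "\<And>i. smooth_on S (f i)"
  shows "smooth_on S (\<lambda>x. \<chi> i. f i x)"
proof -
  have "smooth_on S (\<lambda>x. \<Sum>i\<in>UNIV. axis i (f i x))"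
  proof (intro smooth_on_sum assms(1))
    show "smooth_on S (\<lambda>x. axis i (f i x))" for i
      by (rule smooth_on_bounded_linear[OF _ assms(1) assms(2)])
        (simp add: linear_axis linear_conv_bounded_linear[symmetric])
  qed
  then show ?thesis by (simp only: sum_axis)
qed

lemma smooth_on_nth:
  "open S \<Longrightarrow> smooth_on S f \<Longrightarrow> smooth_on S (\<lambda>x. f x $ i)"
  by (rule smooth_on_bounded_linear[OF bounded_linear_vec_nth])

lemma smooth_on_fst: "open S \<Longrightarrow> smooth_on S f \<Longrightarrow> smooth_on S (\<lambda>x. fst (f x))"
  by (rule smooth_on_bounded_linear[OF bounded_linear_fst])

lemma smooth_on_snd: "open S \<Longrightarrow> smooth_on S f \<Longrightarrow> smooth_on S (\<lambda>x. snd (f x))"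
  by (rule smooth_on_bounded_linear[OF bounded_linear_snd])

lemma smooth_on_local:
  "(\<And>x. x \<in> S \<Longrightarrow> \<exists>U. open U \<and> x \<in> U \<and> smooth_on U f) \<Longrightarrow> smooth_on S f"
  unfolding smooth_on_def by (intro allI Ck_on_local) auto

lemma smooth_on_differentiable: "smooth_on S f \<Longrightarrow> x \<in> S \<Longrightarrow> f differentiable (at x)"
  unfolding smooth_on_def by (drule spec[of _ "Suc 0"]) simp

lemma smooth_on_has_derivative:
  "smooth_on S f \<Longrightarrow> x \<in> S \<Longrightarrow> (f has_derivative frechet_derivative f (at x)) (at x)"
  by (simp add: smooth_on_differentiable frechet_derivative_works[symmetric])

lemma smooth_on_linear_deriv:
  "smooth_on S f \<Longrightarrow> x \<in> S \<Longrightarrow> linear (frechet_derivative f (at x))"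
  by (rule has_derivative_linear[OF smooth_on_has_derivative])

lemma smooth_on_continuous_on: "smooth_on S f \<Longrightarrow> continuous_on S f"
  unfolding smooth_on_def by (drule spec[of _ 0]) simp

lemma smooth_on_deriv_const: "smooth_on S f \<Longrightarrow> smooth_on S (\<lambda>x. frechet_derivative f (at x) b)"
  unfolding smooth_on_def
proof
  fix r assume "\<forall>r. Ck_on r S f"
  then have "Ck_on (Suc r) S f" ..
  then show "Ck_on r S (\<lambda>x. frechet_derivative f (at x) b)" by simp
qed

text \<open>The basis expansion of the chain rule again: base point and direction may both move, as
  they do in the coordinate formulas for tangent maps.\<close>

lemma smooth_on_deriv:
  assumes "smooth_on T f" "open T" "open S" "smooth_on S g" "g ` S \<subseteq> T" "smooth_on S h"
  shows "smooth_on S (\<lambda>x. frechet_derivative f (at (g x)) (h x))"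
proof -
  have "smooth_on S (\<lambda>x. \<Sum>e\<in>Basis. (h x \<bullet> e) *\<^sub>R frechet_derivative f (at (g x)) e)"
  proof (intro smooth_on_sum smooth_on_scaleR assms(3))
    fix e :: 'a
    show "smooth_on S (\<lambda>x. h x \<bullet> e)"
      by (rule smooth_on_bounded_linear[OF bounded_linear_inner_left assms(3,6)])
    show "smooth_on S (\<lambda>x. frechet_derivative f (at (g x)) e)"
      by (rule smooth_on_compose[OF smooth_on_deriv_const[OF assms(1)] assms(4,3,2,5)])
  qed
  then show ?thesis
  proof (rule smooth_on_cong)
    show "open S" by fact
    fix x assume "x \<in> S"
    then have "linear (frechet_derivative f (at (g x)))"
      using assms by (intro smooth_on_linear_deriv[of T]) auto
    then show "(\<Sum>e\<in>Basis. (h x \<bullet> e) *\<^sub>R frechet_derivative f (at (g x)) e) =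
        frechet_derivative f (at (g x)) (h x)"
      by (rule linear_expand_Basis[symmetric])
  qed
qed

section \<open>Charts, local representatives and tangent maps\<close>

text \<open>Isolates the chart-compatibility clauses of \<open>smooth_manifold\<close>, the part
  that is passed on to \<open>prod_atlas\<close>, \<open>Tk\<close> and \<open>sub_atlas\<close>
  below.\<close>

definition smooth_atlas :: "('a, 'e::euclidean_space) atlas \<Rightarrow> bool" where
  "smooth_atlas A \<longleftrightarrow>
     (\<forall>c\<in>A. inj_on (snd c) (fst c)) \<and>
     (\<forall>c\<in>A. \<forall>d\<in>A. open (snd c ` (fst c \<inter> fst d)) \<and>
        smooth_on (snd c ` (fst c \<inter> fst d)) (snd d \<circ> chart_inv c))"

definition lrep :: "('a, 'e) chart \<Rightarrow> ('b, 'f) chart \<Rightarrow> ('a \<Rightarrow> 'b) \<Rightarrow> 'e \<Rightarrow> 'f" where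
  "lrep c d f = snd d \<circ> f \<circ> chart_inv c"

abbreviation ldom :: "('a, 'e) chart \<Rightarrow> ('b, 'f) chart \<Rightarrow> ('a \<Rightarrow> 'b) \<Rightarrow> 'e set" where
  "ldom c d f \<equiv> snd c ` {p \<in> fst c. f p \<in> fst d}"

abbreviation lderiv :: "('a, 'e::euclidean_space) chart \<Rightarrow> ('b, 'f::euclidean_space) chart \<Rightarrow>
    ('a \<Rightarrow> 'b) \<Rightarrow> 'a \<Rightarrow> 'e \<Rightarrow> 'f" where
  "lderiv c d f p \<equiv> frechet_derivative (lrep c d f) (at (snd c p))"

lemma lrep_apply [simp]: "lrep c d f x = snd d (f (chart_inv c x))"
  by (simp add: lrep_def)

lemma smooth_manifold_atlas: "smooth_manifold A \<Longrightarrow> smooth_atlas A"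
  by (simp add: smooth_manifold_def smooth_atlas_def)

lemma smooth_atlas_inj: "smooth_atlas A \<Longrightarrow> c \<in> A \<Longrightarrow> inj_on (snd c) (fst c)"
  by (simp add: smooth_atlas_def)

lemma chart_inv_snd: "inj_on (snd c) (fst c) \<Longrightarrow> p \<in> fst c \<Longrightarrow> chart_inv c (snd c p) = p"
  by (simp add: chart_inv_def)

lemma chart_inv_atlas [simp]:
  "smooth_atlas A \<Longrightarrow> c \<in> A \<Longrightarrow> p \<in> fst c \<Longrightarrow> chart_inv c (snd c p) = p"
  by (simp add: chart_inv_snd smooth_atlas_inj)

lemma chart_eqD:
  assumes "smooth_atlas A" "c \<in> A" "p \<in> fst c" "q \<in> fst c" "snd c p = snd c q"
  shows "p = q"
  by (rule inj_onD[OF smooth_atlas_inj[OF assms(1,2)] assms(5,3,4)])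

lemma chart_image_iff:
  assumes "smooth_atlas A" "c \<in> A" "q \<in> fst c"
  shows "snd c q \<in> snd c ` {p \<in> fst c. R p} \<longleftrightarrow> R q"
  using chart_eqD[OF assms] assms(3) by blast

lemma chart_open: "smooth_atlas A \<Longrightarrow> c \<in> A \<Longrightarrow> open (snd c ` fst c)"
  unfolding smooth_atlas_def by (metis Int_absorb)

lemma mcarrierI: "c \<in> A \<Longrightarrow> p \<in> fst c \<Longrightarrow> p \<in> mcarrier A"
  by (auto simp: mcarrier_def)

lemma mcarrierE:
  assumes "p \<in> mcarrier A"
  obtains c where "c \<in> A" "p \<in> fst c"
  using assms by (auto simp: mcarrier_def)

lemma chart_at_in: 
  assumes "p \<in> mcarrier A"
  shows "chart_at A p \<in> A" "p \<in> fst (chart_at A p)"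
proof -
  have "\<exists>c. c \<in> A \<and> p \<in> fst c" using assms by (auto simp: mcarrier_def)
  from someI_ex[OF this] show "chart_at A p \<in> A" "p \<in> fst (chart_at A p)"
    by (simp_all add: chart_at_def)
qed

lemma smooth_mapD:
  assumes "smooth_map A B f" "c \<in> A" "d \<in> B"
  shows "open (ldom c d f)" "smooth_on (ldom c d f) (lrep c d f)"
  using assms by (simp_all add: smooth_map_def lrep_def)

lemma smooth_map_carrier: "smooth_map A B f \<Longrightarrow> p \<in> mcarrier A \<Longrightarrow> f p \<in> mcarrier B"
  by (auto simp: smooth_map_def)

lemma lrep_has_derivative:
  assumes "smooth_map A B f" "c \<in> A" "d \<in> B" "p \<in> fst c" "f p \<in> fst d"
  shows "(lrep c d f has_derivative lderiv c d f p) (at (snd c p))"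
  using assms by (intro smooth_on_has_derivative[OF smooth_mapD(2)[OF assms(1-3)]]) auto

lemma lderiv_linear:
  assumes "smooth_map A B f" "c \<in> A" "d \<in> B" "p \<in> fst c" "f p \<in> fst d"
  shows "linear (lderiv c d f p)"
  by (rule has_derivative_linear[OF lrep_has_derivative[OF assms]])

lemma smooth_map_ident: "smooth_atlas A \<Longrightarrow> smooth_map A A (\<lambda>x. x)"
proof -
  assume A: "smooth_atlas A"
  have "{p \<in> fst c. p \<in> fst d} = fst c \<inter> fst d" for c d :: "('a, 'b) chart" by auto
  moreover have "snd d \<circ> (\<lambda>x. x) \<circ> chart_inv c = snd d \<circ> chart_inv c" for c d :: "('a, 'b) chart"
    by auto
  ultimately show ?thesis using A by (simp add: smooth_map_def smooth_atlas_def)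
qed

text \<open>The composed representatives coincide only where \<open>f\<close> lands in the domain of
  \<open>d\<close>; that set is open around the point, which is enough for derivatives.\<close>

lemma lderiv_comp:
  assumes A: "smooth_atlas A" and B: "smooth_atlas B"
    and f: "smooth_map A B f" and g: "smooth_map B C g"
    and c: "c \<in> A" "p \<in> fst c" and d: "d \<in> B" "f p \<in> fst d" and e: "e \<in> C" "g (f p) \<in> fst e"
  shows "lderiv c e (\<lambda>x. g (f x)) p v = lderiv d e g (f p) (lderiv c d f p v)"
proof -
  have fp: "lrep c d f (snd c p) = snd d (f p)" using A c by simp
  have "(lrep d e g has_derivative lderiv d e g (f p)) (at (lrep c d f (snd c p)))"
    unfolding fp by (rule lrep_has_derivative[OF g d(1) e(1) d(2) e(2)])
  from has_derivative_compose[OF lrep_has_derivative[OF f c(1) d(1) c(2) d(2)] this]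
  have "((\<lambda>x. lrep d e g (lrep c d f x)) has_derivative
      (\<lambda>v. lderiv d e g (f p) (lderiv c d f p v))) (at (snd c p))" .
  then have "(lrep c e (\<lambda>x. g (f x)) has_derivative
      (\<lambda>v. lderiv d e g (f p) (lderiv c d f p v))) (at (snd c p))"
  proof (rule has_derivative_transform_within_open)
    show "open (ldom c d f)" using smooth_mapD(1)[OF f c(1) d(1)] .
    show "snd c p \<in> ldom c d f" using c d by auto
    show "lrep d e g (lrep c d f x) = lrep c e (\<lambda>x. g (f x)) x" if "x \<in> ldom c d f" for x
      using that A B c d by auto
  qed
  from frechet_derivative_at[OF this] show ?thesis by metis
qed

lemma lderiv_ident:
  assumes "smooth_atlas A" "c \<in> A" "p \<in> fst c"
  shows "lderiv c c (\<lambda>x. x) p v = v"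
proof -
  have "(lrep c c (\<lambda>x. x) has_derivative (\<lambda>x. x)) (at (snd c p))"
    by (rule has_derivative_transform_within_open[OF has_derivative_ident, of "snd c ` fst c"])
      (use assms chart_open[OF assms(1,2)] in auto)
  from frechet_derivative_at[OF this] show ?thesis by metis
qed

lemma lrep_ident: "lrep c d (\<lambda>x. x) = snd d \<circ> chart_inv c"
  by (auto simp: lrep_def)

lemma tangent_space_iff:
  "v \<in> tangent_space A p \<longleftrightarrow>
     (\<forall>c\<in>A. \<forall>d\<in>A. p \<in> fst c \<inter> fst d \<longrightarrow> v d = lderiv c d (\<lambda>x. x) p (v c)) \<and>
     (\<forall>c. \<not> (c \<in> A \<and> p \<in> fst c) \<longrightarrow> v c = 0)"
  unfolding tangent_space_def lrep_ident by simp

lemma tangent_space_trans: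
  "v \<in> tangent_space A p \<Longrightarrow> c \<in> A \<Longrightarrow> p \<in> fst c \<Longrightarrow> d \<in> A \<Longrightarrow> p \<in> fst d \<Longrightarrow>
    v d = lderiv c d (\<lambda>x. x) p (v c)"
  unfolding tangent_space_iff by blast

lemma tangent_space_outside:
  "v \<in> tangent_space A p \<Longrightarrow> \<not> (c \<in> A \<and> p \<in> fst c) \<Longrightarrow> v c = 0"
  unfolding tangent_space_iff by blast

text \<open>Chart changes determine the representatives in all other charts around \<open>p\<close>,
  and every remaining index carries the default value 0.\<close>

lemma tangent_space_eqI:
  assumes "v \<in> tangent_space A p" "w \<in> tangent_space A p" "c \<in> A" "p \<in> fst c" "v c = w c"
  shows "v = w"
proof
  fix d
  show "v d = w d"
  proof (cases "d \<in> A \<and> p \<in> fst d")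
    case True
    then show ?thesis
      using tangent_space_trans[OF assms(1,3,4)] tangent_space_trans[OF assms(2,3,4)] assms(5) by auto
  next
    case False
    then show ?thesis
      using tangent_space_outside[OF assms(1)] tangent_space_outside[OF assms(2)] by auto
  qed
qed

text \<open>The inverse of the coordinate map \<open>v \<mapsto> v c\<close> on the tangent space at
  \<open>p\<close>: it spreads the coordinates in one chart to all others.\<close>

definition tvec :: "('a, 'e::euclidean_space) atlas \<Rightarrow> 'a \<Rightarrow> ('a, 'e) chart \<Rightarrow> 'e \<Rightarrow>
    ('a, 'e) chart \<Rightarrow> 'e" where
  "tvec A p c x = (\<lambda>d. if d \<in> A \<and> p \<in> fst d then lderiv c d (\<lambda>x. x) p x else 0)"

lemma tvec_in:
  assumes "smooth_atlas A" "c \<in> A" "p \<in> fst c"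
  shows "tvec A p c x \<in> tangent_space A p"
  unfolding tangent_space_iff
proof (intro conjI ballI impI allI)
  fix d e assume d: "d \<in> A" "e \<in> A" "p \<in> fst d \<inter> fst e"
  have "lderiv c e (\<lambda>x. x) p x = lderiv d e (\<lambda>x. x) p (lderiv c d (\<lambda>x. x) p x)"
    using lderiv_comp[OF assms(1) assms(1) smooth_map_ident[OF assms(1)] smooth_map_ident[OF assms(1)]
        assms(2,3), of d e] d by simp
  then show "tvec A p c x e = lderiv d e (\<lambda>x. x) p (tvec A p c x d)"
    using d by (simp add: tvec_def)
qed (auto simp: tvec_def)

lemma tvec_at [simp]:
  assumes "smooth_atlas A" "c \<in> A" "p \<in> fst c"
  shows "tvec A p c x c = x"
  using lderiv_ident[OF assms] assms by (simp add: tvec_def)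

lemma tvec_eq:
  assumes "smooth_atlas A" "c \<in> A" "p \<in> fst c" "v \<in> tangent_space A p"
  shows "tvec A p c (v c) = v"
  by (rule tangent_space_eqI[OF tvec_in[OF assms(1-3)] assms(4,2,3)]) (simp add: assms)

lemma tangent_space_lincomb:
  assumes "smooth_atlas A" "v \<in> tangent_space A p" "w \<in> tangent_space A p"
  shows "(\<lambda>c. a *\<^sub>R v c + b *\<^sub>R w c) \<in> tangent_space A p"
  unfolding tangent_space_iff
proof (intro conjI ballI impI allI)
  fix c d assume c: "c \<in> A" "d \<in> A" "p \<in> fst c \<inter> fst d"
  have l: "linear (lderiv c d (\<lambda>x. x) p)"
    using lderiv_linear[OF smooth_map_ident[OF assms(1)] c(1,2)] c(3) by simp
  show "a *\<^sub>R v d + b *\<^sub>R w d = lderiv c d (\<lambda>x. x) p (a *\<^sub>R v c + b *\<^sub>R w c)"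
    using tangent_space_trans[OF assms(2), of c d] tangent_space_trans[OF assms(3), of c d] c
    by (simp add: linear_add[OF l] linear_scale[OF l])
next
  fix c assume "\<not> (c \<in> A \<and> p \<in> fst c)"
  then show "a *\<^sub>R v c + b *\<^sub>R w c = 0"
    using tangent_space_outside[OF assms(2)] tangent_space_outside[OF assms(3)] by simp
qed

lemma tangent_space_zero:
  assumes "smooth_atlas A"
  shows "(\<lambda>c. 0) \<in> tangent_space A p"
  unfolding tangent_space_iff
proof (intro conjI ballI impI allI)
  fix c d assume c: "c \<in> A" "d \<in> A" "p \<in> fst c \<inter> fst d"
  have l: "linear (lderiv c d (\<lambda>x. x) p)"
    using lderiv_linear[OF smooth_map_ident[OF assms(1)] c(1,2)] c(3) by simp
  show "0 = lderiv c d (\<lambda>x. x) p 0" by (simp add: linear_0[OF l])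
qed simp

lemma tangent_space_diff:
  assumes "smooth_atlas A" "v \<in> tangent_space A p" "w \<in> tangent_space A p"
  shows "(\<lambda>c. v c - w c) \<in> tangent_space A p"
  using tangent_space_lincomb[OF assms, of 1 "-1"] by simp

lemma tangent_space_sum:
  assumes "smooth_atlas A" "\<And>i. i \<in> I \<Longrightarrow> v i \<in> tangent_space A p"
  shows "(\<lambda>c. \<Sum>i\<in>I. x i *\<^sub>R v i c) \<in> tangent_space A p"
  using assms(2)
proof (induction I rule: infinite_finite_induct)
  case (insert i I)
  then show ?case using tangent_space_lincomb[OF assms(1), of "v i" p "\<lambda>c. \<Sum>i\<in>I. x i *\<^sub>R v i c" "x i" 1]
    by simp
qed (simp_all add: tangent_space_zero assms(1))

text \<open>Frees \<open>tangent_map\<close> from the arbitrary chart \<open>chart_at A p\<close>: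
  the transition to that chart is absorbed by the chain rule.\<close>

lemma tangent_map_at:
  assumes "smooth_atlas A" "smooth_map A B f" "v \<in> tangent_space A p"
    and "c \<in> A" "p \<in> fst c" "d \<in> B" "f p \<in> fst d"
  shows "tangent_map A B f p v d = lderiv c d f p (v c)"
proof -
  define c' where "c' = chart_at A p"
  have c': "c' \<in> A" "p \<in> fst c'"
    using chart_at_in[OF mcarrierI[OF assms(4,5)]] by (simp_all add: c'_def)
  have "lderiv c' d f p (v c') = lderiv c d f p (lderiv c' c (\<lambda>x. x) p (v c'))"
    using lderiv_comp[OF assms(1,1) smooth_map_ident[OF assms(1)] assms(2) c' assms(4-7)] by simp
  also have "lderiv c' c (\<lambda>x. x) p (v c') = v c"
    using tangent_space_trans[OF assms(3) c' assms(4,5)] by simp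
  finally have eq: "lderiv c' d f p (v c') = lderiv c d f p (v c)" .
  have "tangent_map A B f p v d = lderiv c' d f p (v c')"
    using assms(6,7) by (simp add: tangent_map_def c'_def lrep_def)
  from trans[OF this eq] show ?thesis .
qed

lemma tangent_map_in:
  assumes "smooth_atlas A" "smooth_atlas B" "smooth_map A B f" "v \<in> tangent_space A p"
    and "p \<in> mcarrier A"
  shows "tangent_map A B f p v \<in> tangent_space B (f p)"
  unfolding tangent_space_iff
proof (intro conjI ballI impI allI)
  obtain c where c: "c \<in> A" "p \<in> fst c" using assms(5) by (rule mcarrierE)
  fix d e assume d: "d \<in> B" "e \<in> B" "f p \<in> fst d \<inter> fst e"
  have "lderiv c e f p (v c) = lderiv d e (\<lambda>x. x) (f p) (lderiv c d f p (v c))"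
    using lderiv_comp[OF assms(1-3) smooth_map_ident[OF assms(2)] c, of d e] d by simp
  then show "tangent_map A B f p v e = lderiv d e (\<lambda>x. x) (f p) (tangent_map A B f p v d)"
    using d tangent_map_at[OF assms(1,3,4) c] by simp
qed (auto simp: tangent_map_def)

text \<open>Holds even where neither map is differentiable, because both sides choose from the same
  set of derivatives.\<close>

lemma frechet_derivative_cong_open:
  assumes "open S" "x \<in> S" "\<And>y. y \<in> S \<Longrightarrow> f y = g y"
  shows "frechet_derivative f (at x) = frechet_derivative g (at x)"
proof -
  have "(f has_derivative D) (at x) \<longleftrightarrow> (g has_derivative D) (at x)" for D
    using has_derivative_transform_within_open[of f D x UNIV S g]
      has_derivative_transform_within_open[of g D x UNIV S f] assms by auto
  then show ?thesis by (simp add: frechet_derivative_def)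
qed

text \<open>Maps are total functions with arbitrary values off the carrier, so equality on
  \<open>mcarrier A\<close> has to suffice. It does, since chart images are open and representatives
  evaluate \<open>f\<close> only at points of the chart there.\<close>

lemma tangent_map_cong:
  fixes f g :: "'a \<Rightarrow> 'b" and A :: "('a, 'e::euclidean_space) atlas"
    and B :: "('b, 'f::euclidean_space) atlas"
  assumes "smooth_atlas A" "p \<in> mcarrier A" "\<And>x. x \<in> mcarrier A \<Longrightarrow> f x = g x"
  shows "tangent_map A B f p v = tangent_map A B g p v"
proof -
  define c where "c = chart_at A p"
  have c: "c \<in> A" "p \<in> fst c" using chart_at_in[OF assms(2)] by (simp_all add: c_def)
  have eq: "lderiv c d f p = lderiv c d g p" for d :: "('b, 'f) chart"
  proof (rule frechet_derivative_cong_open)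
    show "open (snd c ` fst c)" "snd c p \<in> snd c ` fst c" using chart_open[OF assms(1)] c by auto
    show "lrep c d f y = lrep c d g y" if "y \<in> snd c ` fst c" for y
      using that assms(1) c assms(3) by (auto simp: mcarrierI)
  qed
  have fp: "f p = g p" using assms(2,3) by simp
  show ?thesis
    unfolding tangent_map_def fp eq[unfolded c_def lrep_def] ..
qed

lemma tangent_map_comp:
  assumes "smooth_atlas A" "smooth_atlas B" "smooth_map A B f" "smooth_map B C g"
    and "p \<in> mcarrier A" "v \<in> tangent_space A p" "smooth_map A C (\<lambda>x. g (f x))"
  shows "tangent_map B C g (f p) (tangent_map A B f p v) = tangent_map A C (\<lambda>x. g (f x)) p v"
proof
  fix e
  obtain c where c: "c \<in> A" "p \<in> fst c" using assms(5) by (rule mcarrierE)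
  obtain d where d: "d \<in> B" "f p \<in> fst d"
    using smooth_map_carrier[OF assms(3,5)] by (rule mcarrierE)
  note fin = tangent_map_in[OF assms(1-3,6,5)]
  show "tangent_map B C g (f p) (tangent_map A B f p v) e = tangent_map A C (\<lambda>x. g (f x)) p v e"
  proof (cases "e \<in> C \<and> g (f p) \<in> fst e")
    case True
    then show ?thesis
      using tangent_map_at[OF assms(2,4) fin d, of e] tangent_map_at[OF assms(1,7,6) c, of e]
        tangent_map_at[OF assms(1,3,6) c d] lderiv_comp[OF assms(1-4) c d, of e "v c"]
      by simp
  qed (auto simp: tangent_map_def)
qed

lemma tangent_map_ident:
  assumes "smooth_atlas A" "v \<in> tangent_space A p" "p \<in> mcarrier A"
  shows "tangent_map A A (\<lambda>x. x) p v = v"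
proof -
  obtain c where c: "c \<in> A" "p \<in> fst c" using assms(3) by (rule mcarrierE)
  show ?thesis
  proof (rule tangent_space_eqI[OF tangent_map_in[OF assms(1,1) smooth_map_ident[OF assms(1)] assms(2,3)]
        assms(2) c])
    show "tangent_map A A (\<lambda>x. x) p v c = v c"
      using tangent_map_at[OF assms(1) smooth_map_ident[OF assms(1)] assms(2) c c] 
        lderiv_ident[OF assms(1) c] by simp
  qed
qed

lemma tangent_map_lincomb:
  assumes "smooth_atlas A" "smooth_map A B f" "p \<in> mcarrier A"
    and "v \<in> tangent_space A p" "w \<in> tangent_space A p"
  shows "tangent_map A B f p (\<lambda>c. a *\<^sub>R v c + b *\<^sub>R w c) =
    (\<lambda>d. a *\<^sub>R tangent_map A B f p v d + b *\<^sub>R tangent_map A B f p w d)"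
proof
  fix d
  obtain c where c: "c \<in> A" "p \<in> fst c" using assms(3) by (rule mcarrierE)
  show "tangent_map A B f p (\<lambda>c. a *\<^sub>R v c + b *\<^sub>R w c) d =
    a *\<^sub>R tangent_map A B f p v d + b *\<^sub>R tangent_map A B f p w d"
  proof (cases "d \<in> B \<and> f p \<in> fst d")
    case True
    then have l: "linear (lderiv c d f p)" using lderiv_linear[OF assms(2) c(1)] c by simp
    from True show ?thesis
      using tangent_map_at[OF assms(1,2) tangent_space_lincomb[OF assms(1,4,5)] c, of d a b]
        tangent_map_at[OF assms(1,2,4) c, of d] tangent_map_at[OF assms(1,2,5) c, of d]
      by (simp add: linear_add[OF l] linear_scale[OF l])
  qed (auto simp: tangent_map_def)
qed

lemma tangent_map_diff:
  assumes "smooth_atlas A" "smooth_map A B f" "p \<in> mcarrier A"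
    and "v \<in> tangent_space A p" "w \<in> tangent_space A p"
  shows "tangent_map A B f p (\<lambda>c. v c - w c) =
    (\<lambda>d. tangent_map A B f p v d - tangent_map A B f p w d)"
  using tangent_map_lincomb[OF assms, of 1 "-1"] by simp

lemma tangent_map_zero:
  assumes "smooth_atlas A" "smooth_map A B f" "p \<in> mcarrier A"
  shows "tangent_map A B f p (\<lambda>c. 0) = (\<lambda>d. 0)"
  using tangent_map_lincomb[OF assms tangent_space_zero[OF assms(1)] tangent_space_zero[OF assms(1)], of 0 0]
  by simp

lemma tangent_map_sum:
  assumes "smooth_atlas A" "smooth_map A B f" "p \<in> mcarrier A"
    and "\<And>i. i \<in> I \<Longrightarrow> v i \<in> tangent_space A p"
  shows "tangent_map A B f p (\<lambda>c. \<Sum>i\<in>I. x i *\<^sub>R v i c) =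
    (\<lambda>d. \<Sum>i\<in>I. x i *\<^sub>R tangent_map A B f p (v i) d)"
  using assms(4)
proof (induction I rule: infinite_finite_induct)
  case (insert i I)
  have "(\<lambda>c. \<Sum>i\<in>I. x i *\<^sub>R v i c) \<in> tangent_space A p"
    using insert by (intro tangent_space_sum[OF assms(1)]) auto
  then show ?case
    using insert tangent_map_lincomb[OF assms(1-3), of "v i" "\<lambda>c. \<Sum>i\<in>I. x i *\<^sub>R v i c" "x i" 1]
    by simp
qed (simp_all add: tangent_map_zero[OF assms(1-3)])

section \<open>Local criteria for smoothness\<close>

lemma smooth_map_cong:
  assumes "smooth_atlas A" "smooth_map A B f" "\<And>x. x \<in> mcarrier A \<Longrightarrow> f x = g x"
  shows "smooth_map A B g"
  unfolding smooth_map_def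
proof (intro conjI ballI)
  show "g \<in> mcarrier A \<rightarrow> mcarrier B" using smooth_map_carrier[OF assms(2)] assms(3) by auto
  fix c d assume c: "c \<in> A" "d \<in> B"
  have eq: "{p \<in> fst c. g p \<in> fst d} = {p \<in> fst c. f p \<in> fst d}"
    using assms(3) mcarrierI[OF c(1)] by auto
  show "open (ldom c d g)" using smooth_mapD(1)[OF assms(2) c] eq by simp
  show "smooth_on (ldom c d g) (snd d \<circ> g \<circ> chart_inv c)"
    unfolding eq lrep_def[symmetric]
  proof (rule smooth_on_cong[OF smooth_mapD(2,1)[OF assms(2) c]])
    show "lrep c d f x = lrep c d g x" if "x \<in> ldom c d f" for x
      using that assms(1,3) mcarrierI[OF c(1)] c by auto
  qed
qed

lemma smooth_mapI_local:
  assumes "f \<in> mcarrier A \<rightarrow> mcarrier B"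
    and "\<And>c d p. c \<in> A \<Longrightarrow> d \<in> B \<Longrightarrow> p \<in> fst c \<Longrightarrow> f p \<in> fst d \<Longrightarrow>
      \<exists>U. open U \<and> snd c p \<in> U \<and> U \<subseteq> ldom c d f \<and> smooth_on U (lrep c d f)"
  shows "smooth_map A B f"
  unfolding smooth_map_def
proof (intro conjI ballI)
  show "f \<in> mcarrier A \<rightarrow> mcarrier B" by fact
  fix c d assume c: "c \<in> A" "d \<in> B"
  have *: "\<exists>U. open U \<and> x \<in> U \<and> U \<subseteq> ldom c d f \<and> smooth_on U (lrep c d f)" if "x \<in> ldom c d f" for x
    using that assms(2)[OF c] by auto
  then show "open (ldom c d f)" by (subst open_subopen) blast
  show "smooth_on (ldom c d f) (snd d \<circ> f \<circ> chart_inv c)"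
    unfolding lrep_def[symmetric]
  proof (rule smooth_on_local)
    show "\<exists>U. open U \<and> x \<in> U \<and> smooth_on U (lrep c d f)" if "x \<in> ldom c d f" for x
      using *[OF that] by blast
  qed
qed

lemma open_preimage_on:
  assumes "smooth_on S f" "open S" "open T"
  shows "open {x \<in> S. f x \<in> T}"
proof -
  have "open (S \<inter> f -` T)"
    by (rule continuous_open_preimage[OF smooth_on_continuous_on[OF assms(1)] assms(2,3)])
  then show ?thesis by (simp add: vimage_def Collect_conj_eq)
qed

text \<open>\<open>smooth_map\<close> speaks about all pairs of charts. One good pair at each point
  is enough because the chart changes on both sides are smooth.\<close>

lemma smooth_mapI:
  assumes A: "smooth_atlas A" and B: "smooth_atlas B"
    and ex: "\<And>p. p \<in> mcarrier A \<Longrightarrow> \<exists>c\<in>A. \<exists>d\<in>B. \<exists>U. p \<in> fst c \<and> f p \<in> fst d \<and> open U \<and> snd c p \<in> U \<and>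
      U \<subseteq> ldom c d f \<and> smooth_on U (lrep c d f)"
  shows "smooth_map A B f"
proof (rule smooth_mapI_local)
  show "f \<in> mcarrier A \<rightarrow> mcarrier B"
  proof
    fix p assume "p \<in> mcarrier A"
    from ex[OF this] obtain d where "d \<in> B" "f p \<in> fst d" by auto
    then show "f p \<in> mcarrier B" by (rule mcarrierI)
  qed
  fix c' d' p assume c': "c' \<in> A" and d': "d' \<in> B" and p': "p \<in> fst c'" "f p \<in> fst d'"
  obtain c d U where c: "c \<in> A" "p \<in> fst c" and d: "d \<in> B" "f p \<in> fst d"
    and U: "open U" "snd c p \<in> U" "U \<subseteq> ldom c d f" and sm: "smooth_on U (lrep c d f)"
    using ex[OF mcarrierI[OF c' p'(1)]] by blast
  let ?t = "lrep c' c (\<lambda>x. x)" and ?s = "lrep d d' (\<lambda>x. x)"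
  note t = smooth_mapD[OF smooth_map_ident[OF A] c' c(1)]
  note s = smooth_mapD[OF smooth_map_ident[OF B] d(1) d']
  \<comment> \<open>The known representative is placed between two chart changes: \<open>U1\<close>
    restricts to values that also lie in \<open>d'\<close>, and \<open>V\<close> pulls this back
    through the change from \<open>c'\<close> to \<open>c\<close>.\<close>
  define U1 where "U1 = {x \<in> U. lrep c d f x \<in> ldom d d' (\<lambda>x. x)}"
  define V where "V = {x \<in> ldom c' c (\<lambda>x. x). ?t x \<in> U1}"
  have U1: "open U1" unfolding U1_def by (rule open_preimage_on[OF sm U(1) s(1)])
  have V: "open V" unfolding V_def by (rule open_preimage_on[OF t(2,1) U1])
  have Vt: "?t ` V \<subseteq> U1" by (auto simp: V_def)
  have "smooth_on U1 (\<lambda>x. ?s (lrep c d f x))"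
    by (rule smooth_on_compose[OF s(2) smooth_on_mono[OF sm] U1 s(1)]) (auto simp: U1_def)
  then have "smooth_on V (\<lambda>x. ?s (lrep c d f (?t x)))"
    by (rule smooth_on_compose[OF _ smooth_on_mono[OF t(2)] V U1 Vt]) (auto simp: V_def)
  \<comment> \<open>Points of \<open>V\<close> come from a genuine \<open>q\<close> in both source
    charts with value in both target charts; only there do \<open>chart_inv\<close> and the
    coordinate maps cancel.\<close>
  moreover have VV: "\<exists>q. x = snd c' q \<and> q \<in> fst c' \<and> q \<in> fst c \<and> f q \<in> fst d \<and> f q \<in> fst d'" if xV: "x \<in> V" for x
  proof -
    obtain q where q: "x = snd c' q" "q \<in> fst c'" "q \<in> fst c" using xV by (auto simp: V_def)
    have "snd c q \<in> U1" using xV q A c' by (simp add: V_def)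
    then have 1: "snd c q \<in> ldom c d f" "lrep c d f (snd c q) \<in> ldom d d' (\<lambda>x. x)"
      using U(3) by (auto simp: U1_def)
    have 2: "f q \<in> fst d" using 1(1) chart_image_iff[OF A c(1) q(3)] by simp
    have "snd d (f q) \<in> ldom d d' (\<lambda>x. x)" using 1(2) A c q(3) by simp
    then have "f q \<in> fst d'" using chart_image_iff[OF B d(1) 2] by simp
    then show ?thesis using q 2 by blast
  qed
  ultimately have "smooth_on V (lrep c' d' f)"
  proof (rule_tac smooth_on_cong[OF _ V])
    fix x assume "x \<in> V"
    from VV[OF this] show "?s (lrep c d f (?t x)) = lrep c' d' f x" using A B c' c d by auto
  qed
  moreover have "V \<subseteq> ldom c' d' f" using VV by blast
  moreover have "snd c' p \<in> V" using A c' p' c d d' U by (auto simp: V_def U1_def)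
  ultimately show "\<exists>U. open U \<and> snd c' p \<in> U \<and> U \<subseteq> ldom c' d' f \<and> smooth_on U (lrep c' d' f)"
    using V by blast
qed

lemma smooth_map_comp:
  assumes A: "smooth_atlas A" and B: "smooth_atlas B" 
    and f: "smooth_map A B f" and g: "smooth_map B C g"
  shows "smooth_map A C (\<lambda>x. g (f x))"
proof (rule smooth_mapI_local)
  show "(\<lambda>x. g (f x)) \<in> mcarrier A \<rightarrow> mcarrier C"
    using smooth_map_carrier[OF f] smooth_map_carrier[OF g] by auto
  fix c e p assume c: "c \<in> A" and e: "e \<in> C" and p: "p \<in> fst c" "g (f p) \<in> fst e"
  obtain d where d: "d \<in> B" "f p \<in> fst d"
    using smooth_map_carrier[OF f mcarrierI[OF c p(1)]] by (rule mcarrierE)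
  note F = smooth_mapD[OF f c d(1)] and G = smooth_mapD[OF g d(1) e]
  define V where "V = {x \<in> ldom c d f. lrep c d f x \<in> ldom d e g}"
  have V: "open V" unfolding V_def by (rule open_preimage_on[OF F(2,1) G(1)])
  have "smooth_on V (\<lambda>x. lrep d e g (lrep c d f x))"
    by (rule smooth_on_compose[OF G(2) smooth_on_mono[OF F(2)] V G(1)]) (auto simp: V_def)
  then have "smooth_on V (lrep c e (\<lambda>x. g (f x)))"
  proof (rule smooth_on_cong[OF _ V])
    fix x assume "x \<in> V"
    then obtain q where "x = snd c q" "q \<in> fst c" "f q \<in> fst d" by (auto simp: V_def)
    then show "lrep d e g (lrep c d f x) = lrep c e (\<lambda>x. g (f x)) x"
      using A B c d by simp
  qed
  moreover have "V \<subseteq> ldom c e (\<lambda>x. g (f x))"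
  proof
    fix x assume "x \<in> V"
    then obtain q where q: "x = snd c q" "q \<in> fst c" "f q \<in> fst d" and
      "snd d (f q) \<in> ldom d e g" using A c by (auto simp: V_def)
    then have "g (f q) \<in> fst e" using chart_image_iff[OF B d(1) q(3)] by simp
    then show "x \<in> ldom c e (\<lambda>x. g (f x))" using q by blast
  qed
  moreover have "snd c p \<in> V" using A c p d by (auto simp: V_def)
  ultimately show "\<exists>U. open U \<and> snd c p \<in> U \<and> U \<subseteq> ldom c e (\<lambda>x. g (f x)) \<and> smooth_on U (lrep c e (\<lambda>x. g (f x)))"
    using V by blast
qed

section \<open>The topology of a manifold\<close>

lemma openin_mtopology:
  assumes A: "smooth_atlas A"
  shows "openin (mtopology A) S \<longleftrightarrow> S \<subseteq> mcarrier A \<and> (\<forall>c\<in>A. open (snd c ` (S \<inter> fst c)))"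
proof -
  have "istopology (\<lambda>S. S \<subseteq> mcarrier A \<and> (\<forall>c\<in>A. open (snd c ` (S \<inter> fst c))))"
    unfolding istopology_def
  proof (intro conjI allI impI ballI)
    fix S T c assume S: "S \<subseteq> mcarrier A \<and> (\<forall>c\<in>A. open (snd c ` (S \<inter> fst c)))"
      "T \<subseteq> mcarrier A \<and> (\<forall>c\<in>A. open (snd c ` (T \<inter> fst c)))" and c: "c \<in> A"
    \<comment> \<open>Images commute with intersections only because the chart is injective; the
      union case below is unconditional.\<close>
    have "snd c ` (S \<inter> T \<inter> fst c) = snd c ` (S \<inter> fst c) \<inter> snd c ` (T \<inter> fst c)"
      using smooth_atlas_inj[OF A c] by (auto dest: inj_onD)
    then show "open (snd c ` (S \<inter> T \<inter> fst c))" using S c by auto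
  next
    fix K c assume K: "\<forall>S\<in>K. S \<subseteq> mcarrier A \<and> (\<forall>c\<in>A. open (snd c ` (S \<inter> fst c)))" and c: "c \<in> A"
    have "snd c ` (\<Union>K \<inter> fst c) = (\<Union>S\<in>K. snd c ` (S \<inter> fst c))" by auto
    then show "open (snd c ` (\<Union>K \<inter> fst c))" using K c by auto
  qed auto
  then show ?thesis unfolding mtopology_def by (simp add: topology_inverse')
qed

lemma openin_chart_preimage:
  assumes A: "smooth_atlas A" and c: "c \<in> A" and U: "open U"
  shows "openin (mtopology A) {p \<in> fst c. snd c p \<in> U}"
  unfolding openin_mtopology[OF A]
proof (intro conjI ballI)
  show "{p \<in> fst c. snd c p \<in> U} \<subseteq> mcarrier A" using mcarrierI[OF c] by auto
  fix d assume d: "d \<in> A"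
  note t = smooth_mapD[OF smooth_map_ident[OF A] d c]
  have "snd d ` ({p \<in> fst c. snd c p \<in> U} \<inter> fst d) = {x \<in> ldom d c (\<lambda>x. x). lrep d c (\<lambda>x. x) x \<in> U}"
    using A c d by auto
  then show "open (snd d ` ({p \<in> fst c. snd c p \<in> U} \<inter> fst d))"
    using open_preimage_on[OF t(2,1) U] by simp
qed

lemma openin_chart_domain:
  assumes "smooth_atlas A" "c \<in> A"
  shows "openin (mtopology A) (fst c)"
  using openin_chart_preimage[OF assms open_UNIV] by simp

lemma topspace_mtopology: "smooth_atlas A \<Longrightarrow> topspace (mtopology A) = mcarrier A"
proof (rule antisym)
  assume A: "smooth_atlas A"
  show "topspace (mtopology A) \<subseteq> mcarrier A"
    using openin_topspace[of "mtopology A"] by (simp only: openin_mtopology[OF A])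
  show "mcarrier A \<subseteq> topspace (mtopology A)"
    using openin_subset[OF openin_chart_domain[OF A]] by (auto elim!: mcarrierE)
qed

section \<open>The bundle \<open>T\<^sup>1\<^sub>k\<close> as a manifold\<close>

lemma Tk_chart_in: "c \<in> A \<Longrightarrow> Tk_chart A c \<in> Tk A"
  by (simp add: Tk_def)

lemma TkE:
  assumes "C \<in> Tk A"
  obtains c where "c \<in> A" "C = Tk_chart A c"
  using assms by (auto simp: Tk_def)

lemma fst_Tk_chart [simp]: "w \<in> fst (Tk_chart A c) \<longleftrightarrow> w \<in> Tk_set A \<and> fst w \<in> fst c"
  by (simp add: Tk_chart_def)

lemma snd_Tk_chart [simp]: "snd (Tk_chart A c) w = (snd c (fst w), \<chi> \<alpha>. snd w \<alpha> c)"
  by (simp add: Tk_chart_def)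

lemma Tk_setD:
  assumes "w \<in> Tk_set A"
  shows "fst w \<in> mcarrier A" "snd w \<alpha> \<in> tangent_space A (fst w)"
  using assms by (auto simp: Tk_set_def)

lemma Tk_setI: "p \<in> mcarrier A \<Longrightarrow> (\<And>\<alpha>. v \<alpha> \<in> tangent_space A p) \<Longrightarrow> (p, v) \<in> Tk_set A"
  by (auto simp: Tk_set_def)

lemma mcarrier_Tk: "mcarrier (Tk A) = Tk_set A"
proof
  show "mcarrier (Tk A) \<subseteq> Tk_set A" by (auto simp: mcarrier_def Tk_def)
  show "Tk_set A \<subseteq> mcarrier (Tk A)"
  proof
    fix w assume w: "w \<in> Tk_set A"
    obtain c where c: "c \<in> A" "fst w \<in> fst c" using Tk_setD(1)[OF w] by (rule mcarrierE)
    show "w \<in> mcarrier (Tk A)" by (rule mcarrierI[OF Tk_chart_in[OF c(1)]]) (simp add: w c)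
  qed
qed

text \<open>The inverse of the natural chart \<open>Tk_chart A c\<close>, taking the base point
  itself in place of its coordinates.\<close>

definition tk_point :: "('a, 'e::euclidean_space) atlas \<Rightarrow> ('a, 'e) chart \<Rightarrow> 'a \<Rightarrow> 'e ^ 'k \<Rightarrow>
    ('k::finite, 'a, 'e) ktangent" where
  "tk_point A c p u = (p, \<lambda>\<alpha>. tvec A p c (u $ \<alpha>))"

lemma fst_tk_point [simp]: "fst (tk_point A c p u) = p"
  by (simp add: tk_point_def)

lemma tk_point_in:
  assumes "smooth_atlas A" "c \<in> A" "p \<in> fst c"
  shows "tk_point A c p u \<in> Tk_set A"
  unfolding tk_point_def by (intro Tk_setI mcarrierI[OF assms(2,3)] tvec_in[OF assms])

lemma tk_point_coord:
  assumes "smooth_atlas A" "c \<in> A" "p \<in> fst c"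
  shows "snd (Tk_chart A c) (tk_point A c p u) = (snd c p, u)"
  using assms by (simp add: tk_point_def)

lemma tk_point_eq:
  assumes "smooth_atlas A" "c \<in> A" "fst w \<in> fst c" "w \<in> Tk_set A"
  shows "tk_point A c (fst w) (\<chi> \<alpha>. snd w \<alpha> c) = w"
  using tvec_eq[OF assms(1-3)] Tk_setD(2)[OF assms(4)]
  by (simp add: tk_point_def prod_eq_iff fun_eq_iff)

lemma inj_on_Tk_chart:
  assumes "smooth_atlas A" "c \<in> A"
  shows "inj_on (snd (Tk_chart A c)) (fst (Tk_chart A c))"
proof (rule inj_onI)
  fix v w assume v: "v \<in> fst (Tk_chart A c)" and w: "w \<in> fst (Tk_chart A c)"
    and eq: "snd (Tk_chart A c) v = snd (Tk_chart A c) w"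
  have p: "fst v = fst w" using v w eq by (auto intro: chart_eqD[OF assms])
  have "v = tk_point A c (fst v) (\<chi> \<alpha>. snd v \<alpha> c)" using tk_point_eq[OF assms, of v] v by simp
  also have "\<dots> = tk_point A c (fst w) (\<chi> \<alpha>. snd w \<alpha> c)" using eq p by simp
  also have "\<dots> = w" using tk_point_eq[OF assms, of w] w by simp
  finally show "v = w" .
qed

lemma chart_inv_Tk_chart:
  assumes "smooth_atlas A" "c \<in> A" "p \<in> fst c"
  shows "chart_inv (Tk_chart A c) (snd c p, u) = tk_point A c p u"
  using chart_inv_snd[OF inj_on_Tk_chart[OF assms(1,2)], of "tk_point A c p u"]
    tk_point_in[OF assms, of u] tk_point_coord[OF assms, of u] assms(3) by simp

text \<open>The free predicate \<open>R\<close> lets one lemma serve full chart domains, preimages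
  under maps that depend only on the base point, and domains of local representatives.\<close>

lemma Tk_chart_image:
  assumes "smooth_atlas A" "c \<in> A"
  shows "snd (Tk_chart A c) ` {w \<in> fst (Tk_chart A c). R (fst w)} = snd c ` {p \<in> fst c. R p} \<times> UNIV"
    (is "?l = ?r")
proof
  show "?l \<subseteq> ?r" by auto
  show "?r \<subseteq> ?l"
  proof
    fix z assume "z \<in> ?r"
    then obtain p where p: "p \<in> fst c" "R p" "fst z = snd c p" by auto
    then have "z = snd (Tk_chart A c) (tk_point A c p (snd z))"
      using tk_point_coord[OF assms p(1), of "snd z"] by (simp add: prod_eq_iff)
    moreover have "tk_point A c p (snd z) \<in> {w \<in> fst (Tk_chart A c). R (fst w)}"
      using p tk_point_in[OF assms p(1)] by simp
    ultimately show "z \<in> ?l" by (rule image_eqI)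
  qed
qed

lemma Tk_map_in:
  assumes "smooth_atlas A" "smooth_atlas B" "smooth_map A B f" "w \<in> Tk_set A"
  shows "Tk_map A B f w \<in> Tk_set B"
  unfolding Tk_map_def
  by (intro Tk_setI smooth_map_carrier[OF assms(3)] tangent_map_in[OF assms(1-3)] Tk_setD[OF assms(4)])

lemma fst_Tk_map [simp]: "fst (Tk_map A B f w) = f (fst w)"
  by (simp add: Tk_map_def)

lemma snd_Tk_map: "snd (Tk_map A B f w) \<alpha> = tangent_map A B f (fst w) (snd w \<alpha>)"
  by (simp add: Tk_map_def)

lemma Tk_map_coord:
  assumes "smooth_atlas A" "smooth_map A B f" "c \<in> A" "p \<in> fst c" "d \<in> B" "f p \<in> fst d"
  shows "snd (Tk_chart B d) (Tk_map A B f (tk_point A c p u)) =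
    (snd d (f p), \<chi> \<alpha>. lderiv c d f p (u $ \<alpha>))"
  using tangent_map_at[OF assms(1,2) tvec_in[OF assms(1,3,4)] assms(3-6)] assms(1,3,4)
  by (simp add: Tk_map_def tk_point_def vec_eq_iff)

lemma Tk_map_ident:
  assumes "smooth_atlas A" "w \<in> Tk_set A"
  shows "Tk_map A A (\<lambda>x. x) w = w"
  using tangent_map_ident[OF assms(1) Tk_setD(2)[OF assms(2)] Tk_setD(1)[OF assms(2)]]
  by (simp add: Tk_map_def prod_eq_iff fun_eq_iff)

lemma Tk_map_comp:
  assumes "smooth_atlas A" "smooth_atlas B" "smooth_map A B f" "smooth_map B C g" "w \<in> Tk_set A"
  shows "Tk_map B C g (Tk_map A B f w) = Tk_map A C (\<lambda>x. g (f x)) w"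
  using tangent_map_comp[OF assms(1-4) Tk_setD[OF assms(5)] smooth_map_comp[OF assms(1-4)]]
  by (simp add: Tk_map_def)

lemma Tk_map_cong:
  assumes "smooth_atlas A" "w \<in> Tk_set A" "\<And>x. x \<in> mcarrier A \<Longrightarrow> f x = g x"
  shows "Tk_map A B f w = Tk_map A B g w"
proof -
  note p = Tk_setD(1)[OF assms(2)]
  have "tangent_map A B f (fst w) v = tangent_map A B g (fst w) v" for v
    by (rule tangent_map_cong[OF assms(1) p assms(3)])
  then show ?thesis using assms(3)[OF p] by (simp add: Tk_map_def)
qed

text \<open>The map is the coordinate expression of the \<open>k\<close>-fold tangent map of
  \<open>r\<close>.\<close>

lemma smooth_on_tangent_rep:
  fixes r :: "'e::euclidean_space \<Rightarrow> 'f::euclidean_space"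
  assumes "open S" "smooth_on S r"
  shows "smooth_on (S \<times> UNIV)
    (\<lambda>z::'e \<times> ('e ^ 'k::finite). (r (fst z), \<chi> \<alpha>. frechet_derivative r (at (fst z)) (snd z $ \<alpha>)))"
proof -
  let ?S = "S \<times> (UNIV :: ('e ^ 'k) set)"
  have o: "open ?S" using assms(1) by (simp add: open_Times)
  note i = smooth_on_ident[OF o]
  have f: "fst ` ?S \<subseteq> S" by auto
  have "smooth_on ?S (\<lambda>z. r (fst z))"
    by (rule smooth_on_compose[OF assms(2) smooth_on_fst[OF o i] o assms(1) f])
  moreover have "smooth_on ?S (\<lambda>z. \<chi> \<alpha>. frechet_derivative r (at (fst z)) (snd z $ \<alpha>))"
    by (intro smooth_on_vec[OF o] smooth_on_deriv[OF assms(2,1) o smooth_on_fst[OF o i] f]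
      smooth_on_nth[OF o] smooth_on_snd[OF o i])
  ultimately show ?thesis by (rule smooth_on_Pair[OF o])
qed

lemma lrep_Tk_map:
  assumes "smooth_atlas A" "smooth_map A B f" "c \<in> A" "d \<in> B" "fst z \<in> ldom c d f"
  shows "lrep (Tk_chart A c) (Tk_chart B d) (Tk_map A B f) z =
    (lrep c d f (fst z), \<chi> \<alpha>. frechet_derivative (lrep c d f) (at (fst z)) (snd z $ \<alpha>))"
proof -
  obtain p where p: "p \<in> fst c" "f p \<in> fst d" "fst z = snd c p" using assms(5) by auto
  have z: "chart_inv (Tk_chart A c) z = tk_point A c p (snd z)"
    using chart_inv_Tk_chart[OF assms(1,3) p(1), of "snd z"] p(3) by (metis prod.collapse)
  have "lrep (Tk_chart A c) (Tk_chart B d) (Tk_map A B f) z =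
      snd (Tk_chart B d) (Tk_map A B f (tk_point A c p (snd z)))"
    by (simp only: lrep_apply z)
  then show ?thesis
    unfolding Tk_map_coord[OF assms(1-3) p(1) assms(4) p(2)]
    using p assms(1,3) by (simp only: lrep_apply chart_inv_atlas)
qed

lemma ldom_Tk_map:
  assumes "smooth_atlas A" "smooth_atlas B" "smooth_map A B f" "c \<in> A" "d \<in> B"
  shows "ldom (Tk_chart A c) (Tk_chart B d) (Tk_map A B f) = ldom c d f \<times> UNIV"
proof -
  have eq: "{w \<in> fst (Tk_chart A c). Tk_map A B f w \<in> fst (Tk_chart B d)} =
      {w \<in> fst (Tk_chart A c). f (fst w) \<in> fst d}"
    using Tk_map_in[OF assms(1-3)] by auto
  show ?thesis unfolding eq by (rule Tk_chart_image[OF assms(1,4)])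
qed

lemma smooth_map_Tk_map:
  fixes A :: "('a, 'e::euclidean_space) atlas" and B :: "('b, 'f::euclidean_space) atlas"
  assumes "smooth_atlas A" "smooth_atlas B" "smooth_map A B f"
  shows "smooth_map (Tk A :: (('k::finite, 'a, 'e) ktangent, _) atlas) (Tk B) (Tk_map A B f)"
  unfolding smooth_map_def mcarrier_Tk
proof (intro conjI ballI)
  show "Tk_map A B f \<in> Tk_set A \<rightarrow> Tk_set B" using Tk_map_in[OF assms] by auto
  fix C D assume "C \<in> (Tk A :: (('k, 'a, 'e) ktangent, _) atlas)" "D \<in> (Tk B :: (('k, 'b, 'f) ktangent, _) atlas)"
  then obtain c d where c: "c \<in> A" "C = Tk_chart A c" and d: "d \<in> B" "D = Tk_chart B d"
    by (auto simp: Tk_def)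
  note F = smooth_mapD[OF assms(3) c(1) d(1)]
  note dom = ldom_Tk_map[OF assms c(1) d(1)]
  show o: "open (ldom C D (Tk_map A B f))"
    unfolding c d dom using F(1) by (simp add: open_Times)
  show "smooth_on (ldom C D (Tk_map A B f)) (snd D \<circ> Tk_map A B f \<circ> chart_inv C)"
    unfolding lrep_def[symmetric] c d dom
  proof (rule smooth_on_cong[OF smooth_on_tangent_rep[OF F]])
    show "open (ldom c d f \<times> (UNIV :: ('e ^ 'k) set))" using F(1) by (simp add: open_Times)
    fix z assume "z \<in> ldom c d f \<times> (UNIV :: ('e ^ 'k) set)"
    then have "fst z \<in> ldom c d f" by auto
    then show "(lrep c d f (fst z), \<chi> \<alpha>. frechet_derivative (lrep c d f) (at (fst z)) (snd z $ \<alpha>)) =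
        lrep (Tk_chart A c) (Tk_chart B d) (Tk_map A B f) z"
      by (rule lrep_Tk_map[OF assms(1,3) c(1) d(1), symmetric])
  qed
qed

text \<open>Changes between natural charts are the local representatives of the tangent map of the
  identity, so compatibility is a special case of \<open>smooth_map_Tk_map\<close>.\<close>

lemma smooth_atlas_Tk:
  assumes "smooth_atlas A"
  shows "smooth_atlas (Tk A :: (('k::finite, 'a, 'e::euclidean_space) ktangent, _) atlas)"
  unfolding smooth_atlas_def
proof (intro conjI ballI)
  fix C assume "C \<in> (Tk A :: (('k, 'a, 'e) ktangent, _) atlas)"
  then obtain c where c: "c \<in> A" "C = Tk_chart A c" by (rule TkE)
  then show "inj_on (snd C) (fst C)" using inj_on_Tk_chart[OF assms] by simp
  fix D assume "D \<in> (Tk A :: (('k, 'a, 'e) ktangent, _) atlas)"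
  then obtain d where d: "d \<in> A" "D = Tk_chart A d" by (rule TkE)
  let ?I = "Tk_map A A (\<lambda>x. x)"
  have sm: "open (ldom C D ?I)" "smooth_on (ldom C D ?I) (lrep C D ?I)"
    unfolding c(2) d(2)
    by (rule smooth_mapD[OF smooth_map_Tk_map[OF assms assms smooth_map_ident[OF assms]]
      Tk_chart_in[OF c(1)] Tk_chart_in[OF d(1)]])+
  have dom: "ldom C D ?I = snd C ` (fst C \<inter> fst D)"
  proof -
    have "{p \<in> fst C. ?I p \<in> fst D} = fst C \<inter> fst D"
      by (auto simp: c d Tk_map_ident[OF assms] simp del: fst_Tk_map)
    then show ?thesis by simp
  qed
  show o: "open (snd C ` (fst C \<inter> fst D))" using sm(1) by (simp only: dom)
  show "smooth_on (snd C ` (fst C \<inter> fst D)) (snd D \<circ> chart_inv C)"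
  proof (rule smooth_on_cong[OF sm(2)[unfolded dom] o])
    fix x assume "x \<in> snd C ` (fst C \<inter> fst D)"
    then obtain w where w: "w \<in> fst C" "x = snd C w" by auto
    have "chart_inv C x = w" using chart_inv_snd[OF inj_on_Tk_chart[OF assms c(1)], of w] w c by simp
    moreover have "?I w = w" using w(1) c by (simp add: Tk_map_ident[OF assms])
    ultimately show "lrep C D ?I x = (snd D \<circ> chart_inv C) x" by simp
  qed
qed

lemma lrep_Tk_fst:
  assumes "smooth_atlas A" "c \<in> A" "fst z \<in> snd c ` fst c"
  shows "lrep (Tk_chart A c) d fst z = lrep c d (\<lambda>x. x) (fst z)"
proof -
  obtain p where p: "p \<in> fst c" "fst z = snd c p" using assms(3) by auto
  have "chart_inv (Tk_chart A c) z = tk_point A c p (snd z)"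
    using chart_inv_Tk_chart[OF assms(1,2) p(1), of "snd z"] p(2) by (metis prod.collapse)
  then show ?thesis using p assms by simp
qed

lemma smooth_map_Tk_fst:
  assumes "smooth_atlas A"
  shows "smooth_map (Tk A :: (('k::finite, 'a, 'e::euclidean_space) ktangent, _) atlas) A fst"
  unfolding smooth_map_def mcarrier_Tk
proof (intro conjI ballI)
  show "fst \<in> Tk_set A \<rightarrow> mcarrier A" using Tk_setD(1) by auto
  fix C d assume "C \<in> (Tk A :: (('k, 'a, 'e) ktangent, _) atlas)" and d: "d \<in> A"
  then obtain c where c: "c \<in> A" "C = Tk_chart A c" by (auto simp: Tk_def)
  note F = smooth_mapD[OF smooth_map_ident[OF assms] c(1) d]
  have dom: "ldom C d fst = ldom c d (\<lambda>x. x) \<times> UNIV"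
    unfolding c by (rule Tk_chart_image[OF assms c(1)])
  show o: "open (ldom C d fst)"
    unfolding dom using F(1) by (simp add: open_Times)
  show "smooth_on (ldom C d fst) (snd d \<circ> fst \<circ> chart_inv C)"
    unfolding lrep_def[symmetric]
  proof (rule smooth_on_cong[OF _ o])
    show "smooth_on (ldom C d fst) (\<lambda>z. lrep c d (\<lambda>x. x) (fst z))"
      by (rule smooth_on_compose[OF F(2) smooth_on_fst[OF o smooth_on_ident[OF o]] o F(1)])
        (auto simp: dom)
    show "lrep c d (\<lambda>x. x) (fst z) = lrep C d fst z" if "z \<in> ldom C d fst" for z
    proof -
      have "fst z \<in> snd c ` fst c" using that unfolding dom by auto
      then show ?thesis unfolding c by (rule lrep_Tk_fst[OF assms c(1), symmetric])
    qed
  qed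
qed

text \<open>In matching charts the projection is the linear map \<open>fst\<close>, which is its own
  derivative.\<close>

lemma tangent_map_Tk_fst:
  fixes A :: "('a, 'e::euclidean_space) atlas" and v :: "('k::finite, 'a, 'e) ktangent"
  assumes "smooth_atlas A" "v \<in> Tk_set A" "c \<in> A" "fst v \<in> fst c" "W \<in> tangent_space (Tk A) v"
  shows "tangent_map (Tk A) A fst v W c = fst (W (Tk_chart A c))"
proof -
  let ?C = "Tk_chart A c"
  have v: "v \<in> fst ?C" using assms by simp
  have "(lrep ?C c fst has_derivative fst) (at (snd ?C v))"
  proof (rule has_derivative_transform_within_open)
    show "(fst has_derivative fst) (at (snd ?C v))"
      by (rule bounded_linear_imp_has_derivative[OF bounded_linear_fst])
    show "open (snd c ` fst c \<times> (UNIV :: ('e ^ 'k) set))"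
      using chart_open[OF assms(1,3)] by (simp add: open_Times)
    show "snd ?C v \<in> snd c ` fst c \<times> UNIV" using assms(4) by auto
    fix z assume "z \<in> snd c ` fst c \<times> (UNIV :: ('e ^ 'k) set)"
    then show "fst z = lrep ?C c fst z"
      using lrep_Tk_fst[OF assms(1,3), of z c] assms(1,3) by auto
  qed
  from frechet_derivative_at[OF this] have D: "frechet_derivative (lrep ?C c fst) (at (snd ?C v)) = fst" by simp
  show ?thesis
    using tangent_map_at[OF smooth_atlas_Tk[OF assms(1)] smooth_map_Tk_fst[OF assms(1)] assms(5)
        Tk_chart_in[OF assms(3)] v assms(3,4)]
    unfolding D .
qed

section \<open>Products and parametrised maps\<close>

lemma prod_atlasE:
  assumes "C \<in> prod_atlas A B"
  obtains c d where "c \<in> A" "d \<in> B" "C = (fst c \<times> fst d, map_prod (snd c) (snd d))"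
  using assms by (auto simp: prod_atlas_def)

lemma prod_atlasI:
  "c \<in> A \<Longrightarrow> d \<in> B \<Longrightarrow> (fst c \<times> fst d, map_prod (snd c) (snd d)) \<in> prod_atlas A B"
  unfolding prod_atlas_def by blast

lemma mcarrier_prod: "mcarrier (prod_atlas A B) = mcarrier A \<times> mcarrier B"
proof
  show "mcarrier (prod_atlas A B) \<subseteq> mcarrier A \<times> mcarrier B"
    by (auto elim!: prod_atlasE simp: mcarrier_def[of "prod_atlas A B"] intro: mcarrierI)
  show "mcarrier A \<times> mcarrier B \<subseteq> mcarrier (prod_atlas A B)"
  proof
    fix z assume "z \<in> mcarrier A \<times> mcarrier B"
    then obtain c d where "c \<in> A" "d \<in> B" "fst z \<in> fst c" "snd z \<in> fst d"
      by (auto elim!: mcarrierE)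
    then show "z \<in> mcarrier (prod_atlas A B)"
      by (intro mcarrierI[OF prod_atlasI]) (auto simp: mem_Times_iff)
  qed
qed

lemma smooth_atlas_prod:
  assumes A: "smooth_atlas A" and B: "smooth_atlas B"
  shows "smooth_atlas (prod_atlas A B)"
  unfolding smooth_atlas_def
proof (intro conjI ballI)
  fix C assume "C \<in> prod_atlas A B"
  then obtain c d where c: "c \<in> A" "d \<in> B" and C: "C = (fst c \<times> fst d, map_prod (snd c) (snd d))"
    by (rule prod_atlasE)
  show inj: "inj_on (snd C) (fst C)"
    unfolding C using smooth_atlas_inj[OF A c(1)] smooth_atlas_inj[OF B c(2)]
    by (simp add: map_prod_inj_on)
  fix D assume "D \<in> prod_atlas A B"
  then obtain c' d' where c': "c' \<in> A" "d' \<in> B" and D: "D = (fst c' \<times> fst d', map_prod (snd c') (snd d'))"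
    by (rule prod_atlasE)
  note F = smooth_mapD[OF smooth_map_ident[OF A] c(1) c'(1)]
  note G = smooth_mapD[OF smooth_map_ident[OF B] c(2) c'(2)]
  let ?S = "ldom c c' (\<lambda>x. x) \<times> ldom d d' (\<lambda>x. x)"
  have S: "snd C ` (fst C \<inter> fst D) = ?S"
    by (auto simp: C D image_iff Bex_def)
  have o: "open ?S" using F G by (simp add: open_Times)
  then show "open (snd C ` (fst C \<inter> fst D))" by (simp only: S)
  note i = smooth_on_ident[OF o]
  have "smooth_on ?S (\<lambda>z. lrep c c' (\<lambda>x. x) (fst z))"
    by (rule smooth_on_compose[OF F(2) smooth_on_fst[OF o i] o F(1)]) auto
  moreover have "smooth_on ?S (\<lambda>z. lrep d d' (\<lambda>x. x) (snd z))"
    by (rule smooth_on_compose[OF G(2) smooth_on_snd[OF o i] o G(1)]) auto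
  ultimately have "smooth_on ?S (\<lambda>z. (lrep c c' (\<lambda>x. x) (fst z), lrep d d' (\<lambda>x. x) (snd z)))"
    by (rule smooth_on_Pair[OF o])
  then show "smooth_on (snd C ` (fst C \<inter> fst D)) (snd D \<circ> chart_inv C)"
    unfolding S
  proof (rule smooth_on_cong[OF _ o])
    fix z assume "z \<in> ?S"
    then obtain p q where p: "p \<in> fst c" "q \<in> fst d" "z = (snd c p, snd d q)" by auto
    have "chart_inv C z = (p, q)"
      using chart_inv_snd[OF inj, of "(p, q)"] p by (simp add: C)
    then show "(lrep c c' (\<lambda>x. x) (fst z), lrep d d' (\<lambda>x. x) (snd z)) = (snd D \<circ> chart_inv C) z"
      using p A B c by (simp add: D)
  qed
qed

lemma smooth_map_Pair_left:
  assumes A: "smooth_atlas A" and B: "smooth_atlas B" and a: "a \<in> mcarrier A"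
  shows "smooth_map B (prod_atlas A B) (\<lambda>y. (a, y))"
proof (rule smooth_mapI[OF B smooth_atlas_prod[OF A B]])
  fix p assume "p \<in> mcarrier B"
  then obtain c where c: "c \<in> B" "p \<in> fst c" by (rule mcarrierE)
  obtain e where e: "e \<in> A" "a \<in> fst e" using a by (rule mcarrierE)
  let ?e = "(fst e \<times> fst c, map_prod (snd e) (snd c))" and ?U = "snd c ` fst c"
  have o: "open ?U" by (rule chart_open[OF B c(1)])
  have "smooth_on ?U (\<lambda>x. (snd e a, x))"
    by (rule smooth_on_Pair[OF o smooth_on_const[OF o] smooth_on_ident[OF o]])
  then have "smooth_on ?U (lrep c ?e (\<lambda>y. (a, y)))"
    by (rule smooth_on_cong[OF _ o]) (use B c in auto)
  then show "\<exists>c\<in>B. \<exists>d\<in>prod_atlas A B. \<exists>U. p \<in> fst c \<and> (a, p) \<in> fst d \<and> open U \<and> snd c p \<in> U \<and>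
      U \<subseteq> ldom c d (\<lambda>y. (a, y)) \<and> smooth_on U (lrep c d (\<lambda>y. (a, y)))"
    using o c e by (intro bexI[of _ c] bexI[OF _ prod_atlasI[OF e(1) c(1)]] exI[of _ ?U]) auto
qed

lemma smooth_map_Pair_right:
  assumes A: "smooth_atlas A" and B: "smooth_atlas B" and b: "b \<in> mcarrier B"
  shows "smooth_map A (prod_atlas A B) (\<lambda>x. (x, b))"
proof (rule smooth_mapI[OF A smooth_atlas_prod[OF A B]])
  fix p assume "p \<in> mcarrier A"
  then obtain c where c: "c \<in> A" "p \<in> fst c" by (rule mcarrierE)
  obtain e where e: "e \<in> B" "b \<in> fst e" using b by (rule mcarrierE)
  let ?e = "(fst c \<times> fst e, map_prod (snd c) (snd e))" and ?U = "snd c ` fst c"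
  have o: "open ?U" by (rule chart_open[OF A c(1)])
  have "smooth_on ?U (\<lambda>x. (x, snd e b))"
    by (rule smooth_on_Pair[OF o smooth_on_ident[OF o] smooth_on_const[OF o]])
  then have "smooth_on ?U (lrep c ?e (\<lambda>x. (x, b)))"
    by (rule smooth_on_cong[OF _ o]) (use A c in auto)
  then show "\<exists>c\<in>A. \<exists>d\<in>prod_atlas A B. \<exists>U. p \<in> fst c \<and> (p, b) \<in> fst d \<and> open U \<and> snd c p \<in> U \<and>
      U \<subseteq> ldom c d (\<lambda>x. (x, b)) \<and> smooth_on U (lrep c d (\<lambda>x. (x, b)))"
    using o c e by (intro bexI[of _ c] bexI[OF _ prod_atlasI[OF c(1) e(1)]] exI[of _ ?U]) auto
qed

lemma smooth_map_slice_left: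
  assumes "smooth_atlas A" "smooth_atlas B" "smooth_map (prod_atlas A B) C F" "a \<in> mcarrier A"
  shows "smooth_map B C (\<lambda>y. F (a, y))"
  using smooth_map_comp[OF assms(2) smooth_atlas_prod[OF assms(1,2)] smooth_map_Pair_left[OF assms(1,2,4)] assms(3)] .

lemma smooth_map_slice_right:
  assumes "smooth_atlas A" "smooth_atlas B" "smooth_map (prod_atlas A B) C F" "b \<in> mcarrier B"
  shows "smooth_map A C (\<lambda>x. F (x, b))"
  using smooth_map_comp[OF assms(1) smooth_atlas_prod[OF assms(1,2)] smooth_map_Pair_right[OF assms(1,2,4)] assms(3)] .

text \<open>Freezing the parameter is an affine insertion with derivative
  \<open>\<lambda>v. (0, v)\<close>. A partial derivative thus becomes a directional derivative of
  one function that is smooth in parameter and point together.\<close>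

lemma lderiv_slice_left:
  assumes A: "smooth_atlas A" and B: "smooth_atlas B" and F: "smooth_map (prod_atlas A B) C F"
    and a: "a \<in> A" "g \<in> fst a" and b: "b \<in> B" "p \<in> fst b" and c: "c \<in> C" "F (g, p) \<in> fst c"
  shows "lderiv b c (\<lambda>y. F (g, y)) p v =
    frechet_derivative (lrep (fst a \<times> fst b, map_prod (snd a) (snd b)) c F) (at (snd a g, snd b p)) (0, v)"
proof -
  let ?e = "(fst a \<times> fst b, map_prod (snd a) (snd b))"
  have P: "smooth_map B (prod_atlas A B) (\<lambda>y. (g, y))"
    by (rule smooth_map_Pair_left[OF A B mcarrierI[OF a]])
  have "lderiv b c (\<lambda>y. F (g, y)) p v = lderiv ?e c F (g, p) (lderiv b ?e (\<lambda>y. (g, y)) p v)"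
    by (rule lderiv_comp[OF B smooth_atlas_prod[OF A B] P F b prod_atlasI[OF a(1) b(1)] _ c]) (simp add: a b)
  moreover have "(lrep b ?e (\<lambda>y. (g, y)) has_derivative (\<lambda>v. (0, v))) (at (snd b p))"
  proof (rule has_derivative_transform_within_open)
    show "((\<lambda>x. (snd a g, x)) has_derivative (\<lambda>v. (0, v))) (at (snd b p))"
      by (intro has_derivative_Pair has_derivative_const has_derivative_ident)
    show "open (snd b ` fst b)" by (rule chart_open[OF B b(1)])
    show "snd b p \<in> snd b ` fst b" using b by simp
    show "(snd a g, x) = lrep b ?e (\<lambda>y. (g, y)) x" if "x \<in> snd b ` fst b" for x
      using that B b by auto
  qed
  then have "lderiv b ?e (\<lambda>y. (g, y)) p = (\<lambda>v. (0, v))" by (metis frechet_derivative_at)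
  ultimately show ?thesis by simp
qed

text \<open>Serves to make a lifted action smooth jointly in group element and tangent vectors;
  smoothness of each lifted map by itself would be too weak.\<close>

lemma smooth_map_Tk_family:
  fixes F :: "'a \<times> 'b \<Rightarrow> 'c" and A :: "('a, 'd::euclidean_space) atlas"
    and B :: "('b, 'e::euclidean_space) atlas" and C :: "('c, 'f::euclidean_space) atlas"
  assumes A: "smooth_atlas A" and B: "smooth_atlas B" and C: "smooth_atlas C"
    and F: "smooth_map (prod_atlas A B) C F"
  shows "smooth_map (prod_atlas A (Tk B)) (Tk C)
    (\<lambda>z :: 'a \<times> ('k::finite, 'b, 'e) ktangent. Tk_map B C (\<lambda>p. F (fst z, p)) (snd z))"
    (is "smooth_map _ _ ?T")
proof (rule smooth_mapI[OF smooth_atlas_prod[OF A smooth_atlas_Tk[OF B]] smooth_atlas_Tk[OF C]])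
  fix z assume "z \<in> mcarrier (prod_atlas A (Tk B :: (('k, 'b, 'e) ktangent, _) atlas))"
  then have z: "fst z \<in> mcarrier A" "snd z \<in> Tk_set B" by (auto simp: mcarrier_prod mcarrier_Tk)
  obtain a where a: "a \<in> A" "fst z \<in> fst a" using z(1) by (rule mcarrierE)
  obtain b where b: "b \<in> B" "fst (snd z) \<in> fst b" using Tk_setD(1)[OF z(2)] by (rule mcarrierE)
  have "(fst z, fst (snd z)) \<in> mcarrier (prod_atlas A B)"
    using z Tk_setD(1)[OF z(2)] by (simp add: mcarrier_prod)
  then have "F (fst z, fst (snd z)) \<in> mcarrier C" by (rule smooth_map_carrier[OF F])
  then obtain c where c: "c \<in> C" "F (fst z, fst (snd z)) \<in> fst c" by (rule mcarrierE)
  let ?e = "(fst a \<times> fst b, map_prod (snd a) (snd b))"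
  let ?b = "Tk_chart B b :: (('k, 'b, 'e) ktangent, _) chart"
  let ?E = "(fst a \<times> fst ?b, map_prod (snd a) (snd ?b))"
  let ?c = "Tk_chart C c :: (('k, 'c, 'f) ktangent, _) chart"
  note S = smooth_mapD[OF F prod_atlasI[OF a(1) b(1)] c(1)]
  let ?h = "\<lambda>y :: 'd \<times> ('e \<times> ('e ^ 'k)). (fst y, fst (snd y))"
  \<comment> \<open>\<open>?h\<close> forgets the fibre coordinates: whether the image lies in the
    natural chart over \<open>c\<close> depends on parameter and base point alone.\<close>
  define U where "U = {y. ?h y \<in> ldom ?e c F}"
  have h: "smooth_on UNIV ?h"
    by (intro smooth_on_Pair smooth_on_fst smooth_on_snd smooth_on_ident open_UNIV)
  have oU: "open U" using open_preimage_on[OF h open_UNIV S(1)] by (simp add: U_def)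
  have hU: "?h ` U \<subseteq> ldom ?e c F" by (auto simp: U_def)
  note h' = smooth_on_mono[OF h subset_UNIV, of U]
  let ?R = "lrep ?e c F"
  let ?T' = "\<lambda>y. (?R (?h y), \<chi> \<alpha>. frechet_derivative ?R (at (?h y)) (0, snd (snd y) $ \<alpha>))"
  have "smooth_on U (\<lambda>y. ?R (?h y))"
    by (rule smooth_on_compose[OF S(2) h' oU S(1) hU])
  moreover have "smooth_on U (\<lambda>y. \<chi> \<alpha>. frechet_derivative ?R (at (?h y)) (0, snd (snd y) $ \<alpha>))"
    by (intro smooth_on_vec[OF oU] smooth_on_deriv[OF S(2,1) oU h' hU] smooth_on_Pair[OF oU]
        smooth_on_const[OF oU] smooth_on_nth[OF oU] smooth_on_snd[OF oU] smooth_on_ident[OF oU])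
  ultimately have sm: "smooth_on U ?T'" by (rule smooth_on_Pair[OF oU])
  have key: "y \<in> ldom ?E ?c ?T \<and> lrep ?E ?c ?T y = ?T' y" if yU: "y \<in> U" for y
  proof -
    obtain g p where g: "g \<in> fst a" "p \<in> fst b" "fst y = snd a g" "fst (snd y) = snd b p" "F (g, p) \<in> fst c"
      using yU by (auto simp: U_def)
    let ?w = "tk_point B b p (snd (snd y))"
    have y: "y = map_prod (snd a) (snd ?b) (g, ?w)"
      using g tk_point_coord[OF B b(1) g(2), of "snd (snd y)"] by (simp add: prod_eq_iff del: snd_Tk_chart)
    have w: "?w \<in> Tk_set B" by (rule tk_point_in[OF B b(1) g(2)])
    have inv: "chart_inv ?E y = (g, ?w)"
      using chart_inv_atlas[OF smooth_atlas_prod[OF A smooth_atlas_Tk[OF B]] prod_atlasI[OF a(1) Tk_chart_in[OF b(1)]],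
        of "(g, ?w)"] y g w by simp
    have Fg: "smooth_map B C (\<lambda>p. F (g, p))"
      by (rule smooth_map_slice_left[OF A B F mcarrierI[OF a(1) g(1)]])
    have T: "?T (g, ?w) \<in> fst ?c" using Tk_map_in[OF B C Fg w] g by simp
    have "lrep ?E ?c ?T y = snd ?c (Tk_map B C (\<lambda>p. F (g, p)) ?w)"
      by (simp only: lrep_apply inv fst_conv snd_conv)
    also have "\<dots> = (snd c (F (g, p)), \<chi> \<alpha>. lderiv b c (\<lambda>p. F (g, p)) p (snd (snd y) $ \<alpha>))"
      by (rule Tk_map_coord[OF B Fg b(1) g(2) c(1) g(5)])
    also have "\<dots> = (snd c (F (g, p)), \<chi> \<alpha>. frechet_derivative ?R (at (snd a g, snd b p)) (0, snd (snd y) $ \<alpha>))"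
      by (simp only: lderiv_slice_left[OF A B F a(1) g(1) b(1) g(2) c(1) g(5)])
    also have "snd c (F (g, p)) = ?R (?h y)"
      using chart_inv_atlas[OF smooth_atlas_prod[OF A B] prod_atlasI[OF a(1) b(1)], of "(g, p)"] g by simp
    finally have "lrep ?E ?c ?T y = ?T' y" by (simp only: g(3,4))
    moreover have "y \<in> ldom ?E ?c ?T"
      by (rule image_eqI[of _ _ "(g, ?w)"]) (use y T g w in auto)
    ultimately show ?thesis by simp
  qed
  have "smooth_on U (lrep ?E ?c ?T)"
    by (rule smooth_on_cong[OF sm oU]) (use key in simp)
  moreover have "U \<subseteq> ldom ?E ?c ?T" using key by blast
  moreover have "snd ?E z \<in> U"
  proof -
    have "?h (snd ?E z) = map_prod (snd a) (snd b) (fst z, fst (snd z))" by (cases z) simp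
    moreover have "(fst z, fst (snd z)) \<in> {x \<in> fst ?e. F x \<in> fst c}" using a b c by simp
    ultimately show ?thesis unfolding U_def by auto
  qed
  moreover have "z \<in> fst ?E" using a b z by (simp add: mem_Times_iff)
  moreover have "?T z \<in> fst ?c"
    using Tk_map_in[OF B C smooth_map_slice_left[OF A B F z(1)] z(2)] c by simp
  ultimately show "\<exists>d\<in>prod_atlas A (Tk B). \<exists>e\<in>Tk C. \<exists>U. z \<in> fst d \<and> ?T z \<in> fst e \<and> open U \<and> snd d z \<in> U \<and>
      U \<subseteq> ldom d e ?T \<and> smooth_on U (lrep d e ?T)"
    using oU by (intro bexI[OF _ prod_atlasI[OF a(1) Tk_chart_in[OF b(1)]]] bexI[OF _ Tk_chart_in[OF c(1)]] exI[of _ U])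
      simp
qed

section \<open>The fibre Hessian of a Lagrangian\<close>

text \<open>\<open>fibre_hessian\<close> with arbitrary fibre directions in place of coordinate
  directions, so that linear maps can be applied to its arguments.\<close>

definition fibre_D2 ::
  "('e::euclidean_space \<times> 'f::euclidean_space \<Rightarrow> real) \<Rightarrow> 'e \<times> 'f \<Rightarrow> 'f \<Rightarrow> 'f \<Rightarrow> real" where
  "fibre_D2 F z a b = frechet_derivative (\<lambda>y. frechet_derivative F (at y) (0, b)) (at z) (0, a)"

lemma linear_fibre_D2_left:
  assumes "smooth_on S F" "z \<in> S"
  shows "linear (\<lambda>a. fibre_D2 F z a b)"
proof -
  have "linear (frechet_derivative (\<lambda>y. frechet_derivative F (at y) (0, b)) (at z))"
    by (rule smooth_on_linear_deriv[OF smooth_on_deriv_const[OF assms(1)] assms(2)])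
  moreover have "linear (\<lambda>a. (0, a))" by (rule linearI) auto
  ultimately show ?thesis unfolding fibre_D2_def by (rule linear_compose[unfolded o_def, rotated])
qed

text \<open>Here \<open>b\<close> sits inside the inner derivative, so its linearity has to hold at
  all points near \<open>z\<close> before the outer derivative is taken; hence the openness of
  \<open>S\<close>.\<close>

lemma linear_fibre_D2_right:
  assumes "open S" "smooth_on S F" "z \<in> S"
  shows "linear (fibre_D2 F z a)"
proof -
  have lin: "linear (frechet_derivative F (at y))" if "y \<in> S" for y
    by (rule smooth_on_linear_deriv[OF assms(2) that])
  have D: "((\<lambda>y. frechet_derivative F (at y) (0, b)) has_derivative
      frechet_derivative (\<lambda>y. frechet_derivative F (at y) (0, b)) (at z)) (at z)" for b
    by (rule smooth_on_has_derivative[OF smooth_on_deriv_const[OF assms(2)] assms(3)])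
  show ?thesis
  proof (rule linearI)
    fix b b'
    have "((\<lambda>y. frechet_derivative F (at y) (0, b + b')) has_derivative
       (\<lambda>v. frechet_derivative (\<lambda>y. frechet_derivative F (at y) (0, b)) (at z) v +
          frechet_derivative (\<lambda>y. frechet_derivative F (at y) (0, b')) (at z) v)) (at z)"
    proof (rule has_derivative_transform_within_open[OF has_derivative_add[OF D[of b] D[of b']] assms(1,3)])
      show "frechet_derivative F (at y) (0, b) + frechet_derivative F (at y) (0, b') =
          frechet_derivative F (at y) (0, b + b')" if "y \<in> S" for y
        using linear_add[OF lin[OF that], of "(0, b)" "(0, b')"] by simp
    qed
    from fun_cong[OF frechet_derivative_at[OF this], of "(0, a)"]
    show "fibre_D2 F z a (b + b') = fibre_D2 F z a b + fibre_D2 F z a b'"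
      unfolding fibre_D2_def by (rule sym)
  next
    fix r b
    have "((\<lambda>y. frechet_derivative F (at y) (0, r *\<^sub>R b)) has_derivative
       (\<lambda>v. r *\<^sub>R frechet_derivative (\<lambda>y. frechet_derivative F (at y) (0, b)) (at z) v)) (at z)"
    proof (rule has_derivative_transform_within_open[OF has_derivative_scaleR_right[OF D[of b]] assms(1,3)])
      show "r *\<^sub>R frechet_derivative F (at y) (0, b) = frechet_derivative F (at y) (0, r *\<^sub>R b)"
        if "y \<in> S" for y
        using linear_scale[OF lin[OF that], of r "(0, b)"] by simp
    qed
    from fun_cong[OF frechet_derivative_at[OF this], of "(0, a)"]
    show "fibre_D2 F z a (r *\<^sub>R b) = r *\<^sub>R fibre_D2 F z a b"
      unfolding fibre_D2_def by (rule sym)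
  qed
qed

lemma smooth_on_fibre_D2:
  assumes "smooth_on T F" "open T" "open S" "smooth_on S g" "g ` S \<subseteq> T" "smooth_on S h" "smooth_on S k"
  shows "smooth_on S (\<lambda>x. fibre_D2 F (g x) (h x) (k x))"
proof -
  have "smooth_on S (\<lambda>x. fibre_D2 F (g x) (h x) e)" for e
    unfolding fibre_D2_def
    by (rule smooth_on_deriv[OF smooth_on_deriv_const[OF assms(1)] assms(2-5)
        smooth_on_Pair[OF assms(3) smooth_on_const[OF assms(3)] assms(6)]])
  then have "smooth_on S (\<lambda>x. \<Sum>e\<in>Basis. (k x \<bullet> e) *\<^sub>R fibre_D2 F (g x) (h x) e)"
    by (intro smooth_on_sum[OF assms(3)] smooth_on_scaleR[OF assms(3)]
        smooth_on_bounded_linear[OF bounded_linear_inner_left assms(3,7)])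
  then show ?thesis
  proof (rule smooth_on_cong[OF _ assms(3)])
    fix x assume "x \<in> S"
    then have "linear (fibre_D2 F (g x) (h x))"
      using assms(5) by (intro linear_fibre_D2_right[OF assms(2,1)]) auto
    then show "(\<Sum>e\<in>Basis. (k x \<bullet> e) *\<^sub>R fibre_D2 F (g x) (h x) e) = fibre_D2 F (g x) (h x) (k x)"
      by (rule linear_expand_Basis[symmetric])
  qed
qed

text \<open>Restricting to a fibre turns a fibrewise linear change of coordinates into a linear one; applied
  twice this gives the transformation law of the fibre Hessian.\<close>

lemma fibre_derivative_linear_change:
  fixes F :: "'e::euclidean_space \<times> 'f::euclidean_space \<Rightarrow> real"
    and F' :: "'g::euclidean_space \<times> 'h::euclidean_space \<Rightarrow> real"
  assumes "F differentiable (at (x, u))" "F' differentiable (at (x', T u))" "linear T"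
    and "\<And>u. F (x, u) = F' (x', T u)"
  shows "frechet_derivative F (at (x, u)) (0, a) = frechet_derivative F' (at (x', T u)) (0, T a)"
proof -
  have F: "(F has_derivative frechet_derivative F (at (x, u))) (at (x, u))"
    and F': "(F' has_derivative frechet_derivative F' (at (x', T u))) (at (x', T u))"
    using assms(1,2) by (simp_all add: frechet_derivative_works[symmetric])
  have "((\<lambda>u. (x, u)) has_derivative (\<lambda>a. (0, a))) (at u)"
    by (intro has_derivative_Pair has_derivative_const has_derivative_ident)
  from has_derivative_compose[OF this F]
  have 1: "((\<lambda>u. F (x, u)) has_derivative (\<lambda>a. frechet_derivative F (at (x, u)) (0, a))) (at u)" .
  have "(T has_derivative T) (at u)"
    using assms(3) by (simp add: linear_imp_has_derivative)
  then have "((\<lambda>u. (x', T u)) has_derivative (\<lambda>a. (0, T a))) (at u)"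
    by (intro has_derivative_Pair has_derivative_const)
  from has_derivative_compose[OF this F']
  have "((\<lambda>u. F' (x', T u)) has_derivative (\<lambda>a. frechet_derivative F' (at (x', T u)) (0, T a))) (at u)" .
  then have 2: "((\<lambda>u. F (x, u)) has_derivative (\<lambda>a. frechet_derivative F' (at (x', T u)) (0, T a))) (at u)"
    by (simp only: assms(4))
  show ?thesis using fun_cong[OF has_derivative_unique[OF 1 2]] .
qed

section \<open>The Lagrangian in natural coordinates and its bilinear form\<close>

abbreviation local_lagr ::
  "('q, real ^ 'n) atlas \<Rightarrow> ('k::finite, 'q, 'n::finite) lagrangian \<Rightarrow> ('q, real ^ 'n) chart \<Rightarrow>
    (real ^ 'n) \<times> ((real ^ 'n) ^ 'k) \<Rightarrow> real" where
  "local_lagr Q L c \<equiv> L \<circ> chart_inv (Tk_chart Q c)"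

lemma smooth_on_local_lagr:
  fixes L :: "('k::finite, 'q, 'n::finite) lagrangian"
  assumes "smooth_atlas Q" "smooth_map (Tk Q) euclidean_atlas L" "c \<in> Q"
  shows "smooth_on (snd c ` fst c \<times> UNIV) (local_lagr Q L c)"
proof -
  let ?d = "(UNIV, id) :: (real, real) chart"
  have "?d \<in> euclidean_atlas" by (simp add: euclidean_atlas_def)
  note S = smooth_mapD(2)[OF assms(2) Tk_chart_in[OF assms(3)] this]
  have "ldom (Tk_chart Q c) ?d L = snd c ` fst c \<times> UNIV"
    using Tk_chart_image[OF assms(1,3), of "\<lambda>_. True"] by simp
  moreover have "lrep (Tk_chart Q c) ?d L = local_lagr Q L c" by (auto simp: lrep_def)
  ultimately show ?thesis using S by simp
qed

text \<open>One statement with two uses: for the identity it yields independence of the chart, for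
  \<open>\<Phi> g\<close> invariance under the group.\<close>

lemma fibre_D2_natural:
  fixes L :: "('k::finite, 'q, 'n::finite) lagrangian"
  assumes Q: "smooth_atlas Q" and L: "smooth_map (Tk Q) euclidean_atlas L" and f: "smooth_map Q Q f"
    and inv: "\<And>v. v \<in> Tk_set Q \<Longrightarrow> L (Tk_map Q Q f v) = L v"
    and c: "c \<in> Q" "q \<in> fst c" and d: "d \<in> Q" "f q \<in> fst d"
  defines "T \<equiv> (\<lambda>u. \<chi> \<alpha>. lderiv c d f q (u $ \<alpha>)) :: (real ^ 'n) ^ 'k \<Rightarrow> (real ^ 'n) ^ 'k"
  shows "fibre_D2 (local_lagr Q L c) (snd c q, u) a b =
    fibre_D2 (local_lagr Q L d) (snd d (f q), T u) (T a) (T b)"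
proof -
  have l: "linear (lderiv c d f q)" by (rule lderiv_linear[OF f c(1) d(1) c(2) d(2)])
  have T: "linear T"
    by (rule linearI) (auto simp: T_def vec_eq_iff linear_add[OF l] linear_scale[OF l])
  note C = smooth_on_local_lagr[OF Q L c(1)] and D = smooth_on_local_lagr[OF Q L d(1)]
  have inC: "(snd c q, u) \<in> snd c ` fst c \<times> UNIV" for u :: "(real ^ 'n) ^ 'k" using c by auto
  have inD: "(snd d (f q), u) \<in> snd d ` fst d \<times> UNIV" for u :: "(real ^ 'n) ^ 'k" using d by auto
  have eq: "local_lagr Q L c (snd c q, u) = local_lagr Q L d (snd d (f q), T u)" for u
  proof -
    let ?v = "tk_point Q c q u"
    let ?w = "Tk_map Q Q f ?v"
    have v: "?v \<in> Tk_set Q" by (rule tk_point_in[OF Q c])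
    have w: "?w \<in> fst (Tk_chart Q d)" using Tk_map_in[OF Q Q f v] d by simp
    have "snd (Tk_chart Q d) ?w = (snd d (f q), T u)"
      unfolding T_def by (rule Tk_map_coord[OF Q f c d])
    then have "chart_inv (Tk_chart Q d) (snd d (f q), T u) = ?w"
      using chart_inv_snd[OF inj_on_Tk_chart[OF Q d(1)] w] by simp
    then show ?thesis using inv[OF v] by (simp add: chart_inv_Tk_chart[OF Q c])
  qed
  \<comment> \<open>Since this holds at every fibre point \<open>u\<close>, it is again an identity
    between functions on the fibre and can be differentiated once more.\<close>
  have eq1: "frechet_derivative (local_lagr Q L c) (at (snd c q, u)) (0, b) =
      frechet_derivative (local_lagr Q L d) (at (snd d (f q), T u)) (0, T b)" for u
    by (rule fibre_derivative_linear_change[OF smooth_on_differentiable[OF C inC]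
        smooth_on_differentiable[OF D inD] T eq])
  show ?thesis
    unfolding fibre_D2_def
    by (rule fibre_derivative_linear_change[OF
        smooth_on_differentiable[OF smooth_on_deriv_const[OF C] inC]
        smooth_on_differentiable[OF smooth_on_deriv_const[OF D] inD] T eq1])
qed

lemma fibre_D2_chart_independent:
  fixes L :: "('k::finite, 'q, 'n::finite) lagrangian"
  assumes "smooth_atlas Q" "smooth_map (Tk Q) euclidean_atlas L" "v \<in> Tk_set Q"
    and "\<And>\<alpha>. u \<alpha> \<in> tangent_space Q (fst v)" "\<And>\<alpha>. w \<alpha> \<in> tangent_space Q (fst v)"
    and c: "c \<in> Q" "fst v \<in> fst c" and d: "d \<in> Q" "fst v \<in> fst d"
  shows "fibre_D2 (local_lagr Q L c) (snd (Tk_chart Q c) v) (\<chi> \<alpha>. u \<alpha> c) (\<chi> \<beta>. w \<beta> c) =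
    fibre_D2 (local_lagr Q L d) (snd (Tk_chart Q d) v) (\<chi> \<alpha>. u \<alpha> d) (\<chi> \<beta>. w \<beta> d)"
proof -
  have inv: "L (Tk_map Q Q (\<lambda>x. x) v) = L v" if "v \<in> Tk_set Q" for v
    by (simp only: Tk_map_ident[OF assms(1) that])
  show ?thesis
    using fibre_D2_natural[OF assms(1,2) smooth_map_ident[OF assms(1)] inv c d, of "\<chi> \<alpha>. snd v \<alpha> c"
        "\<chi> \<alpha>. u \<alpha> c" "\<chi> \<beta>. w \<beta> c"]
    by (simp add: tangent_space_trans[OF assms(4) c d, symmetric] tangent_space_trans[OF assms(5) c d, symmetric]
        tangent_space_trans[OF Tk_setD(2)[OF assms(3)] c d, symmetric])
qed

lemma partial_eq: "partial f b = (\<lambda>x. frechet_derivative f (at x) b)"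
  by (simp add: partial_def fun_eq_iff)

lemma vec_expand_axis:
  fixes u :: "'k::finite \<Rightarrow> real ^ 'n::finite"
  shows "(\<chi> \<alpha>. u \<alpha>) = (\<Sum>\<alpha>\<in>UNIV. \<Sum>A\<in>UNIV. (u \<alpha> $ A) *\<^sub>R axis \<alpha> (axis A 1))"
proof -
  have "(\<Sum>A\<in>UNIV. (x $ A) *\<^sub>R axis A 1) = x" for x :: "real ^ 'n"
    by (auto simp: vec_eq_iff axis_def if_distrib[of "\<lambda>v. _ * v"] sum.delta cong: if_cong)
  then have "(\<Sum>A\<in>UNIV. (u \<alpha> $ A) *\<^sub>R axis \<alpha> (axis A 1)) = axis \<alpha> (u \<alpha>)" for \<alpha> :: 'k
    by (simp only: linear_scale[OF linear_axis, symmetric] linear_sum[OF linear_axis, symmetric])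
  then show ?thesis by (simp only: sum_axis)
qed

text \<open>Replaces the arbitrary chart inside \<open>g_comp\<close> by any chart around the base
  point, and the fourfold coordinate sum by a bilinear form.\<close>

lemma g_total_eq:
  fixes L :: "('k::finite, 'q, 'n::finite) lagrangian"
  assumes "smooth_atlas Q" "smooth_map (Tk Q) euclidean_atlas L" "v \<in> Tk_set Q"
    and "\<And>\<alpha>. u \<alpha> \<in> tangent_space Q (fst v)" "\<And>\<alpha>. w \<alpha> \<in> tangent_space Q (fst v)"
    and "c \<in> Q" "fst v \<in> fst c"
  shows "g_total Q L v u w =
    fibre_D2 (local_lagr Q L c) (snd (Tk_chart Q c) v) (\<chi> \<alpha>. u \<alpha> c) (\<chi> \<beta>. w \<beta> c)"
proof -
  define d where "d = chart_at Q (fst v)"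
  have d: "d \<in> Q" "fst v \<in> fst d" using chart_at_in[OF Tk_setD(1)[OF assms(3)]] by (simp_all add: d_def)
  let ?z = "snd (Tk_chart Q d) v"
  let ?H = "fibre_D2 (local_lagr Q L d) ?z"
  have o: "open (snd d ` fst d \<times> (UNIV :: ((real ^ 'n) ^ 'k) set))"
    using chart_open[OF assms(1) d(1)] by (simp add: open_Times)
  have z: "?z \<in> snd d ` fst d \<times> UNIV" using d by auto
  note S = smooth_on_local_lagr[OF assms(1,2) d(1)]
  note l1 = linear_fibre_D2_left[OF S z] and l2 = linear_fibre_D2_right[OF o S z]
  have "?H (\<chi> \<alpha>. u \<alpha> d) (\<chi> \<beta>. w \<beta> d) =
     (\<Sum>\<beta>\<in>UNIV. \<Sum>B\<in>UNIV. (w \<beta> d $ B) *\<^sub>R ?H (\<chi> \<alpha>. u \<alpha> d) (axis \<beta> (axis B 1)))"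
    by (subst vec_expand_axis[of "\<lambda>\<beta>. w \<beta> d"]) (simp only: linear_sum[OF l2] linear_scale[OF l2])
  also have "\<dots> = (\<Sum>\<beta>\<in>UNIV. \<Sum>B\<in>UNIV. (w \<beta> d $ B) *\<^sub>R
      (\<Sum>\<alpha>\<in>UNIV. \<Sum>A\<in>UNIV. (u \<alpha> d $ A) *\<^sub>R ?H (axis \<alpha> (axis A 1)) (axis \<beta> (axis B 1))))"
    by (subst vec_expand_axis[of "\<lambda>\<alpha>. u \<alpha> d"]) (simp only: linear_sum[OF l1] linear_scale[OF l1])
  also have "\<dots> = (\<Sum>\<beta>\<in>UNIV. \<Sum>B\<in>UNIV. \<Sum>\<alpha>\<in>UNIV. \<Sum>A\<in>UNIV.
      ?H (axis \<alpha> (axis A 1)) (axis \<beta> (axis B 1)) * u \<alpha> d $ A * w \<beta> d $ B)"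
    by (simp add: sum_distrib_left mult_ac)
  \<comment> \<open>From here the sums are only reordered, into the order \<alpha>, \<beta>, A, B of
    \<open>g_total\<close> and \<open>g_comp\<close>.\<close>
  also have "\<dots> = (\<Sum>\<beta>\<in>UNIV. \<Sum>\<alpha>\<in>UNIV. \<Sum>B\<in>UNIV. \<Sum>A\<in>UNIV.
      ?H (axis \<alpha> (axis A 1)) (axis \<beta> (axis B 1)) * u \<alpha> d $ A * w \<beta> d $ B)"
    by (rule sum.cong[OF refl]) (rule sum.swap)
  also have "\<dots> = (\<Sum>\<alpha>\<in>UNIV. \<Sum>\<beta>\<in>UNIV. \<Sum>B\<in>UNIV. \<Sum>A\<in>UNIV.
      ?H (axis \<alpha> (axis A 1)) (axis \<beta> (axis B 1)) * u \<alpha> d $ A * w \<beta> d $ B)"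
    by (rule sum.swap)
  also have "\<dots> = (\<Sum>\<alpha>\<in>UNIV. \<Sum>\<beta>\<in>UNIV. \<Sum>A\<in>UNIV. \<Sum>B\<in>UNIV.
      ?H (axis \<alpha> (axis A 1)) (axis \<beta> (axis B 1)) * u \<alpha> d $ A * w \<beta> d $ B)"
    by (intro sum.cong[OF refl] sum.swap)
  also have "\<dots> = g_total Q L v u w"
    unfolding g_total_def g_comp_def Let_def d_def[symmetric] fibre_hessian_def partial_eq fibre_D2_def ..
  finally show ?thesis
    using fibre_D2_chart_independent[OF assms d] by simp
qed

lemma vec_axis: "(\<chi> \<alpha>'. if \<alpha>' = \<alpha> then x else 0) = axis \<alpha> x"
  by (simp add: axis_def)

text \<open>Families concentrated in one slot recover the single components, which thereby inherit
  the chart independence of \<open>g_total\<close>.\<close>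

lemma g_comp_as_total:
  fixes L :: "('k::finite, 'q, 'n::finite) lagrangian"
  shows "g_comp Q L v \<alpha> \<beta> u w =
    g_total Q L v (\<lambda>\<alpha>'. if \<alpha>' = \<alpha> then u else (\<lambda>c. 0)) (\<lambda>\<beta>'. if \<beta>' = \<beta> then w else (\<lambda>c. 0))"
proof -
  have "g_comp Q L v \<alpha>' \<beta>' (if \<alpha>' = \<alpha> then u else (\<lambda>c. 0)) (if \<beta>' = \<beta> then w else (\<lambda>c. 0)) =
    (if \<alpha>' = \<alpha> then if \<beta>' = \<beta> then g_comp Q L v \<alpha> \<beta> u w else 0 else 0)" for \<alpha>' \<beta>'
    by (simp add: g_comp_def)
  moreover have "(\<Sum>\<beta>'\<in>UNIV. if \<alpha>' = \<alpha> then if \<beta>' = \<beta> then K else 0 else 0) = (if \<alpha>' = \<alpha> then K else 0)"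
    for \<alpha>' and K :: real by simp
  ultimately show ?thesis by (simp add: g_total_def)
qed

lemma g_comp_eq:
  fixes L :: "('k::finite, 'q, 'n::finite) lagrangian"
  assumes "smooth_atlas Q" "smooth_map (Tk Q) euclidean_atlas L" "v \<in> Tk_set Q"
    and "u \<in> tangent_space Q (fst v)" "w \<in> tangent_space Q (fst v)"
    and "c \<in> Q" "fst v \<in> fst c"
  shows "g_comp Q L v \<alpha> \<beta> u w =
    fibre_D2 (local_lagr Q L c) (snd (Tk_chart Q c) v) (axis \<alpha> (u c)) (axis \<beta> (w c))"
proof -
  note 0 = tangent_space_zero[OF assms(1)]
  have u: "(if \<gamma> = \<alpha> then u else (\<lambda>c. 0)) \<in> tangent_space Q (fst v)" for \<gamma>
    using assms(4) 0 by simp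
  have w: "(if \<gamma> = \<beta> then w else (\<lambda>c. 0)) \<in> tangent_space Q (fst v)" for \<gamma>
    using assms(5) 0 by simp
  from g_total_eq[OF assms(1-3), where u="\<lambda>\<alpha>'. if \<alpha>' = \<alpha> then u else (\<lambda>c. 0)" and
      w="\<lambda>\<beta>'. if \<beta>' = \<beta> then w else (\<lambda>c. 0)", OF u w assms(6,7)]
  show ?thesis
    unfolding g_comp_as_total if_distrib[of "\<lambda>f. f c"] vec_axis .
qed

lemma g_total_natural:
  fixes L :: "('k::finite, 'q, 'n::finite) lagrangian"
  assumes Q: "smooth_atlas Q" and L: "smooth_map (Tk Q) euclidean_atlas L" and f: "smooth_map Q Q f"
    and inv: "\<And>v. v \<in> Tk_set Q \<Longrightarrow> L (Tk_map Q Q f v) = L v"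
    and v: "v \<in> Tk_set Q"
    and u: "\<And>\<alpha>. u \<alpha> \<in> tangent_space Q (fst v)" and w: "\<And>\<alpha>. w \<alpha> \<in> tangent_space Q (fst v)"
  shows "g_total Q L (Tk_map Q Q f v) (\<lambda>\<alpha>. tangent_map Q Q f (fst v) (u \<alpha>))
      (\<lambda>\<alpha>. tangent_map Q Q f (fst v) (w \<alpha>)) = g_total Q L v u w"
proof -
  obtain c where c: "c \<in> Q" "fst v \<in> fst c" using Tk_setD(1)[OF v] by (rule mcarrierE)
  obtain d where d: "d \<in> Q" "f (fst v) \<in> fst d"
    using smooth_map_carrier[OF f Tk_setD(1)[OF v]] by (rule mcarrierE)
  have t: "tangent_map Q Q f (fst v) x \<in> tangent_space Q (fst (Tk_map Q Q f v))"
    if "x \<in> tangent_space Q (fst v)" for x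
    using tangent_map_in[OF Q Q f that Tk_setD(1)[OF v]] by simp
  have td: "tangent_map Q Q f (fst v) x d = lderiv c d f (fst v) (x c)"
    if "x \<in> tangent_space Q (fst v)" for x
    by (rule tangent_map_at[OF Q f that c d])
  have "g_total Q L (Tk_map Q Q f v) (\<lambda>\<alpha>. tangent_map Q Q f (fst v) (u \<alpha>))
      (\<lambda>\<alpha>. tangent_map Q Q f (fst v) (w \<alpha>)) = fibre_D2 (local_lagr Q L d)
        (snd (Tk_chart Q d) (Tk_map Q Q f v)) (\<chi> \<alpha>. tangent_map Q Q f (fst v) (u \<alpha>) d)
        (\<chi> \<alpha>. tangent_map Q Q f (fst v) (w \<alpha>) d)"
    using d by (intro g_total_eq[OF Q L Tk_map_in[OF Q Q f v] t[OF u] t[OF w]]) simp_all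
  also have "snd (Tk_chart Q d) (Tk_map Q Q f v) =
      (snd d (f (fst v)), \<chi> \<alpha>. lderiv c d f (fst v) ((\<chi> \<alpha>. snd v \<alpha> c) $ \<alpha>))"
    using td[OF Tk_setD(2)[OF v]] by (simp add: snd_Tk_map)
  also have "(\<chi> \<alpha>. tangent_map Q Q f (fst v) (u \<alpha>) d) = (\<chi> \<alpha>. lderiv c d f (fst v) ((\<chi> \<alpha>. u \<alpha> c) $ \<alpha>))"
    using td[OF u] by simp
  also have "(\<chi> \<alpha>. tangent_map Q Q f (fst v) (w \<alpha>) d) = (\<chi> \<alpha>. lderiv c d f (fst v) ((\<chi> \<alpha>. w \<alpha> c) $ \<alpha>))"
    using td[OF w] by simp
  also have "fibre_D2 (local_lagr Q L d) (snd d (f (fst v)), \<chi> \<alpha>. lderiv c d f (fst v) ((\<chi> \<alpha>. snd v \<alpha> c) $ \<alpha>))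
      (\<chi> \<alpha>. lderiv c d f (fst v) ((\<chi> \<alpha>. u \<alpha> c) $ \<alpha>)) (\<chi> \<alpha>. lderiv c d f (fst v) ((\<chi> \<alpha>. w \<alpha> c) $ \<alpha>)) =
    fibre_D2 (local_lagr Q L c) (snd c (fst v), \<chi> \<alpha>. snd v \<alpha> c) (\<chi> \<alpha>. u \<alpha> c) (\<chi> \<alpha>. w \<alpha> c)"
    by (rule fibre_D2_natural[OF Q L f inv c d, symmetric])
  also have "\<dots> = g_total Q L v u w"
    using g_total_eq[OF Q L v u w c] by simp
  finally show ?thesis .
qed

section \<open>Vertical vectors of a quotient by a Lie group\<close>

text \<open>A linear right inverse splits the domain into the kernel and a copy of the target, and
  dimensions add.\<close>

lemma dim_kernel_surj:
  fixes f :: "'a::euclidean_space \<Rightarrow> 'b::euclidean_space"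
  assumes "linear f" "surj f"
  shows "dim {x. f x = 0} + DIM('b) = DIM('a)"
proof -
  obtain g where g: "linear g" "f \<circ> g = id"
    using linear_surjective_right_inverse[OF assms] by auto
  then have fg: "f (g y) = y" for y by (metis comp_apply id_apply)
  have "inj g" using fg by (metis injI)
  then have "dim (range g) = DIM('b)" using dim_image_eq[OF g(1), of UNIV] by (simp add: inj_on_subset)
  moreover have "{x + y |x y. x \<in> {x. f x = 0} \<and> y \<in> range g} = UNIV"
  proof -
    have "\<exists>x y. z = x + y \<and> x \<in> {x. f x = 0} \<and> y \<in> range g" for z
      by (rule exI[of _ "z - g (f z)"], rule exI[of _ "g (f z)"])
        (simp add: linear_diff[OF assms(1)] fg)
    then show ?thesis by blast
  qed
  moreover have "{x. f x = 0} \<inter> range g = {0}"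
    using fg linear_0[OF g(1)] linear_0[OF assms(1)] by auto
  moreover have "subspace {x. f x = 0}" "subspace (range g)"
    using assms(1) g(1) by (auto intro: linear_subspace_kernel linear_subspace_image)
  ultimately show ?thesis using dim_sums_Int[of "{x. f x = 0}" "range g"] by simp
qed

text \<open>Used twice, for the action on the configuration manifold and for its lift to the
  \<open>k\<close>-fold tangent bundle. The laws are asked only on the carrier, where the action has
  meaning.\<close>

locale lie_action = group G
  for G :: "('g, 'z) monoid_scheme" (structure) +
  fixes AG :: "('g, 'h::euclidean_space) atlas" and M :: "('a, 'e::euclidean_space) atlas"
    and \<Psi> :: "'g \<Rightarrow> 'a \<Rightarrow> 'a"
  assumes lie: "lie_group G AG"
    and M: "smooth_atlas M"
    and act_smooth: "smooth_map (prod_atlas AG M) M (\<lambda>z. \<Psi> (fst z) (snd z))"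
    and act_mult: "g \<in> carrier G \<Longrightarrow> h \<in> carrier G \<Longrightarrow> m \<in> mcarrier M \<Longrightarrow> \<Psi> (g \<otimes> h) m = \<Psi> g (\<Psi> h m)"
    and act_one: "m \<in> mcarrier M \<Longrightarrow> \<Psi> \<one> m = m"
begin

lemma AG: "smooth_atlas AG"
  using lie by (simp add: lie_group_def smooth_manifold_atlas)

lemma AG_carrier: "mcarrier AG = carrier G"
  using lie by (simp add: lie_group_def)

lemma mult_smooth: "smooth_map (prod_atlas AG AG) AG (\<lambda>z. fst z \<otimes> snd z)"
  using lie by (simp add: lie_group_def case_prod_beta')

lemma act_smooth_left: "g \<in> carrier G \<Longrightarrow> smooth_map M M (\<Psi> g)"
  using smooth_map_slice_left[OF AG M act_smooth, of g] by (simp add: AG_carrier)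

lemma act_smooth_right: "m \<in> mcarrier M \<Longrightarrow> smooth_map AG M (\<lambda>g. \<Psi> g m)"
  using smooth_map_slice_right[OF AG M act_smooth, of m] by simp

lemma orbit_act:
  assumes "g \<in> carrier G" "m \<in> mcarrier M"
  shows "orbit G \<Psi> (\<Psi> g m) = orbit G \<Psi> m"
proof -
  have "\<exists>k\<in>carrier G. \<Psi> h (\<Psi> g m) = \<Psi> k m" if "h \<in> carrier G" for h
    using that assms act_mult[of h g m] by (intro bexI[of _ "h \<otimes> g"]) auto
  moreover have "\<exists>k\<in>carrier G. \<Psi> h m = \<Psi> k (\<Psi> g m)" if "h \<in> carrier G" for h
    using that assms act_mult[of "h \<otimes> inv g" g m] by (intro bexI[of _ "h \<otimes> inv g"]) (auto simp: m_assoc)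
  ultimately show ?thesis unfolding orbit_def by blast
qed

lemma orbit_eqD:
  assumes "x \<in> mcarrier M" "orbit G \<Psi> x = orbit G \<Psi> y"
  obtains g where "g \<in> carrier G" "x = \<Psi> g y"
proof -
  have "x \<in> orbit G \<Psi> x" unfolding orbit_def using act_one[OF assms(1)] by force
  then show ?thesis using that unfolding assms(2) by (auto simp: orbit_def)
qed

lemma fundamental_in:
  assumes "\<xi> \<in> lie_algebra G AG" "m \<in> mcarrier M"
  shows "fundamental G AG M \<Psi> \<xi> m \<in> tangent_space M m"
  using tangent_map_in[OF AG M act_smooth_right[OF assms(2)] assms(1)] assms(2)
  by (simp add: fundamental_def act_one AG_carrier)

text \<open>The action of \<open>g\<close> sends the fundamental field of \<open>Ad (inv g) \<xi>\<close> to that of \<open>\<xi>\<close>, since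
  \<open>h g m = g (inv g h g) m\<close>.\<close>

lemma fundamental_act:
  assumes g: "g \<in> carrier G" and m: "m \<in> mcarrier M" and \<xi>: "\<xi> \<in> lie_algebra G AG"
  obtains \<eta> where "\<eta> \<in> lie_algebra G AG"
    "fundamental G AG M \<Psi> \<xi> (\<Psi> g m) = tangent_map M M (\<Psi> g) m (fundamental G AG M \<Psi> \<eta> m)"
proof -
  let ?k = "\<lambda>h. inv g \<otimes> h \<otimes> g"
  have one: "\<one> \<in> mcarrier AG" by (simp add: AG_carrier)
  have k: "smooth_map AG AG ?k"
    using smooth_map_comp[OF AG AG smooth_map_slice_left[OF AG AG mult_smooth, of "inv g"]
        smooth_map_slice_right[OF AG AG mult_smooth, of g]] g by (simp add: AG_carrier)
  have k1: "?k \<one> = \<one>" using g by simp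
  define \<eta> where "\<eta> = tangent_map AG AG ?k \<one> \<xi>"
  have \<eta>: "\<eta> \<in> lie_algebra G AG"
    using tangent_map_in[OF AG AG k \<xi> one] unfolding \<eta>_def k1 .
  let ?o = "\<lambda>h. \<Psi> h m"
  have o: "smooth_map AG M ?o" by (rule act_smooth_right[OF m])
  have ok: "smooth_map AG M (\<lambda>h. ?o (?k h))" by (rule smooth_map_comp[OF AG AG k o])
  note gs = act_smooth_left[OF g]
  have gok: "smooth_map AG M (\<lambda>h. \<Psi> g (?o (?k h)))" by (rule smooth_map_comp[OF AG M ok gs])
  have "fundamental G AG M \<Psi> \<xi> (\<Psi> g m) = tangent_map AG M (\<lambda>h. \<Psi> g (?o (?k h))) \<one> \<xi>"
    unfolding fundamental_def
  proof (rule tangent_map_cong[OF AG one])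
    fix h assume "h \<in> mcarrier AG"
    then have h: "h \<in> carrier G" by (simp add: AG_carrier)
    have "\<Psi> h (\<Psi> g m) = \<Psi> (h \<otimes> g) m" using act_mult[OF h g m] by simp
    also have "h \<otimes> g = g \<otimes> ?k h" using g h by (simp add: m_assoc[symmetric])
    also have "\<Psi> (g \<otimes> ?k h) m = \<Psi> g (\<Psi> (?k h) m)" using act_mult[OF g _ m, of "?k h"] g h by simp
    finally show "\<Psi> h (\<Psi> g m) = \<Psi> g (?o (?k h))" .
  qed
  also have "\<dots> = tangent_map M M (\<Psi> g) (?o (?k \<one>)) (tangent_map AG M (\<lambda>h. ?o (?k h)) \<one> \<xi>)"
    by (rule tangent_map_comp[OF AG M ok gs one \<xi> gok, symmetric])
  also have "tangent_map AG M (\<lambda>h. ?o (?k h)) \<one> \<xi> = tangent_map AG M ?o (?k \<one>) (tangent_map AG AG ?k \<one> \<xi>)"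
    by (rule tangent_map_comp[OF AG AG k o one \<xi> ok, symmetric])
  also have "\<dots> = fundamental G AG M \<Psi> \<eta> m" unfolding k1 \<eta>_def fundamental_def ..
  also have "?o (?k \<one>) = m" unfolding k1 by (rule act_one[OF m])
  finally show ?thesis by (rule that[OF \<eta>])
qed

text \<open>Second countability of the group enters through the Lindelof property; it keeps a later
  union of null sets countable.\<close>

lemma countable_chart_cover:
  obtains C where "countable C" "C \<subseteq> AG" "mcarrier C = carrier G"
proof -
  have "Lindelof_space (mtopology AG)"
    using lie by (intro second_countable_imp_Lindelof_space) (simp add: lie_group_def smooth_manifold_def)
  moreover have "openin (mtopology AG) U" if "U \<in> fst ` AG" for U
    using that openin_chart_domain[OF AG] by auto
  moreover have "\<Union> (fst ` AG) = topspace (mtopology AG)"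
    unfolding topspace_mtopology[OF AG] mcarrier_def ..
  ultimately have "\<exists>V. countable V \<and> V \<subseteq> fst ` AG \<and> \<Union>V = topspace (mtopology AG)"
    by (rule Lindelof_spaceD)
  then obtain V where V: "countable V" "V \<subseteq> fst ` AG" "\<Union>V = topspace (mtopology AG)"
    by auto
  then obtain C where "countable C" "C \<subseteq> AG" "V = fst ` C"
    using countable_subset_image[of V fst AG] by blast
  then show ?thesis
    using that[of C] V(3) topspace_mtopology[OF AG] AG_carrier by (simp add: mcarrier_def)
qed

section \<open>Vertical spaces over a quotient manifold and their dimension\<close>

context
  fixes P :: "('a set, 'p::euclidean_space) atlas"
  assumes P: "quotient_manifold G M \<Psi> P"
begin

lemma P_atlas: "smooth_atlas P"
  using P by (simp add: quotient_manifold_def smooth_manifold_atlas)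

lemma orbit_smooth: "smooth_map M P (orbit G \<Psi>)"
  using P by (simp add: quotient_manifold_def)

text \<open>The orbit map of \<open>m\<close> followed by the projection to orbits is constant, so
  its derivative at the unit vanishes.\<close>

lemma fundamental_vertical:
  assumes "\<xi> \<in> lie_algebra G AG" "m \<in> mcarrier M"
  shows "fundamental G AG M \<Psi> \<xi> m \<in> vertical_space M P (orbit G \<Psi>) m"
proof -
  let ?\<pi> = "orbit G \<Psi>"
  note o = act_smooth_right[OF assms(2)]
  have one: "\<one> \<in> mcarrier AG" by (simp add: AG_carrier)
  note c = smooth_map_comp[OF AG M o orbit_smooth]
  have "tangent_map M P ?\<pi> m (fundamental G AG M \<Psi> \<xi> m) = tangent_map AG P (\<lambda>g. ?\<pi> (\<Psi> g m)) \<one> \<xi>"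
    using tangent_map_comp[OF AG M o orbit_smooth one assms(1) c]
    by (simp add: fundamental_def act_one[OF assms(2)])
  also have "\<dots> = tangent_map AG P (\<lambda>g. ?\<pi> m) \<one> \<xi>"
    by (rule tangent_map_cong[OF AG one]) (simp add: orbit_act assms AG_carrier)
  also have "\<dots> = (\<lambda>_. 0)"
  proof
    fix d :: "('a set, 'p) chart"
    have "frechet_derivative (snd d \<circ> (\<lambda>g. ?\<pi> m) \<circ> chart_inv c) (at x) v = 0"
      for c :: "('g, 'h) chart" and x v
    proof -
      have "snd d \<circ> (\<lambda>g. ?\<pi> m) \<circ> chart_inv c = (\<lambda>_. snd d (?\<pi> m))" by auto
      then show ?thesis by (simp only: frechet_derivative_const)
    qed
    then show "tangent_map AG P (\<lambda>g. ?\<pi> m) \<one> \<xi> d = 0" by (simp add: tangent_map_def)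
  qed
  finally show ?thesis using fundamental_in[OF assms] by (simp add: vertical_space_def)
qed

text \<open>The projection to orbits is unchanged by composition with \<open>\<Psi> g\<close>; the
  chain rule transfers this to tangent vectors.\<close>

lemma vertical_act:
  assumes "g \<in> carrier G" "m \<in> mcarrier M" "v \<in> vertical_space M P (orbit G \<Psi>) m"
  shows "tangent_map M M (\<Psi> g) m v \<in> vertical_space M P (orbit G \<Psi>) (\<Psi> g m)"
proof -
  have v: "v \<in> tangent_space M m" "tangent_map M P (orbit G \<Psi>) m v = (\<lambda>_. 0)"
    using assms(3) by (simp_all add: vertical_space_def)
  note gs = act_smooth_left[OF assms(1)]
  note c = smooth_map_comp[OF M M gs orbit_smooth]
  have "tangent_map M P (orbit G \<Psi>) (\<Psi> g m) (tangent_map M M (\<Psi> g) m v) =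
      tangent_map M P (\<lambda>x. orbit G \<Psi> (\<Psi> g x)) m v"
    by (rule tangent_map_comp[OF M M gs orbit_smooth assms(2) v(1) c])
  also have "\<dots> = tangent_map M P (orbit G \<Psi>) m v"
    by (rule tangent_map_cong[OF M assms(2)]) (rule orbit_act[OF assms(1)])
  finally show ?thesis
    using v(2) tangent_map_in[OF M M gs v(1) assms(2)] by (simp add: vertical_space_def)
qed

text \<open>Through each orbit near \<open>m\<close> passes a point of a slice of dimension \<open>DIM('p)\<close>, so a neighbourhood of
  \<open>m\<close> is covered by countably many smooth images of open sets of dimension \<open>DIM('h) + DIM('p)\<close>.\<close>

lemma dim_le_group_quotient:
  assumes m: "m \<in> mcarrier M" and c: "c \<in> M" "m \<in> fst c" and d: "d \<in> P" "orbit G \<Psi> m \<in> fst d"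
    and surj: "surj (lderiv c d (orbit G \<Psi>) m)"
  shows "DIM('e) \<le> DIM('h) + DIM('p)"
proof (rule ccontr)
  assume "\<not> ?thesis"
  then have less: "DIM('h \<times> 'p) < DIM('e)" by simp
  let ?\<pi> = "orbit G \<Psi>"
  let ?D = "lderiv c d ?\<pi> m"
  let ?f = "lrep c d ?\<pi>"
  define O' where "O' = ldom c d ?\<pi>"
  have O': "open O'" and sm: "smooth_on O' ?f"
    using smooth_mapD[OF orbit_smooth c(1) d(1)] by (simp_all add: O'_def)
  have x0: "snd c m \<in> O'" using c d by (auto simp: O'_def)
  have Dl: "linear ?D" by (rule lderiv_linear[OF orbit_smooth c(1) d(1) c(2) d(2)])
  \<comment> \<open>A linear right inverse of the derivative defines an affine slice of dimension
    \<open>DIM('p)\<close> through \<open>snd c m\<close>, complementary to the kernel.\<close>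
  obtain k where k: "linear k" "?D \<circ> k = id"
    using linear_surjective_right_inverse[OF Dl surj] by auto
  have kb: "bounded_linear k" using k(1) by (simp add: linear_conv_bounded_linear)
  define \<sigma> where "\<sigma> s = snd c m + k s" for s
  have \<sigma>0: "\<sigma> 0 = snd c m" using linear_0[OF k(1)] by (simp add: \<sigma>_def)
  have \<sigma>s: "smooth_on S \<sigma>" if "open S" for S
    unfolding \<sigma>_def[abs_def]
    by (intro smooth_on_add smooth_on_const smooth_on_bounded_linear[OF kb] smooth_on_ident that)
  define S where "S = {s. \<sigma> s \<in> O'}"
  have S: "open S" using open_preimage_on[OF \<sigma>s[OF open_UNIV] open_UNIV O'] by (simp add: S_def)
  have S0: "0 \<in> S" using x0 \<sigma>0 by (simp add: S_def)
  define h where "h s = ?f (\<sigma> s)" for s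
  have hs: "smooth_on S h"
    unfolding h_def[abs_def] by (rule smooth_on_compose[OF sm \<sigma>s[OF S] S O']) (auto simp: S_def)
  have \<sigma>d: "(\<sigma> has_derivative k) (at 0)"
    using has_derivative_add[OF has_derivative_const bounded_linear_imp_has_derivative[OF kb]]
    by (simp add: \<sigma>_def[abs_def])
  have "(?f has_derivative ?D) (at (\<sigma> 0))"
    unfolding \<sigma>0 by (rule lrep_has_derivative[OF orbit_smooth c(1) d(1) c(2) d(2)])
  from has_derivative_compose[OF \<sigma>d this] have "(h has_derivative (\<lambda>s. ?D (k s))) (at 0)"
    unfolding h_def[abs_def] .
  moreover have "(\<lambda>s. ?D (k s)) \<circ> id = id" using k(2) by (simp add: fun_eq_iff)
  \<comment> \<open>\<open>h\<close> expresses the slice in orbit coordinates and has the identity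
    as derivative at 0, so its values fill a neighbourhood of \<open>h 0\<close>: every orbit close
    enough to that of \<open>m\<close> meets the slice.\<close>
  ultimately have h0: "h 0 \<in> interior (h ` S)"
    using sussmann_open_mapping[OF S smooth_on_continuous_on[OF hs] S0, of _ id S]
    by (simp add: interior_open[OF S] S0 bounded_linear_ident id_def)
  \<comment> \<open>An open coordinate neighbourhood of \<open>m\<close>, hence not null, all of
    whose points lie on orbits that meet the slice.\<close>
  define N where "N = {x \<in> O'. ?f x \<in> interior (h ` S)}"
  have N: "open N" unfolding N_def by (rule open_preimage_on[OF sm O' open_interior])
  have "snd c m \<in> N" using x0 h0 \<sigma>0 by (simp add: N_def h_def)
  then have notneg: "\<not> negligible N" using open_not_negligible[OF N] by auto
  obtain C where C: "countable C" "C \<subseteq> AG" "mcarrier C = carrier G" by (rule countable_chart_cover)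
  let ?A = "\<lambda>z. \<Psi> (fst z) (snd z)"
  let ?E = "\<lambda>a :: ('g, 'h) chart. (fst a \<times> fst c, map_prod (snd a) (snd c))"
  let ?j = "\<lambda>z :: 'h \<times> 'p. (fst z, \<sigma> (snd z))"
  define Z where "Z a = {z. ?j z \<in> ldom (?E a) c ?A}" for a
  \<comment> \<open>\<open>F a (x, s)\<close> is the coordinate of \<open>g\<close> acting on the
    slice point \<open>\<sigma> s\<close>, where \<open>g\<close> has coordinates \<open>x\<close>
    in the chart \<open>a\<close>. The domain lies in \<open>'h \<times> 'p\<close>, of smaller
    dimension than \<open>'e\<close> by the contrary assumption.\<close>
  define F where "F a z = lrep (?E a) c ?A (?j z)" for a z
  have "smooth_on UNIV (\<lambda>z::'h \<times> 'p. \<sigma> (snd z))"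
    by (rule smooth_on_compose[OF \<sigma>s[OF open_UNIV] smooth_on_snd[OF open_UNIV smooth_on_ident[OF open_UNIV]]]) auto
  then have j: "smooth_on UNIV ?j"
    by (intro smooth_on_Pair smooth_on_fst smooth_on_ident open_UNIV)
  have neg: "negligible (F a ` Z a)" if a: "a \<in> C" for a
  proof -
    have "a \<in> AG" using C a by auto
    note A = smooth_mapD[OF act_smooth prod_atlasI[OF this c(1)] c(1)]
    have Z: "open (Z a)" using open_preimage_on[OF j open_UNIV A(1)] by (simp add: Z_def)
    have jZ: "?j ` Z a \<subseteq> ldom (?E a) c ?A"
      by (intro image_subsetI) (simp only: Z_def mem_Collect_eq)
    have "smooth_on (Z a) (F a)"
      unfolding F_def[abs_def]
      by (rule smooth_on_compose[OF A(2) smooth_on_mono[OF j subset_UNIV] Z A(1) jZ])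
    then have "F a differentiable_on Z a"
      by (auto simp: differentiable_on_def intro: differentiable_at_withinI smooth_on_differentiable)
    then show ?thesis by (rule negligible_differentiable_image_lowdim[OF less])
  qed
  have "N \<subseteq> \<Union> ((\<lambda>a. F a ` Z a) ` C)"
  proof
    fix x assume "x \<in> N"
    then have x: "x \<in> O'" "?f x \<in> h ` S"
      using subsetD[OF interior_subset, of "?f x" "h ` S"] by (simp_all add: N_def)
    from x(1) obtain q where q: "q \<in> fst c" "?\<pi> q \<in> fst d" "x = snd c q" by (auto simp: O'_def)
    from x(2) obtain s where s: "s \<in> S" "?f x = h s" by auto
    then obtain r where r: "r \<in> fst c" "?\<pi> r \<in> fst d" "\<sigma> s = snd c r" by (auto simp: S_def O'_def)
    \<comment> \<open>Equal orbit coordinates mean equal orbits, so some group element carries the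
      slice point \<open>r\<close> to \<open>q\<close>; this exhibits \<open>x\<close> as a value of
      \<open>F\<close>.\<close>
    have "snd d (?\<pi> q) = snd d (?\<pi> r)" using s(2) q r M c(1) by (simp add: h_def)
    then have "?\<pi> q = ?\<pi> r" by (rule chart_eqD[OF P_atlas d(1) q(2) r(2)])
    then obtain g where g: "g \<in> carrier G" "q = \<Psi> g r"
      by (rule orbit_eqD[OF mcarrierI[OF c(1) q(1)]])
    obtain a where a: "a \<in> C" "g \<in> fst a" using g(1) unfolding C(3)[symmetric] by (rule mcarrierE)
    have a': "a \<in> AG" using a C by auto
    have gr: "(g, r) \<in> fst (?E a)" using a r by simp
    have jz: "?j (snd a g, s) = snd (?E a) (g, r)" using r by simp
    have "(snd a g, s) \<in> Z a"
      unfolding Z_def mem_Collect_eq jz using gr q g by (intro imageI) simp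
    moreover have "F a (snd a g, s) = x"
      unfolding F_def jz lrep_apply chart_inv_atlas[OF smooth_atlas_prod[OF AG M] prod_atlasI[OF a' c(1)] gr]
      using q g by simp
    ultimately show "x \<in> \<Union> ((\<lambda>a. F a ` Z a) ` C)" using a(1) by blast
  qed
  moreover have "negligible (\<Union> ((\<lambda>a. F a ` Z a) ` C))"
    using C(1) neg by (intro negligible_countable_Union) auto
  ultimately show False using notneg negligible_subset by blast
qed

text \<open>Vertical coordinates lie in the kernel of a surjective linear map onto
  \<open>'p\<close>. Rank-nullity and the preceding inequality bound that kernel.\<close>

lemma dim_vertical_le:
  assumes m: "m \<in> mcarrier M" and c: "c \<in> M" "m \<in> fst c"
  shows "dim ((\<lambda>v. v c) ` vertical_space M P (orbit G \<Psi>) m) \<le> DIM('h)"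
proof -
  let ?\<pi> = "orbit G \<Psi>"
  have \<pi>m: "?\<pi> m \<in> mcarrier P" by (rule smooth_map_carrier[OF orbit_smooth m])
  then obtain d where d: "d \<in> P" "?\<pi> m \<in> fst d" by (rule mcarrierE)
  let ?D = "lderiv c d ?\<pi> m"
  have Dl: "linear ?D" by (rule lderiv_linear[OF orbit_smooth c(1) d(1) c(2) d(2)])
  have Dv: "tangent_map M P ?\<pi> m v d = ?D (v c)" if "v \<in> tangent_space M m" for v
    by (rule tangent_map_at[OF M orbit_smooth that c d])
  \<comment> \<open>The submersion clause of \<open>quotient_manifold\<close> concerns abstract
    tangent vectors; \<open>tvec\<close> turns it into surjectivity in coordinates.\<close>
  have surj: "surj ?D"
    unfolding surj_def
  proof
    fix y
    have "tvec P (?\<pi> m) d y \<in> tangent_map M P ?\<pi> m ` tangent_space M m"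
      using P m tvec_in[OF P_atlas d, of y] by (simp add: quotient_manifold_def)
    then obtain v where "v \<in> tangent_space M m" "tangent_map M P ?\<pi> m v = tvec P (?\<pi> m) d y" by auto
    then have "?D (v c) = y" using Dv tvec_at[OF P_atlas d] by metis
    then show "\<exists>x. y = ?D x" by metis
  qed
  have "(\<lambda>v. v c) ` vertical_space M P ?\<pi> m \<subseteq> {x. ?D x = 0}"
    by (auto simp: vertical_space_def Dv[symmetric])
  then have "dim ((\<lambda>v. v c) ` vertical_space M P ?\<pi> m) \<le> dim {x. ?D x = 0}" by (rule dim_subset)
  also have "\<dots> \<le> DIM('h)"
    using dim_kernel_surj[OF Dl surj] dim_le_group_quotient[OF m c d surj] by linarith
  finally show ?thesis .
qed

end

end

section \<open>Smooth frames of kernels\<close>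

text \<open>Independence is stated for indexed families, so the family must first be seen to be
  injective before cardinality can be compared with dimension.\<close>

lemma family_spans:
  fixes z :: "'i \<Rightarrow> 'e::euclidean_space"
  assumes I: "finite I" and V: "\<And>i. i \<in> I \<Longrightarrow> z i \<in> V" "dim V \<le> card I"
    and ind: "\<And>y. (\<Sum>i\<in>I. y i *\<^sub>R z i) = 0 \<Longrightarrow> \<forall>i\<in>I. y i = 0"
    and x: "x \<in> V"
  obtains y where "x = (\<Sum>i\<in>I. y i *\<^sub>R z i)"
proof -
  have inj: "inj_on z I"
  proof (rule inj_onI, rule ccontr)
    fix i j assume ij: "i \<in> I" "j \<in> I" "z i = z j" "i \<noteq> j"
    \<comment> \<open>A repeated vector would give the nontrivial relation with coefficients 1 and
      -1.\<close>
    let ?y = "\<lambda>k. if k = i then 1 else if k = j then -1 else (0::real)"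
    have "(\<Sum>k\<in>I. ?y k *\<^sub>R z k) = (\<Sum>k\<in>{i, j}. ?y k *\<^sub>R z k)"
      using ij I by (intro sum.mono_neutral_right) auto
    also have "\<dots> = 0" using ij by simp
    finally have "?y i = 0" using ind[of ?y] ij(1) by blast
    then show False by simp
  qed
  have "independent (z ` I)"
  proof (rule independent_if_scalars_zero)
    show "finite (z ` I)" using I by simp
    fix f e assume "(\<Sum>x\<in>z ` I. f x *\<^sub>R x) = 0" "e \<in> z ` I"
    then show "f e = 0" using ind[of "\<lambda>i. f (z i)"] by (auto simp: sum.reindex[OF inj])
  qed
  then have "V \<subseteq> span (z ` I)"
    using V by (intro card_ge_dim_independent) (auto simp: card_image[OF inj])
  then have "x \<in> range (\<lambda>u. \<Sum>v\<in>z ` I. u v *\<^sub>R v)"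
    using x span_finite[of "z ` I"] I by auto
  then obtain u where "x = (\<Sum>v\<in>z ` I. u v *\<^sub>R v)" by auto
  then show ?thesis using that[of "\<lambda>i. u (z i)"] by (simp add: sum.reindex[OF inj])
qed

lemma smooth_on_det:
  fixes A :: "'a::euclidean_space \<Rightarrow> real ^ 'm::finite ^ 'm"
  assumes "open S" "\<And>i j. smooth_on S (\<lambda>z. A z $ i $ j)"
  shows "smooth_on S (\<lambda>z. det (A z))"
  unfolding det_def
  by (intro smooth_on_sum smooth_on_mult smooth_on_const smooth_on_prod assms)

text \<open>The solution as a quotient of determinants, a form in which smooth dependence on the
  data is visible wherever the determinant is nonzero.\<close>

definition cramer_solution :: "real ^ 'm ^ 'm \<Rightarrow> real ^ 'm \<Rightarrow> real ^ 'm::finite" where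
  "cramer_solution A b = (\<chi> k. det (\<chi> i j. if j = k then b $ i else A $ i $ j) / det A)"

lemma cramer_solution_iff:
  "det A \<noteq> 0 \<Longrightarrow> A *v x = b \<longleftrightarrow> x = cramer_solution A b"
  unfolding cramer_solution_def by (rule cramer)

lemma smooth_on_cramer_solution:
  fixes A :: "'a::euclidean_space \<Rightarrow> real ^ 'm::finite ^ 'm"
  assumes S: "open S" and A: "\<And>i j. smooth_on S (\<lambda>z. A z $ i $ j)"
    and b: "\<And>i. smooth_on S (\<lambda>z. b z $ i)" and det: "\<And>z. z \<in> S \<Longrightarrow> det (A z) \<noteq> 0"
  shows "smooth_on S (\<lambda>z. cramer_solution (A z) (b z) $ k)"
proof -
  have "smooth_on S (\<lambda>z. (\<chi> i j. if j = k then b z $ i else A z $ i $ j) $ i $ j)" for i j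
    using A b by (cases "j = k") simp_all
  then have "smooth_on S (\<lambda>z. det (\<chi> i j. if j = k then b z $ i else A z $ i $ j))"
    by (rule smooth_on_det[OF S])
  from smooth_on_mult[OF S this smooth_on_inverse[OF S smooth_on_det[OF S A] det]]
  show ?thesis by (simp add: cramer_solution_def divide_inverse)
qed

text \<open>Test the relation against \<open>b j\<close> for an index \<open>j\<close> of largest
  coefficient: then \<open>\<bar>c j\<bar>\<close> is at most \<open>r\<close> terms of size
  \<open>\<bar>c j\<bar> / (r + 1)\<close>, and the factor \<open>r / (r + 1)\<close> is below 1.
  The summand 1 also keeps the bound meaningful for \<open>r = 0\<close>.\<close>

lemma orthonormal_perturbation_independent:
  fixes b s :: "nat \<Rightarrow> 'x::euclidean_space"
  assumes on: "\<And>i j. i < r \<Longrightarrow> j < r \<Longrightarrow> b i \<bullet> b j = (if i = j then 1 else 0)"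
    and near: "\<And>i. i < r \<Longrightarrow> norm (s i - b i) < 1 / (real r + 1)"
    and zero: "(\<Sum>i<r. c i *\<^sub>R s i) = 0"
  shows "\<forall>i<r. c i = 0"
proof (cases "r = 0")
  case False
  have "\<exists>j\<in>{..<r}. \<forall>i\<in>{..<r}. \<bar>c i\<bar> \<le> \<bar>c j\<bar>"
  proof -
    have *: "finite ((\<lambda>i. \<bar>c i\<bar>) ` {..<r})" "(\<lambda>i. \<bar>c i\<bar>) ` {..<r} \<noteq> {}" using False by auto
    from Max_in[OF *] obtain j where "j < r" "Max ((\<lambda>i. \<bar>c i\<bar>) ` {..<r}) = \<bar>c j\<bar>" by auto
    then show ?thesis using Max_ge[OF *(1)] by (intro bexI[of _ j]) auto
  qed
  then obtain j where j: "j < r" and max: "\<And>i. i < r \<Longrightarrow> \<bar>c i\<bar> \<le> \<bar>c j\<bar>" by auto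
  have "(\<Sum>i<r. c i * (b i \<bullet> b j)) = (\<Sum>i<r. if i = j then c j else 0)"
    by (rule sum.cong) (auto simp: on j)
  then have "c j = (\<Sum>i<r. c i * (b i \<bullet> b j))" using j by simp
  also have "\<dots> = (\<Sum>i<r. c i *\<^sub>R b i) \<bullet> b j"
    by (simp add: inner_sum_left)
  also have "(\<Sum>i<r. c i *\<^sub>R b i) = (\<Sum>i<r. c i *\<^sub>R (b i - s i))"
    using zero by (simp add: scaleR_diff_right sum_subtractf)
  finally have "\<bar>c j\<bar> \<le> norm (\<Sum>i<r. c i *\<^sub>R (b i - s i)) * norm (b j)"
    by (metis Cauchy_Schwarz_ineq2)
  also have "norm (b j) = 1" using on[OF j j] by (simp add: norm_eq_sqrt_inner)
  also have "norm (\<Sum>i<r. c i *\<^sub>R (b i - s i)) \<le> (\<Sum>i<r. \<bar>c j\<bar> * (1 / (real r + 1)))"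
  proof (rule sum_norm_le)
    fix i assume "i \<in> {..<r}"
    then have "\<bar>c i\<bar> \<le> \<bar>c j\<bar>" "norm (b i - s i) \<le> 1 / (real r + 1)"
      using max near[of i] by (auto simp: norm_minus_commute intro: less_imp_le)
    then show "norm (c i *\<^sub>R (b i - s i)) \<le> \<bar>c j\<bar> * (1 / (real r + 1))"
      by (simp only: norm_scaleR) (rule mult_mono, simp_all)
  qed
  also have "(\<Sum>i<r. \<bar>c j\<bar> * (1 / (real r + 1))) = \<bar>c j\<bar> * (real r / (real r + 1))"
    by simp
  finally have "\<bar>c j\<bar> * (1 - real r / (real r + 1)) \<le> 0" by (simp add: algebra_simps)
  moreover have "1 - real r / (real r + 1) > 0" by (simp add: field_simps)
  ultimately have "c j = 0" by (simp add: mult_le_0_iff)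
  then show ?thesis using max by fastforce
qed simp

text \<open>Projecting a basis of one kernel to the neighbouring ones along the span of the \<open>\<rho> i\<close> gives a frame;
  all kernels have the same dimension because the functionals are independent.\<close>

lemma smooth_kernel_frame:
  fixes a :: "'m::finite \<Rightarrow> 'a::euclidean_space \<Rightarrow> 'x::euclidean_space \<Rightarrow> real" and \<rho> :: "'m \<Rightarrow> 'a \<Rightarrow> 'x"
  assumes S: "open S" "z0 \<in> S"
    and lin: "\<And>j z. z \<in> S \<Longrightarrow> linear (a j z)"
    and a: "\<And>j x. smooth_on S (\<lambda>z. a j z x)" and \<rho>: "\<And>i. smooth_on S (\<rho> i)"
    and inv: "\<And>z. z \<in> S \<Longrightarrow> invertible ((\<chi> i j. a j z (\<rho> i z)) :: real ^ 'm ^ 'm)"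
  obtains U r s where "open U" "z0 \<in> U" "U \<subseteq> S" "\<forall>i<r::nat. smooth_on U (s i)"
    "\<forall>z\<in>U. {x. \<forall>j. a j z x = 0} = range (\<lambda>c. \<Sum>i<r. (c i :: real) *\<^sub>R s i z)"
    "\<forall>z\<in>U. \<forall>c. (\<Sum>i<r. (c i :: real) *\<^sub>R s i z) = 0 \<longrightarrow> (\<forall>i<r. c i = 0)"
proof -
  \<comment> \<open>The transpose of the matrix in the hypothesis, so that it acts on coefficient
    vectors of combinations of the \<open>\<rho> i\<close>.\<close>
  define A :: "'a \<Rightarrow> real ^ 'm ^ 'm" where "A z = (\<chi> j i. a j z (\<rho> i z))" for z
  have detA: "det (A z) \<noteq> 0" if "z \<in> S" for z
  proof -
    have "transpose (A z) = (\<chi> i j. a j z (\<rho> i z))" by (simp add: A_def transpose_def)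
    then show ?thesis using inv[OF that] by (metis invertible_det_nz det_transpose)
  qed
  \<comment> \<open>Smoothness of \<open>a\<close> is assumed only for fixed arguments, so the
    moving argument \<open>\<rho> i z\<close> is expanded over \<open>Basis\<close>.\<close>
  have a\<rho>: "smooth_on S (\<lambda>z. a j z (\<rho> i z))" for i j
  proof -
    have "smooth_on S (\<lambda>z. \<Sum>e\<in>Basis. (\<rho> i z \<bullet> e) *\<^sub>R a j z e)"
      by (intro smooth_on_sum smooth_on_scaleR S(1) a smooth_on_bounded_linear[OF bounded_linear_inner_left] \<rho>)
    then show ?thesis
      by (rule smooth_on_cong[OF _ S(1)]) (rule linear_expand_Basis[OF lin, symmetric])
  qed
  define K where "K z = {x. \<forall>j. a j z x = 0}" for z
  define f where "f z x = (\<chi> j. a j z x)" for z x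
  have f: "linear (f z)" if "z \<in> S" for z
    by (rule linearI) (simp_all add: f_def vec_eq_iff linear_add[OF lin[OF that]] linear_scale[OF lin[OF that]])
  define \<tau> where "\<tau> z y = (\<Sum>i\<in>UNIV. (y $ i) *\<^sub>R \<rho> i z)" for z and y :: "real ^ 'm"
  have f\<tau>: "f z (\<tau> z y) = A z *v y" if "z \<in> S" for z y
    by (simp add: f_def \<tau>_def A_def vec_eq_iff matrix_vector_mult_def linear_sum[OF lin[OF that]]
        linear_scale[OF lin[OF that]] mult.commute)
  have K: "K z = {x. f z x = 0}" for z by (simp add: K_def f_def vec_eq_iff)
  have Ksub: "subspace (K z)" if "z \<in> S" for z
    unfolding K by (rule linear_subspace_kernel[OF f[OF that]])
  have dimK: "dim (K z) + CARD('m) = DIM('x)" if z: "z \<in> S" for z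
  proof -
    have "\<exists>x. y = f z x" for y
      using cramer_solution_iff[OF detA[OF z], of _ y] f\<tau>[OF z] by metis
    then have "surj (f z)" by (auto simp: surj_def)
    from dim_kernel_surj[OF f[OF z] this] show ?thesis by (simp add: K)
  qed
  \<comment> \<open>Subtracts the unique combination of the \<open>\<rho> i\<close> on which the
    functionals take the same values as on \<open>x\<close>; this is the projection onto the kernel
    along their span.\<close>
  define p where "p z x = x - \<tau> z (cramer_solution (A z) (f z x))" for z x
  have pK: "p z x \<in> K z" if z: "z \<in> S" for z x
  proof -
    have "A z *v cramer_solution (A z) (f z x) = f z x" using cramer_solution_iff[OF detA[OF z]] by blast
    then show ?thesis unfolding K p_def by (simp add: linear_diff[OF f[OF z]] f\<tau>[OF z])
  qed
  have p_id: "p z x = x" if z: "z \<in> S" and x: "x \<in> K z" for z x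
  proof -
    have "A z *v 0 = f z x" using x by (simp add: K)
    then have "cramer_solution (A z) (f z x) = 0" using cramer_solution_iff[OF detA[OF z]] by metis
    then show ?thesis by (simp add: p_def \<tau>_def)
  qed
  have p_smooth: "smooth_on S (\<lambda>z. p z x)" for x
    unfolding p_def \<tau>_def
  proof (intro smooth_on_diff smooth_on_const smooth_on_sum smooth_on_scaleR \<rho> S(1))
    show "smooth_on S (\<lambda>z. cramer_solution (A z) (f z x) $ i)" for i
      by (rule smooth_on_cramer_solution[OF S(1) _ _ detA]) (simp_all add: A_def f_def a\<rho> a)
  qed
  define r where "r = dim (K z0)"
  obtain B where B: "B \<subseteq> K z0" "pairwise orthogonal B" "\<And>x. x \<in> B \<Longrightarrow> norm x = 1"
      "independent B" "card B = r"
    using orthonormal_basis_subspace[OF Ksub[OF S(2)]] unfolding r_def by metis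
  have "finite B" using B(4) by (rule independent_imp_finite)
  then obtain b where b: "bij_betw b {..<r} B"
    using ex_bij_betw_nat_finite[of B] B(5) by (metis atLeast0LessThan)
  have bB: "b i \<in> B" if "i < r" for i using b that by (auto simp: bij_betw_def)
  have b_on: "b i \<bullet> b j = (if i = j then 1 else 0)" if ij: "i < r" "j < r" for i j
  proof (cases "i = j")
    case True
    then show ?thesis using B(3)[OF bB[OF ij(1)]] by (simp add: norm_eq_1)
  next
    case False
    then have "b i \<noteq> b j" using b ij by (auto simp: bij_betw_def inj_on_def)
    then show ?thesis using B(2) bB ij False by (auto simp: pairwise_def orthogonal_def)
  qed
  define s where "s i z = p z (b i)" for i z
  have s_smooth: "smooth_on S (s i)" for i unfolding s_def[abs_def] by (rule p_smooth)
  have s0: "s i z0 = b i" if "i < r" for i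
    unfolding s_def by (rule p_id[OF S(2)]) (use bB[OF that] B(1) in auto)
  \<comment> \<open>The radius is the tolerance of
    \<open>orthonormal_perturbation_independent\<close>; at \<open>z0\<close> the projected vectors
    are the orthonormal basis itself, so \<open>z0\<close> belongs to \<open>U\<close>.\<close>
  define U where "U = S \<inter> (\<Inter>i<r. {z \<in> S. s i z \<in> ball (b i) (1 / (real r + 1))})"
  have U: "open U"
    unfolding U_def
    by (intro open_Int S(1) open_INT finite_lessThan ballI open_preimage_on[OF s_smooth S(1) open_ball])
  have near: "norm (s i z - b i) < 1 / (real r + 1)" if "z \<in> U" "i < r" for i z
    using that by (auto simp: U_def dist_norm norm_minus_commute)
  have ind: "\<forall>i<r. c i = 0" if "z \<in> U" "(\<Sum>i<r. c i *\<^sub>R s i z) = 0" for z c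
    by (rule orthonormal_perturbation_independent[OF b_on near[OF that(1)] that(2)])
  show ?thesis
  proof (rule that[of U r s])
    show "open U" by (rule U)
    show "z0 \<in> U" using S(2) by (auto simp: U_def s0)
    show US: "U \<subseteq> S" by (auto simp: U_def)
    show "\<forall>i<r. smooth_on U (s i)" by (intro allI impI smooth_on_mono[OF s_smooth US])
    show "\<forall>z\<in>U. \<forall>c. (\<Sum>i<r. c i *\<^sub>R s i z) = 0 \<longrightarrow> (\<forall>i<r. c i = 0)"
      using ind by blast
    show "\<forall>z\<in>U. {x. \<forall>j. a j z x = 0} = range (\<lambda>c. \<Sum>i<r. c i *\<^sub>R s i z)"
    proof
      fix z assume zU: "z \<in> U"
      then have z: "z \<in> S" using US by auto
      have sK: "s i z \<in> K z" for i unfolding s_def by (rule pK[OF z])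
      have "K z = range (\<lambda>c. \<Sum>i<r. c i *\<^sub>R s i z)"
      proof
        show "range (\<lambda>c. \<Sum>i<r. c i *\<^sub>R s i z) \<subseteq> K z"
          using Ksub[OF z] sK by (auto intro!: subspace_sum subspace_scale)
        show "K z \<subseteq> range (\<lambda>c. \<Sum>i<r. c i *\<^sub>R s i z)"
        proof
          fix x assume x: "x \<in> K z"
          \<comment> \<open>The dimension of the kernel is the same at \<open>z\<close> and
            \<open>z0\<close>, so \<open>r\<close> independent vectors in it must span it.\<close>
          have "dim (K z) \<le> card {..<r}" using dimK[OF z] dimK[OF S(2)] by (simp add: r_def)
          then obtain y where "x = (\<Sum>i<r. y i *\<^sub>R s i z)"
            using family_spans[of "{..<r}" "\<lambda>i. s i z" "K z" x] sK ind[OF zU] x by auto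
          then show "x \<in> range (\<lambda>c. \<Sum>i<r. c i *\<^sub>R s i z)" by auto
        qed
      qed
      then show "{x. \<forall>j. a j z x = 0} = range (\<lambda>c. \<Sum>i<r. c i *\<^sub>R s i z)" by (simp only: K_def)
    qed
  qed
qed

section \<open>Local sections of \<open>T\<^sup>1\<^sub>k\<close>\<close>

lemma smooth_atlas_sub:
  assumes A: "smooth_atlas A" and W: "openin (mtopology A) W"
  shows "smooth_atlas (sub_atlas A W)"
  unfolding smooth_atlas_def
proof (intro conjI ballI)
  fix C assume "C \<in> sub_atlas A W"
  then obtain c where c: "c \<in> A" "C = (fst c \<inter> W, snd c)" by (auto simp: sub_atlas_def)
  show inj: "inj_on (snd C) (fst C)"
    using smooth_atlas_inj[OF A c(1)] by (auto simp: c(2) inj_on_def)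
  fix D assume "D \<in> sub_atlas A W"
  then obtain d where d: "d \<in> A" "D = (fst d \<inter> W, snd d)" by (auto simp: sub_atlas_def)
  note t = smooth_mapD[OF smooth_map_ident[OF A] c(1) d(1)]
  have oW: "open (snd c ` (W \<inter> fst c))" using W c(1) by (simp add: openin_mtopology[OF A])
  have eq: "snd C ` (fst C \<inter> fst D) = snd c ` (W \<inter> fst c) \<inter> ldom c d (\<lambda>x. x)"
  proof
    show "snd c ` (W \<inter> fst c) \<inter> ldom c d (\<lambda>x. x) \<subseteq> snd C ` (fst C \<inter> fst D)"
    proof
      fix x assume "x \<in> snd c ` (W \<inter> fst c) \<inter> ldom c d (\<lambda>x. x)"
      then obtain p where p: "p \<in> W" "p \<in> fst c" "x = snd c p" "snd c p \<in> ldom c d (\<lambda>x. x)" by auto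
      then have "p \<in> fst d" using chart_image_iff[OF A c(1) p(2)] by simp
      then show "x \<in> snd C ` (fst C \<inter> fst D)" using p by (auto simp: c d)
    qed
  qed (auto simp: c d)
  show o: "open (snd C ` (fst C \<inter> fst D))" unfolding eq using oW t(1) by (rule open_Int)
  have "smooth_on (snd C ` (fst C \<inter> fst D)) (lrep c d (\<lambda>x. x))"
    by (rule smooth_on_mono[OF t(2)]) (auto simp: eq)
  then show "smooth_on (snd C ` (fst C \<inter> fst D)) (snd D \<circ> chart_inv C)"
  proof (rule smooth_on_cong[OF _ o])
    fix x assume "x \<in> snd C ` (fst C \<inter> fst D)"
    then obtain p where p: "p \<in> fst C" "x = snd C p" by auto
    have "chart_inv C x = p" using chart_inv_snd[OF inj p(1)] p(2) by simp
    moreover have "chart_inv c x = p" using chart_inv_atlas[OF A c(1), of p] p c by simp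
    ultimately show "lrep c d (\<lambda>x. x) x = (snd D \<circ> chart_inv C) x" by (simp add: d)
  qed
qed

text \<open>In the restricted chart and the natural chart over it, the section is the graph
  \<open>x \<mapsto> (x, \<sigma> x)\<close>.\<close>

lemma smooth_local_section:
  fixes A :: "('a, 'e::euclidean_space) atlas" and \<sigma> :: "'e \<Rightarrow> 'e ^ 'k::finite"
  assumes A: "smooth_atlas A" and c: "c \<in> A" and U: "open U" "U \<subseteq> snd c ` fst c" and \<sigma>: "smooth_on U \<sigma>"
  defines "W \<equiv> {p \<in> fst c. snd c p \<in> U}"
  shows "smooth_map (sub_atlas A W) (Tk A) (\<lambda>p. tk_point A c p (\<sigma> (snd c p)))"
proof (rule smooth_mapI)
  have W: "openin (mtopology A) W"
    unfolding W_def by (rule openin_chart_preimage[OF A c U(1)])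
  show sub: "smooth_atlas (sub_atlas A W)" by (rule smooth_atlas_sub[OF A W])
  show "smooth_atlas (Tk A :: (('k, 'a, 'e) ktangent, _) atlas)" by (rule smooth_atlas_Tk[OF A])
  let ?C = "(fst c \<inter> W, snd c)"
  have C: "?C \<in> sub_atlas A W" using c by (auto simp: sub_atlas_def)
  let ?s = "\<lambda>p. tk_point A c p (\<sigma> (snd c p))"
  fix p assume "p \<in> mcarrier (sub_atlas A W)"
  then have p: "p \<in> W" by (auto simp: mcarrier_def sub_atlas_def)
  then have pc: "p \<in> fst c" "snd c p \<in> U" by (auto simp: W_def)
  have dom: "?s q \<in> fst (Tk_chart A c)" if "q \<in> fst c" for q
    using tk_point_in[OF A c that] that by simp
  have key: "x \<in> ldom ?C (Tk_chart A c) ?s \<and> lrep ?C (Tk_chart A c) ?s x = (x, \<sigma> x)" if xU: "x \<in> U" for x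
  proof -
    obtain q where q: "q \<in> fst c" "x = snd c q" using xU U(2) by auto
    then have qC: "q \<in> fst ?C" using xU by (simp add: W_def)
    have "chart_inv ?C x = q" using chart_inv_atlas[OF sub C qC] q by simp
    then have "lrep ?C (Tk_chart A c) ?s x = (x, \<sigma> x)"
      using tk_point_coord[OF A c q(1), of "\<sigma> (snd c q)"] q by simp
    moreover have "x \<in> ldom ?C (Tk_chart A c) ?s"
      using q qC dom[OF q(1)] by auto
    ultimately show ?thesis by (rule conjI[rotated])
  qed
  have "smooth_on U (lrep ?C (Tk_chart A c) ?s)"
    by (rule smooth_on_cong[OF smooth_on_Pair[OF U(1) smooth_on_ident[OF U(1)] \<sigma>] U(1)])
      (rule key[THEN conjunct2, symmetric])
  moreover have "U \<subseteq> ldom ?C (Tk_chart A c) ?s" using key by blast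
  ultimately show "\<exists>c'\<in>sub_atlas A W. \<exists>d\<in>Tk A. \<exists>U. p \<in> fst c' \<and> ?s p \<in> fst d \<and> open U \<and> snd c' p \<in> U \<and>
      U \<subseteq> ldom c' d ?s \<and> smooth_on U (lrep c' d ?s)"
    using U(1) p pc dom[OF pc(1)]
    by (intro bexI[OF _ C] bexI[OF _ Tk_chart_in[OF c]] exI[of _ U]) simp
qed

section \<open>The mechanical connection\<close>

lemma lift_action_eq: "w \<in> Tk_set A \<Longrightarrow> lift_action A \<Phi> g w = Tk_map A A (\<Phi> g) w"
  by (simp add: lift_action_def)

lemma lie_action_base:
  assumes "lie_group G AG" "smooth_manifold Q" "smooth_action G AG Q \<Phi>"
  shows "lie_action G AG Q \<Phi>"
proof -
  interpret group G using assms(1) by (simp add: lie_group_def)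
  interpret act: group_action G "mcarrier Q" \<Phi> using assms(3) by (simp add: smooth_action_def)
  show ?thesis
  proof
    show "lie_group G AG" by fact
    show "smooth_atlas Q" by (rule smooth_manifold_atlas) fact
    show "smooth_map (prod_atlas AG Q) Q (\<lambda>z. \<Phi> (fst z) (snd z))"
      using assms(3) by (simp add: smooth_action_def case_prod_beta')
    show "\<Phi> (g \<otimes>\<^bsub>G\<^esub> h) m = \<Phi> g (\<Phi> h m)"
      if "g \<in> carrier G" "h \<in> carrier G" "m \<in> mcarrier Q" for g h m
      by (rule act.composition_rule[OF that(3,1,2)])
    show "\<Phi> \<one>\<^bsub>G\<^esub> m = m" if "m \<in> mcarrier Q" for m
      using fun_cong[OF act.id_eq_one, of m] that by simp
  qed
qed

context lie_action
begin

text \<open>The action laws are functoriality of the \<open>k\<close>-fold tangent map; joint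
  smoothness is the parametrised version \<open>smooth_map_Tk_family\<close>.\<close>

lemma lift_lie_action:
  "lie_action G AG (Tk M :: (('k::finite, 'a, 'e) ktangent, _) atlas) (lift_action M \<Psi>)"
proof
  show "lie_group G AG" by (rule lie)
  show "smooth_atlas (Tk M :: (('k, 'a, 'e) ktangent, _) atlas)" by (rule smooth_atlas_Tk[OF M])
  show "smooth_map (prod_atlas AG (Tk M :: (('k, 'a, 'e) ktangent, _) atlas)) (Tk M)
      (\<lambda>z. lift_action M \<Psi> (fst z) (snd z))"
  proof (rule smooth_map_cong[OF smooth_atlas_prod[OF AG smooth_atlas_Tk[OF M]]
        smooth_map_Tk_family[OF AG M M act_smooth]])
    fix z assume "z \<in> mcarrier (prod_atlas AG (Tk M :: (('k, 'a, 'e) ktangent, _) atlas))"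
    then have "snd z \<in> Tk_set M" by (auto simp: mcarrier_prod mcarrier_Tk)
    then show "Tk_map M M (\<lambda>p. \<Psi> (fst (fst z, p)) (snd (fst z, p))) (snd z) = lift_action M \<Psi> (fst z) (snd z)"
      by (simp add: lift_action_eq)
  qed
  fix g h and w :: "('k, 'a, 'e) ktangent"
  assume w: "w \<in> mcarrier (Tk M)"
  then have w': "w \<in> Tk_set M" by (simp add: mcarrier_Tk)
  show "lift_action M \<Psi> \<one> w = w"
    using Tk_map_cong[OF M w', of "\<Psi> \<one>" "\<lambda>x. x" M] Tk_map_ident[OF M w'] w'
    by (simp add: act_one lift_action_eq)
  assume g: "g \<in> carrier G" and h: "h \<in> carrier G"
  have "lift_action M \<Psi> (g \<otimes> h) w = Tk_map M M (\<lambda>x. \<Psi> g (\<Psi> h x)) w"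
    unfolding lift_action_eq[OF w'] by (rule Tk_map_cong[OF M w']) (rule act_mult[OF g h])
  also have "\<dots> = Tk_map M M (\<Psi> g) (Tk_map M M (\<Psi> h) w)"
    by (rule Tk_map_comp[OF M M act_smooth_left[OF h] act_smooth_left[OF g] w', symmetric])
  also have "\<dots> = lift_action M \<Psi> g (lift_action M \<Psi> h w)"
    by (simp add: lift_action_eq w' Tk_map_in[OF M M act_smooth_left[OF h] w'])
  finally show "lift_action M \<Psi> (g \<otimes> h) w = lift_action M \<Psi> g (lift_action M \<Psi> h w)" .
qed

text \<open>In product coordinates the field is the derivative of the action at the unit and
  \<open>x\<close> in the fixed direction \<open>(\<xi> a, 0)\<close>, so joint smoothness of the
  action gives smoothness in \<open>x\<close>.\<close>

lemma fundamental_coord_smooth: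
  assumes c: "c \<in> M" and \<xi>: "\<xi> \<in> lie_algebra G AG"
  shows "smooth_on (snd c ` fst c) (\<lambda>x. fundamental G AG M \<Psi> \<xi> (chart_inv c x) c)"
proof -
  have one: "\<one> \<in> mcarrier AG" by (simp add: AG_carrier)
  then obtain a where a: "a \<in> AG" "\<one> \<in> fst a" by (rule mcarrierE)
  let ?e = "(fst a \<times> fst c, map_prod (snd a) (snd c))"
  let ?A = "\<lambda>z. \<Psi> (fst z) (snd z)"
  note S = smooth_mapD[OF act_smooth prod_atlasI[OF a(1) c] c]
  let ?S = "snd c ` fst c"
  have o: "open ?S" by (rule chart_open[OF M c])
  have sub: "(\<lambda>x. (snd a \<one>, x)) ` ?S \<subseteq> ldom ?e c ?A"
  proof
    fix z assume "z \<in> (\<lambda>x. (snd a \<one>, x)) ` ?S"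
    then obtain p where p: "p \<in> fst c" "z = snd ?e (\<one>, p)" by auto
    moreover have "(\<one>, p) \<in> {z \<in> fst ?e. ?A z \<in> fst c}"
      using p a act_one[OF mcarrierI[OF c p(1)]] by simp
    ultimately show "z \<in> ldom ?e c ?A" by blast
  qed
  have "smooth_on ?S (\<lambda>x. frechet_derivative (lrep ?e c ?A) (at (snd a \<one>, x)) (\<xi> a, 0))"
    by (rule smooth_on_deriv[OF S(2,1) o smooth_on_Pair[OF o smooth_on_const[OF o] smooth_on_ident[OF o]]
        sub smooth_on_const[OF o]])
  then show ?thesis
  proof (rule smooth_on_cong[OF _ o])
    fix x assume "x \<in> ?S"
    then obtain p where p: "p \<in> fst c" "x = snd c p" by auto
    have pM: "p \<in> mcarrier M" by (rule mcarrierI[OF c p(1)])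
    have Ap: "\<Psi> \<one> p \<in> fst c" using act_one[OF pM] p by simp
    have P: "smooth_map AG (prod_atlas AG M) (\<lambda>g. (g, p))"
      by (rule smooth_map_Pair_right[OF AG M pM])
    have "fundamental G AG M \<Psi> \<xi> p c = lderiv a c (\<lambda>g. \<Psi> g p) \<one> (\<xi> a)"
      unfolding fundamental_def by (rule tangent_map_at[OF AG act_smooth_right[OF pM] \<xi> a c Ap])
    also have "\<dots> = lderiv ?e c ?A (\<one>, p) (lderiv a ?e (\<lambda>g. (g, p)) \<one> (\<xi> a))"
      using lderiv_comp[OF AG smooth_atlas_prod[OF AG M] P act_smooth a prod_atlasI[OF a(1) c] _ c, of "\<xi> a"]
        a p Ap by simp
    also have "lderiv a ?e (\<lambda>g. (g, p)) \<one> = (\<lambda>v. (v, 0))"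
    proof -
      have "(lrep a ?e (\<lambda>g. (g, p)) has_derivative (\<lambda>v. (v, 0))) (at (snd a \<one>))"
      proof (rule has_derivative_transform_within_open)
        show "((\<lambda>y. (y, snd c p)) has_derivative (\<lambda>v. (v, 0))) (at (snd a \<one>))"
          by (intro has_derivative_Pair has_derivative_const has_derivative_ident)
        show "open (snd a ` fst a)" by (rule chart_open[OF AG a(1)])
        show "snd a \<one> \<in> snd a ` fst a" using a by simp
        show "(y, snd c p) = lrep a ?e (\<lambda>g. (g, p)) y" if "y \<in> snd a ` fst a" for y
          using that AG a by auto
      qed
      from frechet_derivative_at[OF this] show ?thesis by (rule sym)
    qed
    finally have eq: "fundamental G AG M \<Psi> \<xi> p c = lderiv ?e c ?A (\<one>, p) (\<xi> a, 0)" .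
    show "frechet_derivative (lrep ?e c ?A) (at (snd a \<one>, x)) (\<xi> a, 0) =
        fundamental G AG M \<Psi> \<xi> (chart_inv c x) c"
      unfolding p(2) chart_inv_atlas[OF M c p(1)] eq by (simp only: snd_conv map_prod_simp)
  qed
qed

end

section \<open>Linear algebra of the Gram system\<close>

lemma transposed_system:
  fixes m :: "'m::finite \<Rightarrow> 'm \<Rightarrow> real"
  assumes "invertible ((\<chi> i j. m i j) :: real ^ 'm ^ 'm)"
  shows transposed_system_solvable: "\<exists>x. \<forall>j. (\<Sum>i\<in>UNIV. x i * m i j) = b j"
    and transposed_system_unique: "(\<And>j. (\<Sum>i\<in>UNIV. x i * m i j) = 0) \<Longrightarrow> x i = 0"
proof -
  \<comment> \<open>The unknowns carry the row index of \<open>m\<close>, so the coefficient matrix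
    is the transpose; its determinant is the same.\<close>
  define A :: "real ^ 'm ^ 'm" where "A = (\<chi> j i. m i j)"
  have "transpose A = (\<chi> i j. m i j)" by (simp add: A_def transpose_def)
  then have A: "det A \<noteq> 0" using assms by (metis invertible_det_nz det_transpose)
  have mult: "(A *v y) $ j = (\<Sum>i\<in>UNIV. y $ i * m i j)" for y j
    by (simp add: A_def matrix_vector_mult_def mult.commute)
  obtain y where "A *v y = (\<chi> j. b j)" using cramer_solution_iff[OF A] by blast
  then show "\<exists>x. \<forall>j. (\<Sum>i\<in>UNIV. x i * m i j) = b j"
    by (intro exI[of _ "\<lambda>i. y $ i"] allI) (simp only: mult[symmetric] vec_lambda_beta)
  assume "\<And>j. (\<Sum>i\<in>UNIV. x i * m i j) = 0"
  then have "A *v (\<chi> i. x i) = 0" by (simp add: vec_eq_iff mult)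
  then have "(\<chi> i. x i) = cramer_solution A 0" using cramer_solution_iff[OF A] by metis
  also have "\<dots> = 0" using cramer_solution_iff[OF A, of 0 0] by simp
  finally show "x i = 0" by (simp add: vec_eq_iff)
qed

text \<open>Merges \<open>k\<close> separate combinations into one sum over the pairs
  \<open>(\<alpha>, a)\<close> that index the Gram matrix.\<close>

lemma vec_expand_pairs:
  fixes e :: "'i::finite \<Rightarrow> 'b::real_vector"
  shows "(\<chi> \<alpha>::'k::finite. \<Sum>a\<in>UNIV. x (\<alpha>, a) *\<^sub>R e a) =
    (\<Sum>i\<in>UNIV. x i *\<^sub>R axis (fst i) (e (snd i)))"
proof -
  have "(\<Sum>i\<in>UNIV. x i *\<^sub>R axis (fst i) (e (snd i))) =
      (\<Sum>\<alpha>\<in>UNIV. \<Sum>a\<in>UNIV. x (\<alpha>, a) *\<^sub>R axis \<alpha> (e a))"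
    by (simp add: sum.cartesian_product UNIV_Times_UNIV[symmetric] case_prod_beta' del: UNIV_Times_UNIV)
  also have "\<dots> = (\<Sum>\<alpha>\<in>UNIV. axis \<alpha> (\<Sum>a\<in>UNIV. x (\<alpha>, a) *\<^sub>R e a))"
    by (simp only: linear_sum[OF linear_axis] linear_scale[OF linear_axis])
  finally show ?thesis by (simp only: sum_axis)
qed

text \<open>The model space of the group and the basis \<open>E\<close> share the index type
  \<open>'i\<close>, so the dimension of the group is the number of basis fundamental vectors; this
  count closes \<open>vertical_expand\<close>.\<close>

locale mechanical = lie_action G AG Q \<Phi>
  for G :: "('g, 'z) monoid_scheme" (structure) and AG :: "('g, real ^ 'i::finite) atlas"
    and Q :: "('q, real ^ 'n::finite) atlas" and \<Phi> :: "'g \<Rightarrow> 'q \<Rightarrow> 'q" +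
  fixes L :: "('k::finite, 'q, 'n) lagrangian" and E :: "'i \<Rightarrow> ('g, real ^ 'i) chart \<Rightarrow> real ^ 'i"
    and P :: "(('k, 'q, real ^ 'n) ktangent set, 'p::euclidean_space) atlas"
  assumes L: "smooth_map (Tk Q) euclidean_atlas L"
    and L_inv: "invariant_lagrangian G Q \<Phi> L"
    and E: "lie_algebra_basis G AG E" and reg: "G_regular G AG Q \<Phi> E L"
    and P: "quotient_manifold G (Tk Q :: (('k, 'q, real ^ 'n) ktangent, _) atlas) (lift_action Q \<Phi>) P"
begin

abbreviation TQ :: "(('k, 'q, real ^ 'n) ktangent, (real ^ 'n) \<times> ((real ^ 'n) ^ 'k)) atlas" where
  "TQ \<equiv> Tk Q"

abbreviation lift :: "'g \<Rightarrow> ('k, 'q, real ^ 'n) ktangent \<Rightarrow> ('k, 'q, real ^ 'n) ktangent" where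
  "lift \<equiv> lift_action Q \<Phi>"

abbreviation vert :: "('k, 'q, real ^ 'n) ktangent \<Rightarrow> _ set" where
  "vert \<equiv> vertical_space TQ P (orbit G lift)"

abbreviation hor where "hor \<equiv> mechanical_k_connection G AG Q \<Phi> L"

abbreviation field :: "(('g, real ^ 'i) chart \<Rightarrow> real ^ 'i) \<Rightarrow> 'q \<Rightarrow> _" where
  "field \<equiv> fundamental G AG Q \<Phi>"

sublocale lifted: lie_action G AG TQ lift
  by (rule lift_lie_action)

lemma TQ_carrier: "mcarrier TQ = Tk_set Q"
  by (rule mcarrier_Tk)

lemma E_in: "E a \<in> lie_algebra G AG"
  using E by (simp add: lie_algebra_basis_def)

lemma fst_lift: "v \<in> Tk_set Q \<Longrightarrow> fst (lift g v) = \<Phi> g (fst v)"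
  by (simp add: lift_action_eq)

text \<open>Differentiates at the unit the fact that the projection intertwines the lifted action
  with the action on \<open>Q\<close>.\<close>

lemma tau_fundamental:
  assumes "\<xi> \<in> lie_algebra G AG" "v \<in> Tk_set Q"
  shows "tangent_map TQ Q fst v (fundamental G AG TQ lift \<xi> v) = field \<xi> (fst v)"
proof -
  have v: "v \<in> mcarrier TQ" using assms(2) by (simp add: TQ_carrier)
  have one: "\<one> \<in> mcarrier AG" by (simp add: AG_carrier)
  note o = lifted.act_smooth_right[OF v] and t = smooth_map_Tk_fst[OF M]
  have "tangent_map TQ Q fst (lift \<one> v) (tangent_map AG TQ (\<lambda>g. lift g v) \<one> \<xi>) =
      tangent_map AG Q (\<lambda>g. fst (lift g v)) \<one> \<xi>"
    by (rule tangent_map_comp[OF AG lifted.M o t one assms(1) smooth_map_comp[OF AG lifted.M o t]])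
  also have "\<dots> = tangent_map AG Q (\<lambda>g. \<Phi> g (fst v)) \<one> \<xi>"
    by (rule tangent_map_cong[OF AG one]) (rule fst_lift[OF assms(2)])
  finally show ?thesis by (simp add: fundamental_def lifted.act_one[OF v])
qed

lemma tau_in:
  "W \<in> tangent_space TQ v \<Longrightarrow> v \<in> Tk_set Q \<Longrightarrow> tangent_map TQ Q fst v W \<in> tangent_space Q (fst v)"
  by (rule tangent_map_in[OF lifted.M M smooth_map_Tk_fst[OF M]]) (simp_all add: TQ_carrier)

lemma field_in: "\<xi> \<in> lie_algebra G AG \<Longrightarrow> v \<in> Tk_set Q \<Longrightarrow> field \<xi> (fst v) \<in> tangent_space Q (fst v)"
  by (rule fundamental_in[OF _ Tk_setD(1)])

text \<open>The form \<open>g_total\<close> read in the chart \<open>c\<close>; by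
  \<open>g_total_eq\<close> every chart around the base point is admissible.\<close>

definition H :: "('q, real ^ 'n) chart \<Rightarrow> ('k, 'q, real ^ 'n) ktangent \<Rightarrow>
    (real ^ 'n) ^ 'k \<Rightarrow> (real ^ 'n) ^ 'k \<Rightarrow> real" where
  "H c v = fibre_D2 (local_lagr Q L c) (snd (Tk_chart Q c) v)"

abbreviation e where "e c v a \<equiv> field (E a) (fst v) c"

context
  fixes v :: "('k, 'q, real ^ 'n) ktangent" and c :: "('q, real ^ 'n) chart"
  assumes v: "v \<in> Tk_set Q" and c: "c \<in> Q" "fst v \<in> fst c"
begin

lemma H_linear:
  shows H_linear_left: "linear (\<lambda>a. H c v a b)" and H_linear_right: "linear (H c v a)"
proof -
  have o: "open (snd c ` fst c \<times> (UNIV :: ((real ^ 'n) ^ 'k) set))"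
    using chart_open[OF M c(1)] by (simp add: open_Times)
  have z: "snd (Tk_chart Q c) v \<in> snd c ` fst c \<times> UNIV" using c by auto
  show "linear (\<lambda>a. H c v a b)"
    unfolding H_def by (rule linear_fibre_D2_left[OF smooth_on_local_lagr[OF M L c(1)] z])
  show "linear (H c v a)"
    unfolding H_def by (rule linear_fibre_D2_right[OF o smooth_on_local_lagr[OF M L c(1)] z])
qed

text \<open>\<open>G_regular\<close> is stated in a chosen chart at each point; chart independence
  moves it to \<open>c\<close>, which can stay fixed while \<open>v\<close> varies.\<close>

lemma gram_invertible:
  "invertible ((\<chi> i j. H c v (axis (fst i) (e c v (snd i))) (axis (fst j) (e c v (snd j))))
    :: real ^ ('k \<times> 'i) ^ ('k \<times> 'i))"
proof -
  have eq: "g_comp Q L v \<alpha> \<beta> (field (E a) (fst v)) (field (E b) (fst v)) =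
      H c v (axis \<alpha> (e c v a)) (axis \<beta> (e c v b))" for \<alpha> \<beta> a b
    unfolding H_def by (rule g_comp_eq[OF M L v field_in[OF E_in v] field_in[OF E_in v] c])
  show ?thesis using reg[unfolded G_regular_def, rule_format, OF v] by (simp only: eq)
qed

lemma H_expand_left:
  "H c v (\<chi> \<alpha>. \<Sum>a\<in>UNIV. x (\<alpha>, a) *\<^sub>R e c v a) b =
    (\<Sum>i\<in>UNIV. x i * H c v (axis (fst i) (e c v (snd i))) b)"
  unfolding vec_expand_pairs[of x "e c v"]
  by (simp only: linear_sum[OF H_linear_left] linear_scale[OF H_linear_left] real_scaleR_def)

lemma H_expand_right:
  "H c v b (\<chi> \<alpha>. \<Sum>a\<in>UNIV. x (\<alpha>, a) *\<^sub>R e c v a) =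
    (\<Sum>i\<in>UNIV. x i * H c v b (axis (fst i) (e c v (snd i))))"
  unfolding vec_expand_pairs[of x "e c v"]
  by (simp only: linear_sum[OF H_linear_right] linear_scale[OF H_linear_right] real_scaleR_def)

text \<open>Pairing the combination with all slot vectors is the transposed Gram system applied to
  its coefficients.\<close>

lemma H_nondegenerate:
  assumes "\<And>j. H c v (\<chi> \<alpha>. \<Sum>a\<in>UNIV. x (\<alpha>, a) *\<^sub>R e c v a) (axis (fst j) (e c v (snd j))) = 0"
  shows "x i = 0"
  by (rule transposed_system_unique[OF gram_invertible]) (use assms in \<open>simp only: H_expand_left[of x]\<close>)

text \<open>A relation between fundamental vectors, put into one slot, is the zero tuple and so
  pairs to zero with everything; nondegeneracy then annihilates its coefficients.\<close>

lemma e_independent: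
  assumes "(\<Sum>a\<in>UNIV. y a *\<^sub>R e c v a) = 0"
  shows "y a = 0"
proof -
  \<comment> \<open>Any slot will do; one exists because types are nonempty.\<close>
  define \<alpha> :: 'k where "\<alpha> = undefined"
  define x where "x i = (if fst i = \<alpha> then y (snd i) else 0)" for i
  have "(\<Sum>a\<in>UNIV. x (\<beta>, a) *\<^sub>R e c v a) = 0" for \<beta>
    by (cases "\<beta> = \<alpha>") (simp_all add: x_def assms)
  then have "(\<chi> \<beta>. \<Sum>a\<in>UNIV. x (\<beta>, a) *\<^sub>R e c v a) = 0"
    by (simp only: vec_eq_iff vec_lambda_beta zero_index simp_thms)
  then have "x (\<alpha>, a) = 0"
    by (intro H_nondegenerate[of x]) (simp only: linear_0[OF H_linear_left])
  then show ?thesis by (simp add: x_def)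
qed

text \<open>By bilinearity it is enough to test with basis elements in single slots, and projecting
  to \<open>Q\<close> keeps only the first coordinate components. This replaces a condition on all
  Lie algebra tuples by finitely many equations.\<close>

lemma horizontal_iff:
  "(v, W) \<in> hor \<longleftrightarrow> (v, W) \<in> Tk_set TQ \<and>
    (\<forall>j. H c v (\<chi> \<alpha>. fst (W \<alpha> (Tk_chart Q c))) (axis (fst j) (e c v (snd j))) = 0)"
proof (cases "(v, W) \<in> Tk_set TQ")
  case True
  have W: "W \<alpha> \<in> tangent_space TQ v" for \<alpha> using Tk_setD(2)[OF True] by simp
  have g: "g_total Q L v (\<lambda>\<alpha>. tangent_map TQ Q fst v (W \<alpha>)) (\<lambda>\<beta>. field (\<xi> \<beta>) (fst v)) =
      H c v (\<chi> \<alpha>. fst (W \<alpha> (Tk_chart Q c))) (\<chi> \<beta>. field (\<xi> \<beta>) (fst v) c)"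
    if "\<And>\<beta>. \<xi> \<beta> \<in> lie_algebra G AG" for \<xi>
    using g_total_eq[OF M L v tau_in[OF W v] field_in[OF that v] c]
    by (simp only: tangent_map_Tk_fst[OF M v c W] H_def)
  have z: "(\<lambda>_. 0) \<in> lie_algebra G AG" by (rule tangent_space_zero[OF AG])
  have "(\<forall>\<xi>. (\<forall>\<beta>. \<xi> \<beta> \<in> lie_algebra G AG) \<longrightarrow>
       g_total Q L v (\<lambda>\<alpha>. tangent_map TQ Q fst v (W \<alpha>)) (\<lambda>\<beta>. field (\<xi> \<beta>) (fst v)) = 0) \<longleftrightarrow>
    (\<forall>j. H c v (\<chi> \<alpha>. fst (W \<alpha> (Tk_chart Q c))) (axis (fst j) (e c v (snd j))) = 0)"
    (is "?l \<longleftrightarrow> ?r")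
  proof
    assume l: ?l
    show ?r
    proof
      fix j :: "'k \<times> 'i"
      \<comment> \<open>One basis element in one slot and zero elsewhere: the field of the zero
        element vanishes, so the coordinates form a single \<open>axis\<close> vector.\<close>
      define \<xi> where "\<xi> \<beta> = (if \<beta> = fst j then E (snd j) else (\<lambda>_. 0))" for \<beta>
      have \<xi>: "\<xi> \<beta> \<in> lie_algebra G AG" for \<beta> using E_in z by (simp add: \<xi>_def)
      have f0: "field (\<lambda>_. 0) (fst v) = (\<lambda>_. 0)"
        unfolding fundamental_def
        by (rule tangent_map_zero[OF AG act_smooth_right[OF Tk_setD(1)[OF v]]]) (simp add: AG_carrier)
      have "(\<chi> \<beta>. field (\<xi> \<beta>) (fst v) c) = axis (fst j) (e c v (snd j))"
        by (simp add: vec_eq_iff axis_def \<xi>_def f0)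
      moreover have "g_total Q L v (\<lambda>\<alpha>. tangent_map TQ Q fst v (W \<alpha>)) (\<lambda>\<beta>. field (\<xi> \<beta>) (fst v)) = 0"
        by (rule l[rule_format]) (rule \<xi>)
      ultimately show "H c v (\<chi> \<alpha>. fst (W \<alpha> (Tk_chart Q c))) (axis (fst j) (e c v (snd j))) = 0"
        by (simp only: g[OF \<xi>])
    qed
  next
    assume r: ?r
    show ?l
    proof (intro allI impI)
      fix \<xi> :: "'k \<Rightarrow> ('g, real ^ 'i) chart \<Rightarrow> real ^ 'i"
      assume \<xi>: "\<forall>\<beta>. \<xi> \<beta> \<in> lie_algebra G AG"
      have "\<forall>\<beta>. \<exists>x::real ^ 'i. \<xi> \<beta> = (\<lambda>c. \<Sum>a\<in>UNIV. (x $ a) *\<^sub>R E a c)"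
        using \<xi> E unfolding lie_algebra_basis_def by blast
      then obtain x :: "'k \<Rightarrow> real ^ 'i" where x: "\<And>\<beta>. \<xi> \<beta> = (\<lambda>c. \<Sum>a\<in>UNIV. (x \<beta> $ a) *\<^sub>R E a c)"
        by metis
      let ?x = "\<lambda>i. x (fst i) $ snd i"
      have "field (\<xi> \<beta>) (fst v) c = (\<Sum>a\<in>UNIV. ?x (\<beta>, a) *\<^sub>R e c v a)" for \<beta>
        unfolding fundamental_def x
        by (subst tangent_map_sum[OF AG act_smooth_right[OF Tk_setD(1)[OF v]]])
          (simp_all add: AG_carrier E_in)
      then have "H c v (\<chi> \<alpha>. fst (W \<alpha> (Tk_chart Q c))) (\<chi> \<beta>. field (\<xi> \<beta>) (fst v) c) = 0"
        using r H_expand_right[of _ ?x] by simp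
      then show "g_total Q L v (\<lambda>\<alpha>. tangent_map TQ Q fst v (W \<alpha>)) (\<lambda>\<beta>. field (\<xi> \<beta>) (fst v)) = 0"
        using g[of \<xi>] \<xi> by simp
    qed
  qed
  then show ?thesis using True by (simp add: mechanical_k_connection_def)
qed (simp add: mechanical_k_connection_def)

lemma fundamental_lift_coord: "fst (fundamental G AG TQ lift (E a) v (Tk_chart Q c)) = e c v a"
  using tangent_map_Tk_fst[OF M v c lifted.fundamental_in[OF E_in, of v]]
    tau_fundamental[OF E_in v] v by (simp add: TQ_carrier)

text \<open>The vertical coordinates form a space of dimension at most that of the group and contain
  that many independent fundamental vectors, so nothing vertical lies outside their span.\<close>

lemma vertical_expand:
  assumes u: "u \<in> vert v"
  obtains y where "u = (\<lambda>C. \<Sum>a\<in>UNIV. y a *\<^sub>R fundamental G AG TQ lift (E a) v C)"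
proof -
  let ?C = "Tk_chart Q c"
  let ?\<zeta> = "\<lambda>a. fundamental G AG TQ lift (E a) v"
  have vT: "v \<in> mcarrier TQ" using v by (simp add: TQ_carrier)
  have C: "?C \<in> TQ" "v \<in> fst ?C" using Tk_chart_in[OF c(1)] v c by simp_all
  have V: "?\<zeta> a \<in> vert v" for a by (rule lifted.fundamental_vertical[OF P E_in vT])
  have "dim ((\<lambda>u. u ?C) ` vert v) \<le> card (UNIV :: 'i set)"
    using lifted.dim_vertical_le[OF P vT C] by simp
  \<comment> \<open>Independence is inherited from the projections to \<open>Q\<close>, which are
    the first components.\<close>
  moreover have "\<forall>a\<in>UNIV. y a = 0" if "(\<Sum>a\<in>UNIV. y a *\<^sub>R ?\<zeta> a ?C) = 0" for y
  proof -
    have "(\<Sum>a\<in>UNIV. y a *\<^sub>R e c v a) = fst (\<Sum>a\<in>UNIV. y a *\<^sub>R ?\<zeta> a ?C)"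
      by (simp add: fst_sum fundamental_lift_coord)
    then show ?thesis using e_independent that by simp
  qed
  moreover have "u ?C \<in> (\<lambda>u. u ?C) ` vert v" using u by simp
  ultimately obtain y where y: "u ?C = (\<Sum>a\<in>UNIV. y a *\<^sub>R ?\<zeta> a ?C)"
    using family_spans[of "UNIV :: 'i set" "\<lambda>a. ?\<zeta> a ?C" "(\<lambda>u. u ?C) ` vert v" "u ?C"] V by auto
  have "u = (\<lambda>C. \<Sum>a\<in>UNIV. y a *\<^sub>R ?\<zeta> a C)"
  proof (rule tangent_space_eqI)
    show "?C \<in> TQ" "v \<in> fst ?C" "u ?C = (\<Sum>a\<in>UNIV. y a *\<^sub>R ?\<zeta> a ?C)" by fact+
    show "u \<in> tangent_space TQ v" using u by (simp add: vertical_space_def)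
    show "(\<lambda>C. \<Sum>a\<in>UNIV. y a *\<^sub>R ?\<zeta> a C) \<in> tangent_space TQ v"
      using V by (intro tangent_space_sum[OF lifted.M]) (simp add: vertical_space_def)
  qed
  then show ?thesis by (rule that)
qed

text \<open>Existence is sought among combinations of fundamental vectors, where horizontality is
  the Gram system. For uniqueness an arbitrary vertical competitor must be such a combination too,
  which is \<open>vertical_expand\<close>.\<close>

lemma vertical_complement:
  assumes W: "(v, W) \<in> Tk_set TQ"
  shows "\<exists>!u. (\<forall>\<alpha>. u \<alpha> \<in> vert v) \<and> (v, \<lambda>\<alpha> C. W \<alpha> C - u \<alpha> C) \<in> hor"
proof -
  let ?C = "Tk_chart Q c"
  let ?\<zeta> = "\<lambda>a. fundamental G AG TQ lift (E a) v"
  have vT: "v \<in> mcarrier TQ" using v by (simp add: TQ_carrier)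
  have V: "?\<zeta> a \<in> vert v" for a by (rule lifted.fundamental_vertical[OF P E_in vT])
  have VT: "u \<in> tangent_space TQ v" if "u \<in> vert v" for u using that by (simp add: vertical_space_def)
  have WT: "W \<alpha> \<in> tangent_space TQ v" for \<alpha> using Tk_setD(2)[OF W] by simp
  let ?w = "\<chi> \<alpha>. fst (W \<alpha> ?C)"
  have hor: "(v, \<lambda>\<alpha> C. W \<alpha> C - u \<alpha> C) \<in> hor \<longleftrightarrow>
      (\<forall>j. H c v (\<chi> \<alpha>. fst (u \<alpha> ?C)) (axis (fst j) (e c v (snd j))) =
        H c v ?w (axis (fst j) (e c v (snd j))))" if u: "\<forall>\<alpha>. u \<alpha> \<in> vert v" for u
  proof -
    have "(v, \<lambda>\<alpha> C. W \<alpha> C - u \<alpha> C) \<in> Tk_set TQ"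
      using u by (intro Tk_setI[OF vT] tangent_space_diff[OF lifted.M WT] VT) auto
    moreover have "(\<chi> \<alpha>. fst (W \<alpha> ?C - u \<alpha> ?C)) = ?w - (\<chi> \<alpha>. fst (u \<alpha> ?C))"
      by (simp add: vec_eq_iff)
    ultimately show ?thesis
      unfolding horizontal_iff by (auto simp: linear_diff[OF H_linear_left])
  qed
  define comb where "comb x = (\<lambda>\<alpha> C. \<Sum>a\<in>UNIV. x (\<alpha>, a) *\<^sub>R ?\<zeta> a C)" for x :: "'k \<times> 'i \<Rightarrow> real"
  have comb_coord: "(\<chi> \<alpha>. fst (comb x \<alpha> ?C)) = (\<chi> \<alpha>. \<Sum>a\<in>UNIV. x (\<alpha>, a) *\<^sub>R e c v a)" for x
    by (simp add: comb_def fst_sum fundamental_lift_coord)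
  have comb_vert: "comb x \<alpha> \<in> vert v" for x \<alpha>
  proof -
    have "tangent_map TQ P (orbit G lift) v (comb x \<alpha>) =
        (\<lambda>d. \<Sum>a\<in>UNIV. x (\<alpha>, a) *\<^sub>R tangent_map TQ P (orbit G lift) v (?\<zeta> a) d)"
      unfolding comb_def
      by (rule tangent_map_sum[OF lifted.M lifted.orbit_smooth[OF P] vT VT[OF V]])
    also have "\<dots> = (\<lambda>_. 0)" using V by (simp add: vertical_space_def)
    finally have "tangent_map TQ P (orbit G lift) v (comb x \<alpha>) = (\<lambda>_. 0)" .
    moreover have "comb x \<alpha> \<in> tangent_space TQ v"
      unfolding comb_def by (rule tangent_space_sum[OF lifted.M]) (rule VT[OF V])
    ultimately show ?thesis by (simp add: vertical_space_def)
  qed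
  obtain x where x: "\<forall>j. (\<Sum>i\<in>UNIV. x i * H c v (axis (fst i) (e c v (snd i))) (axis (fst j) (e c v (snd j)))) =
      H c v ?w (axis (fst j) (e c v (snd j)))"
    using transposed_system_solvable[OF gram_invertible,
        of "\<lambda>j. H c v ?w (axis (fst j) (e c v (snd j)))"] by blast
  have ex: "(v, \<lambda>\<alpha> C. W \<alpha> C - comb x \<alpha> C) \<in> hor"
    unfolding hor[OF allI[OF comb_vert]] comb_coord H_expand_left[of x] using x by simp
  show ?thesis
  proof (rule ex1I[of _ "comb x"])
    show "(\<forall>\<alpha>. comb x \<alpha> \<in> vert v) \<and> (v, \<lambda>\<alpha> C. W \<alpha> C - comb x \<alpha> C) \<in> hor"
      using comb_vert ex by simp
    fix u assume u: "(\<forall>\<alpha>. u \<alpha> \<in> vert v) \<and> (v, \<lambda>\<alpha> C. W \<alpha> C - u \<alpha> C) \<in> hor"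
    have "\<forall>\<alpha>. \<exists>y. u \<alpha> = (\<lambda>C. \<Sum>a\<in>UNIV. y a *\<^sub>R ?\<zeta> a C)"
    proof
      fix \<alpha>
      have "u \<alpha> \<in> vert v" using u by simp
      then obtain y where "u \<alpha> = (\<lambda>C. \<Sum>a\<in>UNIV. y a *\<^sub>R ?\<zeta> a C)" by (rule vertical_expand)
      then show "\<exists>y. u \<alpha> = (\<lambda>C. \<Sum>a\<in>UNIV. y a *\<^sub>R ?\<zeta> a C)" by (rule exI[of _ y])
    qed
    from choice[OF this]
    obtain y where y: "\<forall>\<alpha>. u \<alpha> = (\<lambda>C. \<Sum>a\<in>UNIV. y \<alpha> a *\<^sub>R ?\<zeta> a C)" by (rule exE)
    define x' where "x' i = y (fst i) (snd i)" for i
    have ux': "u = comb x'" by (simp add: fun_eq_iff y comb_def x'_def)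
    have "H c v (\<chi> \<alpha>. fst (comb x' \<alpha> ?C)) (axis (fst j) (e c v (snd j))) =
        H c v (\<chi> \<alpha>. fst (comb x \<alpha> ?C)) (axis (fst j) (e c v (snd j)))" for j
      using hor[OF allI[OF comb_vert]] ex u unfolding ux' by simp
    \<comment> \<open>The difference of the two solutions pairs to zero with all slot vectors, so
      its coefficients vanish.\<close>
    then have "H c v (\<chi> \<alpha>. \<Sum>a\<in>UNIV. (x' (\<alpha>, a) - x (\<alpha>, a)) *\<^sub>R e c v a) (axis (fst j) (e c v (snd j))) = 0" for j
      using H_expand_left[of "\<lambda>i. x' i - x i"]
      unfolding comb_coord H_expand_left[of x] H_expand_left[of x']
      by (simp add: left_diff_distrib sum_subtractf)
    then have "x' i - x i = 0" for i
      by (rule H_nondegenerate[of "\<lambda>i. x' i - x i"])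
    then show "u = comb x" unfolding ux' by (simp add: comb_def)
  qed
qed

end

end

section \<open>Equivariance and local frames of the horizontal elements\<close>

context mechanical
begin

lemma L_lift:
  assumes "g \<in> carrier G" "v \<in> Tk_set Q"
  shows "L (Tk_map Q Q (\<Phi> g) v) = L v"
  using L_inv assms lift_action_eq[OF assms(2), of \<Phi> g] unfolding invariant_lagrangian_def by metis

text \<open>The chain rule applied to both sides of
  \<open>fst (lift g w) = \<Phi> g (fst w)\<close>.\<close>

lemma tau_lift:
  assumes g: "g \<in> carrier G" and v: "v \<in> Tk_set Q" and W: "W \<in> tangent_space TQ v"
  shows "tangent_map TQ Q fst (lift g v) (tangent_map TQ TQ (lift g) v W) =
    tangent_map Q Q (\<Phi> g) (fst v) (tangent_map TQ Q fst v W)"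
proof -
  have vT: "v \<in> mcarrier TQ" using v by (simp add: TQ_carrier)
  note t = smooth_map_Tk_fst[OF M] and l = lifted.act_smooth_left[OF g] and a = act_smooth_left[OF g]
  have "tangent_map TQ Q fst (lift g v) (tangent_map TQ TQ (lift g) v W) =
      tangent_map TQ Q (\<lambda>w. fst (lift g w)) v W"
    by (rule tangent_map_comp[OF lifted.M lifted.M l t vT W smooth_map_comp[OF lifted.M lifted.M l t]])
  also have "\<dots> = tangent_map TQ Q (\<lambda>w. \<Phi> g (fst w)) v W"
    by (rule tangent_map_cong[OF lifted.M vT]) (simp add: fst_lift TQ_carrier)
  also have "\<dots> = tangent_map Q Q (\<Phi> g) (fst v) (tangent_map TQ Q fst v W)"
    by (rule tangent_map_comp[OF lifted.M M t a vT W smooth_map_comp[OF lifted.M M t a], symmetric])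
  finally show ?thesis .
qed

lemma lift_lift_eq:
  "(v, W) \<in> Tk_set TQ \<Longrightarrow> lift_action TQ lift g (v, W) = (lift g v, \<lambda>\<alpha>. tangent_map TQ TQ (lift g) v (W \<alpha>))"
  by (simp add: lift_action_eq[of _ TQ] Tk_map_def)

text \<open>Both arguments of \<open>g_total\<close> at \<open>lift g v\<close> are images under the
  tangent map of \<open>\<Phi> g\<close>: the projected vectors by \<open>tau_lift\<close>, the test
  fields by \<open>fundamental_act\<close>. Then \<open>g_total_natural\<close> reduces the
  condition to the one at \<open>v\<close>.\<close>

lemma horizontal_lift:
  assumes g: "g \<in> carrier G" and h: "(v, W) \<in> hor"
  shows "(lift g v, \<lambda>\<alpha>. tangent_map TQ TQ (lift g) v (W \<alpha>)) \<in> hor"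
proof -
  have VW: "(v, W) \<in> Tk_set TQ" using h by (simp add: mechanical_k_connection_def)
  have v: "v \<in> Tk_set Q" and W: "W \<alpha> \<in> tangent_space TQ v" for \<alpha>
    using Tk_setD[OF VW] by (simp_all add: TQ_carrier)
  note l = lifted.act_smooth_left[OF g]
  have in_Tk: "(lift g v, \<lambda>\<alpha>. tangent_map TQ TQ (lift g) v (W \<alpha>)) \<in> Tk_set TQ"
    using Tk_map_in[OF lifted.M lifted.M l VW] by (simp add: Tk_map_def)
  have "g_total Q L (lift g v) (\<lambda>\<alpha>. tangent_map TQ Q fst (lift g v) (tangent_map TQ TQ (lift g) v (W \<alpha>)))
       (\<lambda>\<beta>. field (\<xi> \<beta>) (fst (lift g v))) = 0" if \<xi>: "\<forall>\<beta>. \<xi> \<beta> \<in> lie_algebra G AG" for \<xi>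
  proof -
    have "\<forall>\<beta>. \<exists>\<eta>. \<eta> \<in> lie_algebra G AG \<and>
        field (\<xi> \<beta>) (fst (lift g v)) = tangent_map Q Q (\<Phi> g) (fst v) (field \<eta> (fst v))"
    proof
      fix \<beta>
      have "\<xi> \<beta> \<in> lie_algebra G AG" using \<xi> by simp
      then obtain \<eta> where "\<eta> \<in> lie_algebra G AG"
          "field (\<xi> \<beta>) (\<Phi> g (fst v)) = tangent_map Q Q (\<Phi> g) (fst v) (field \<eta> (fst v))"
        by (rule fundamental_act[OF g Tk_setD(1)[OF v]])
      then show "\<exists>\<eta>. \<eta> \<in> lie_algebra G AG \<and>
          field (\<xi> \<beta>) (fst (lift g v)) = tangent_map Q Q (\<Phi> g) (fst v) (field \<eta> (fst v))"
        unfolding fst_lift[OF v] by (intro exI[of _ \<eta>] conjI)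
    qed
    from choice[OF this] obtain \<eta> where \<eta>: "\<And>\<beta>. \<eta> \<beta> \<in> lie_algebra G AG"
      "\<And>\<beta>. field (\<xi> \<beta>) (fst (lift g v)) = tangent_map Q Q (\<Phi> g) (fst v) (field (\<eta> \<beta>) (fst v))"
      by auto
    have "g_total Q L (lift g v) (\<lambda>\<alpha>. tangent_map TQ Q fst (lift g v) (tangent_map TQ TQ (lift g) v (W \<alpha>)))
       (\<lambda>\<beta>. field (\<xi> \<beta>) (fst (lift g v))) =
      g_total Q L (Tk_map Q Q (\<Phi> g) v) (\<lambda>\<alpha>. tangent_map Q Q (\<Phi> g) (fst v) (tangent_map TQ Q fst v (W \<alpha>)))
       (\<lambda>\<beta>. tangent_map Q Q (\<Phi> g) (fst v) (field (\<eta> \<beta>) (fst v)))"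
      by (simp only: tau_lift[OF g v W] \<eta>(2)) (simp only: lift_action_eq[OF v])
    also have "\<dots> = g_total Q L v (\<lambda>\<alpha>. tangent_map TQ Q fst v (W \<alpha>)) (\<lambda>\<beta>. field (\<eta> \<beta>) (fst v))"
      by (rule g_total_natural[OF M L act_smooth_left[OF g] L_lift[OF g] v,
            where u="\<lambda>\<alpha>. tangent_map TQ Q fst v (W \<alpha>)" and w="\<lambda>\<beta>. field (\<eta> \<beta>) (fst v)"])
        (assumption | rule tau_in[OF W v] field_in[OF \<eta>(1) v])+
    also have "\<dots> = 0" using h \<eta>(1) by (simp add: mechanical_k_connection_def)
    finally show ?thesis .
  qed
  then show ?thesis using in_Tk by (simp add: mechanical_k_connection_def)
qed

lemma complement:
  assumes "(v, W) \<in> Tk_set TQ"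
  shows "\<exists>!u. (\<forall>\<alpha>. u \<alpha> \<in> vert v) \<and> (v, \<lambda>\<alpha> C. W \<alpha> C - u \<alpha> C) \<in> hor"
proof -
  have v: "v \<in> Tk_set Q" using Tk_setD(1)[OF assms] by (simp add: TQ_carrier)
  obtain c where "c \<in> Q" "fst v \<in> fst c" using Tk_setD(1)[OF v] by (rule mcarrierE)
  from vertical_complement[OF v this assms] show ?thesis .
qed

lemma vertical_projection_lift:
  assumes g: "g \<in> carrier G" and w: "w \<in> Tk_set TQ"
  shows "vertical_projection TQ P (orbit G lift) hor (lift_action TQ lift g w) =
    lift_action TQ lift g (vertical_projection TQ P (orbit G lift) hor w)"
proof -
  obtain v W where vW: "w = (v, W)" by (cases w)
  have VW: "(v, W) \<in> Tk_set TQ" using w vW by simp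
  have vT: "v \<in> mcarrier TQ" and W: "W \<alpha> \<in> tangent_space TQ v" for \<alpha>
    using Tk_setD[OF VW] by simp_all
  note l = lifted.act_smooth_left[OF g]
  let ?T = "tangent_map TQ TQ (lift g) v"
  have TW: "(lift g v, \<lambda>\<alpha>. ?T (W \<alpha>)) \<in> Tk_set TQ"
    using Tk_map_in[OF lifted.M lifted.M l VW] by (simp add: Tk_map_def)
  obtain u where u: "\<forall>\<alpha>. u \<alpha> \<in> vert v" "(v, \<lambda>\<alpha> C. W \<alpha> C - u \<alpha> C) \<in> hor"
    using ex1_implies_ex[OF complement[OF VW]] by auto
  have uT: "u \<alpha> \<in> tangent_space TQ v" for \<alpha> using u(1) by (simp add: vertical_space_def)
  have uTk: "(v, u) \<in> Tk_set TQ" by (rule Tk_setI[OF vT uT])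
  have vp: "vertical_projection TQ P (orbit G lift) hor w = (v, u)"
    unfolding vertical_projection_def vW fst_conv snd_conv
    by (rule arg_cong[where f="Pair v"], rule the1_equality[OF complement[OF VW]], rule conjI[OF u])
  have vert: "\<forall>\<alpha>. ?T (u \<alpha>) \<in> vert (lift g v)"
    using lifted.vertical_act[OF P g vT] u(1) by simp
  have "(lift g v, \<lambda>\<alpha>. ?T (\<lambda>C. W \<alpha> C - u \<alpha> C)) \<in> hor"
    by (rule horizontal_lift[OF g u(2)])
  \<comment> \<open>Linearity of the tangent map splits the transported horizontal part, so the
    images of \<open>W\<close> and \<open>u\<close> satisfy the defining conditions of the
    decomposition at \<open>lift g v\<close>.\<close>
  then have hor: "(lift g v, \<lambda>\<alpha> C. ?T (W \<alpha>) C - ?T (u \<alpha>) C) \<in> hor"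
    by (simp only: tangent_map_diff[OF lifted.M l vT W uT])
  have "vertical_projection TQ P (orbit G lift) hor (lift g v, \<lambda>\<alpha>. ?T (W \<alpha>)) = (lift g v, \<lambda>\<alpha>. ?T (u \<alpha>))"
    unfolding vertical_projection_def fst_conv snd_conv
    by (rule arg_cong[where f="Pair (lift g v)"], rule the1_equality[OF complement[OF TW]],
        rule conjI[OF vert hor])
  then show ?thesis
    unfolding vp unfolding vW lift_lift_eq[OF VW] lift_lift_eq[OF uTk] .
qed

text \<open>\<open>smooth_kernel_frame\<close> is applied in the coordinates of one natural chart,
  and \<open>tvec\<close> turns the resulting vectors into local sections. Span and independence are
  then checked on coordinates in that chart alone.\<close>

lemma horizontal_subbundle: "smooth_subbundle TQ hor"
  unfolding smooth_subbundle_def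
proof (intro conjI ballI)
  show "hor \<subseteq> Tk_set TQ" by (auto simp: mechanical_k_connection_def)
  fix m assume "m \<in> mcarrier TQ"
  then have m: "m \<in> Tk_set Q" by (simp add: TQ_carrier)
  obtain c where c: "c \<in> Q" "fst m \<in> fst c" using Tk_setD(1)[OF m] by (rule mcarrierE)
  let ?C = "Tk_chart Q c :: (('k, 'q, real ^ 'n) ktangent, (real ^ 'n) \<times> ((real ^ 'n) ^ 'k)) chart"
  have C: "?C \<in> TQ" by (rule Tk_chart_in[OF c(1)])
  let ?S = "snd c ` fst c \<times> (UNIV :: ((real ^ 'n) ^ 'k) set)"
  have SC: "snd ?C ` fst ?C = ?S" using Tk_chart_image[OF M c(1), of "\<lambda>_. True"]
    by (simp del: fst_Tk_chart snd_Tk_chart)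
  have o: "open ?S" using chart_open[OF M c(1)] by (simp add: open_Times)
  have o1: "open (snd c ` fst c)" by (rule chart_open[OF M c(1)])
  \<comment> \<open>The vectors \<open>e\<close> as functions of the chart coordinates, so that
    smoothness can be stated on the open set \<open>?S\<close>.\<close>
  define \<epsilon> where "\<epsilon> a z = field (E a) (chart_inv c (fst z)) c" for a and z :: "(real ^ 'n) \<times> ((real ^ 'n) ^ 'k)"
  have \<epsilon>: "smooth_on ?S (\<epsilon> a)" for a
    unfolding \<epsilon>_def[abs_def]
    by (rule smooth_on_compose[OF fundamental_coord_smooth[OF c(1) E_in]
        smooth_on_fst[OF o smooth_on_ident[OF o]] o o1]) auto
  let ?D = "fibre_D2 (local_lagr Q L c)"
  note Ls = smooth_on_local_lagr[OF M L c(1)]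
  define f where "f j z x = ?D z (\<chi> \<alpha>. fst (x $ \<alpha>)) (axis (fst j) (\<epsilon> (snd j) z))"
    for j :: "'k \<times> 'i" and z and x :: "((real ^ 'n) \<times> ((real ^ 'n) ^ 'k)) ^ 'k"
  \<comment> \<open>Fibre component 0 is enough, since \<open>f j\<close> reads base components
    only: the values \<open>f j z (\<rho> i z)\<close> are then the Gram entries, although
    \<open>\<rho> i\<close> itself may fail to be vertical.\<close>
  define \<rho> where "\<rho> i z = (axis (fst i) (\<epsilon> (snd i) z, 0) :: ((real ^ 'n) \<times> ((real ^ 'n) ^ 'k)) ^ 'k)"
    for i :: "'k \<times> 'i" and z
  have z0: "snd ?C m \<in> ?S" using c by auto
  have axis: "smooth_on ?S (\<lambda>z. axis \<alpha> (h z))" if "smooth_on ?S h"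
    for \<alpha> :: 'k and h :: "(real ^ 'n) \<times> ((real ^ 'n) ^ 'k) \<Rightarrow> 'x::euclidean_space"
    by (rule smooth_on_bounded_linear[OF _ o that])
      (simp add: linear_axis linear_conv_bounded_linear[symmetric])
  have f_lin: "linear (f j z)" if "z \<in> ?S" for j z
  proof -
    have "linear (\<lambda>x :: ((real ^ 'n) \<times> ((real ^ 'n) ^ 'k)) ^ 'k. \<chi> \<alpha>. fst (x $ \<alpha>))"
      by (rule linearI) (simp_all add: vec_eq_iff)
    from linear_compose[OF this linear_fibre_D2_left[OF Ls that]]
    show ?thesis unfolding f_def[abs_def] o_def .
  qed
  have f_smooth: "smooth_on ?S (\<lambda>z. f j z x)" for j x
    unfolding f_def
    by (rule smooth_on_fibre_D2[OF Ls o o smooth_on_ident[OF o] _ smooth_on_const[OF o] axis[OF \<epsilon>]]) simp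
  have \<rho>_smooth: "smooth_on ?S (\<rho> i)" for i
    unfolding \<rho>_def[abs_def] by (rule axis[OF smooth_on_Pair[OF o \<epsilon> smooth_on_const[OF o]]])
  have fst_\<rho>: "(\<chi> \<alpha>. fst (\<rho> i z $ \<alpha>)) = axis (fst i) (\<epsilon> (snd i) z)" for i z
    by (simp add: vec_eq_iff \<rho>_def axis_def)
  have coord: "?D (snd ?C v) = H c v \<and> \<epsilon> a (snd ?C v) = e c v a" if "v \<in> fst ?C" for v a
    using that c M by (simp add: H_def \<epsilon>_def)
  have f_inv: "invertible ((\<chi> i j. f j z (\<rho> i z)) :: real ^ ('k \<times> 'i) ^ ('k \<times> 'i))" if z: "z \<in> ?S" for z
  proof -
    obtain v where v: "v \<in> fst ?C" "z = snd ?C v" using z unfolding SC[symmetric] by auto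
    have "v \<in> Tk_set Q" "fst v \<in> fst c" using v(1) by simp_all
    from gram_invertible[OF this(1) c(1) this(2)] show ?thesis
      unfolding f_def fst_\<rho> v(2) coord[OF v(1), THEN conjunct1] coord[OF v(1), THEN conjunct2] .
  qed
  obtain U r s where U: "open U" "snd ?C m \<in> U" "U \<subseteq> ?S" and s: "\<forall>i<r::nat. smooth_on U (s i)"
    and ker: "\<forall>z\<in>U. {x. \<forall>j. f j z x = 0} = range (\<lambda>y. \<Sum>i<r. (y i :: real) *\<^sub>R s i z)"
    and ind: "\<forall>z\<in>U. \<forall>y. (\<Sum>i<r. (y i :: real) *\<^sub>R s i z) = 0 \<longrightarrow> (\<forall>i<r. y i = 0)"
    by (rule smooth_kernel_frame[OF o z0 f_lin f_smooth \<rho>_smooth f_inv])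
  let ?W = "{p \<in> fst ?C. snd ?C p \<in> U}"
  define t where "t i p = (\<lambda>\<alpha>. tvec TQ p ?C (s i (snd ?C p) $ \<alpha>))" for i p
  show "\<exists>U (r::nat) (s :: nat \<Rightarrow> ('k, 'q, real ^ 'n) ktangent \<Rightarrow> 'k \<Rightarrow>
          (('k, 'q, real ^ 'n) ktangent, (real ^ 'n) \<times> ((real ^ 'n) ^ 'k)) chart \<Rightarrow> (real ^ 'n) \<times> ((real ^ 'n) ^ 'k)).
        openin (mtopology TQ) U \<and> m \<in> U \<and>
        (\<forall>i<r. smooth_map (sub_atlas TQ U) (Tk TQ) (\<lambda>p. (p, s i p))) \<and>
        (\<forall>p\<in>U.
           {w. (p, w) \<in> hor} = range (\<lambda>x. \<lambda>\<alpha> c. \<Sum>i<r. (x i :: real) *\<^sub>R s i p \<alpha> c) \<and>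
           (\<forall>x. (\<lambda>\<alpha> c. \<Sum>i<r. (x i :: real) *\<^sub>R s i p \<alpha> c) = (\<lambda>\<alpha> c. 0) \<longrightarrow> (\<forall>i<r. x i = 0)))"
  proof (intro exI[of _ ?W] exI[of _ r] exI[of _ t] conjI allI impI ballI)
    show "openin (mtopology TQ) ?W" by (rule openin_chart_preimage[OF lifted.M C U(1)])
    show "m \<in> ?W" using m c U(2) by simp
    fix i assume "i < r"
    from smooth_local_section[OF lifted.M C U(1) _ s[rule_format, OF this]] U(3)
    show "smooth_map (sub_atlas TQ ?W) (Tk TQ) (\<lambda>p. (p, t i p))"
      by (simp only: SC t_def tk_point_def)
  next
    fix p assume pW: "p \<in> ?W"
    then have p: "p \<in> fst ?C" and zU: "snd ?C p \<in> U" by simp_all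
    have pQ: "p \<in> Tk_set Q" and pc: "fst p \<in> fst c" using p by simp_all
    have pT: "p \<in> mcarrier TQ" using pQ by (simp add: TQ_carrier)
    let ?z = "snd ?C p"
    have t_in: "t i p \<alpha> \<in> tangent_space TQ p" for i \<alpha>
      unfolding t_def by (rule tvec_in[OF lifted.M C p])
    have t_at: "t i p \<alpha> ?C = s i ?z $ \<alpha>" for i \<alpha>
      unfolding t_def by (rule tvec_at[OF lifted.M C p])
    have sum_in: "(\<lambda>c. \<Sum>i<r. x i *\<^sub>R t i p \<alpha> c) \<in> tangent_space TQ p" for x \<alpha>
      by (rule tangent_space_sum[OF lifted.M]) (rule t_in)
    have sum_at: "(\<Sum>i<r. x i *\<^sub>R t i p \<alpha> ?C) = (\<Sum>i<r. x i *\<^sub>R s i ?z) $ \<alpha>" for x \<alpha>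
      by (simp only: t_at sum_component vector_scaleR_component)
    have hor: "(p, w) \<in> hor \<longleftrightarrow> (p, w) \<in> Tk_set TQ \<and> (\<forall>j. f j ?z (\<chi> \<alpha>. w \<alpha> ?C) = 0)" for w
      unfolding horizontal_iff[OF pQ c(1) pc] f_def vec_lambda_beta
        coord[OF p, THEN conjunct1] coord[OF p, THEN conjunct2] ..
    show "{w. (p, w) \<in> hor} = range (\<lambda>x. \<lambda>\<alpha> c. \<Sum>i<r. (x i :: real) *\<^sub>R t i p \<alpha> c)" (is "?l = range ?g")
    proof
      show "range ?g \<subseteq> ?l"
      proof
        fix w assume "w \<in> range ?g"
        then obtain x where w: "w = ?g x" by auto
        have "(\<chi> \<alpha>. ?g x \<alpha> ?C) = (\<Sum>i<r. x i *\<^sub>R s i ?z)" by (simp only: sum_at vec_nth_inverse)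
        then have "\<forall>j. f j ?z (\<chi> \<alpha>. ?g x \<alpha> ?C) = 0" using bspec[OF ker zU] by auto
        moreover have "(p, ?g x) \<in> Tk_set TQ" by (rule Tk_setI[OF pT sum_in])
        ultimately show "w \<in> ?l" unfolding w mem_Collect_eq hor by simp
      qed
      show "?l \<subseteq> range ?g"
      proof
        fix w assume "w \<in> ?l"
        then have "(p, w) \<in> hor" by (simp only: mem_Collect_eq)
        note w = conjunct1[OF iffD1[OF hor this]] conjunct2[OF iffD1[OF hor this]]
        have "(\<chi> \<alpha>. w \<alpha> ?C) \<in> range (\<lambda>y. \<Sum>i<r. (y i :: real) *\<^sub>R s i ?z)"
          unfolding bspec[OF ker zU, symmetric] using w(2) by simp
        then obtain y where y: "(\<chi> \<alpha>. w \<alpha> ?C) = (\<Sum>i<r. y i *\<^sub>R s i ?z)" by auto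
        have "w \<alpha> = ?g y \<alpha>" for \<alpha>
        proof (rule tangent_space_eqI[OF _ sum_in C p])
          show "w \<alpha> \<in> tangent_space TQ p" using Tk_setD(2)[OF w(1)] by simp
          show "w \<alpha> ?C = (\<Sum>i<r. y i *\<^sub>R t i p \<alpha> ?C)"
            unfolding sum_at y[symmetric] by simp
        qed
        then show "w \<in> range ?g" by (intro image_eqI[of _ _ y]) (auto simp: fun_eq_iff)
      qed
    qed
    fix x i assume x: "(\<lambda>\<alpha> c. \<Sum>i<r. (x i :: real) *\<^sub>R t i p \<alpha> c) = (\<lambda>\<alpha> c. 0)" and i: "i < r"
    have "(\<Sum>i<r. x i *\<^sub>R s i ?z) $ \<alpha> = 0" for \<alpha>
      using fun_cong[OF fun_cong[OF x], of \<alpha> ?C] unfolding sum_at .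
    then have "(\<Sum>i<r. x i *\<^sub>R s i ?z) = 0" by (simp only: vec_eq_iff zero_index simp_thms)
    then show "x i = 0" using bspec[OF ind zU] i by blast
  qed
qed

lemma principal: "principal_k_connection G TQ lift P hor"
  unfolding principal_k_connection_def k_connection_def
  using horizontal_subbundle complement vertical_projection_lift by blast

end

theorem proposition6p3:
  fixes G :: "('g, 'z) monoid_scheme"
    and AG :: "('g, real ^ 'i::finite) atlas"
    and Q :: "('q, real ^ 'n::finite) atlas"
    and \<Phi> :: "'g \<Rightarrow> 'q \<Rightarrow> 'q"
    and L :: "('k::finite, 'q, 'n) lagrangian"
    and E :: "'i \<Rightarrow> ('g, real ^ 'i) chart \<Rightarrow> real ^ 'i"
    and P :: "(('k, 'q, real ^ 'n) ktangent set, 'p::euclidean_space) atlas"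
  assumes "lie_group G AG" and "connected_space (mtopology AG)"
    and "smooth_manifold Q"
    and "smooth_action G AG Q \<Phi>"
    and "free_action G (mcarrier Q) \<Phi>" and "proper_action AG Q \<Phi>"
    and "smooth_map (Tk Q) euclidean_atlas L"
    and "regular_lagrangian Q L"
    and "invariant_lagrangian G Q \<Phi> L"
    and "lie_algebra_basis G AG E" and "G_regular G AG Q \<Phi> E L"
    and "quotient_manifold G (Tk Q :: (('k, 'q, real ^ 'n) ktangent, _) atlas) (lift_action Q \<Phi>) P"
  shows "principal_k_connection G (Tk Q) (lift_action Q \<Phi>) P
           (mechanical_k_connection G AG Q \<Phi> L)"
proof -
  interpret lie_action G AG Q \<Phi> by (rule lie_action_base) fact+
  interpret mechanical G AG Q \<Phi> L E P by unfold_locales fact+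
  show ?thesis by (rule principal)
qed

end
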